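(* Let $P$ be a subsemigroup of a group $G$ such that $(G^o,P^o)$ is quasi-lattice ordered, let $(A,P,\beta,\omega)$ be a twisted semigroup dynamical system, and let $X=X(A,P,\beta,\omega)$ be the associated product system over $P^o$. Let $i_X:X\to\mathcal T_{\mathrm{cov}}(X)$ be the universal Nica-covariant Toeplitz representation, let $i_A:A\to\mathcal T_{\mathrm{cov}}(X)$ be $i_A(a):=i_X(e,a)$, and let $i_P:P\to M(\mathcal T_{\mathrm{cov}}(X))$ be $i_P(s):=\lim_i i_X(s,\beta_s(a_i))^*$ (strict limit), where $(a_i)$ is an approximate identity for $A$. Then $(\mathcal T_{\mathrm{cov}}(X),i_A,i_P)$ is a Nica-Toeplitz crossed product for $(A,P,\beta,\omega)$.
   Context: Standing assumptions: $A$ is a separable $C^*$-algebra, $P$ is a countable semigroup with identity $e$. Order. $(G^o,P^o)$ denotes the opposite group and semigroup. $(G^o,P^o)$ being quasi-lattice ordered means: $P\cap P^{-1}=\{e\}$ and, for the right-invariant partial order on $G$ given by $s\le t\iff ts^{-1}\in P$, every finite subset of $G$ with an upper bound in $P$ has a least upper bound in $P$. Here $s\vee t$ denotes the least upper bound of $s,t\in P$ in this right-invariant order, with $s\vee t=\infty$ if there is no common upper bound. Twisted systems. $(A,P,\beta,\omega)$ is a twisted semigroup dynamical system: $\beta$ is an action of $P$ by endomorphisms of $A$ with $\beta_e=\mathrm{id}$, each $\beta_s$ being extendible, i.e. extending to a strictly continuous endomorphism $\overline{\beta_s}$ of $M(A)$; $\omega:P\times P\to\mathbb T$ is a multiplier: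 $\omega(e,e)=1$ and $\omega(r,s)\omega(rs,t)=\omega(r,st)\omega(s,t)$. A Nica-Toeplitz covariant representation of $(A,P,\beta,\omega)$ on $\mathcal H$ is a pair $(\pi,V)$ where $\pi:A\to B(\mathcal H)$ is a nondegenerate representation, $V:P\to B(\mathcal H)$ is a map into partial isometries with $V_sV_t=\omega(s,t)V_{st}$, and for all $s,t\in P$, $a\in A$: $\pi(\beta_s(a))=V_s\pi(a)V_s^*$; $V_s^*V_s\pi(a)=\pi(a)V_s^*V_s$; and $V_s^*V_sV_t^*V_t=V_{s\vee t}^*V_{s\vee t}$ if $s\vee t<\infty$, $=0$ otherwise. A Nica-Toeplitz crossed product for $(A,P,\beta,\omega)$ is a triple $(B,j_A,j_P)$ of a $C^*$-algebra $B$, a nondegenerate homomorphism $j_A:A\to B$ and a map $j_P:P\to M(B)$ such that (a) if $\sigma$ is a nondegenerate representation of $B$, then $(\sigma\circ j_A,\overline\sigma\circ j_P)$ is a Nica-Toeplitz covariant representation; (b) for every Nica-Toeplitz covariant representation $(\pi,V)$ there is a representation $\pi\times V$ of $B$ with $(\pi\times V)\circ j_A=\pi$ and $\overline{\pi\times V}\circ j_P=V$; (c) $B$ is generated as a $C^*$-algebra by $\{j_A(a)j_P(s)\}$. A bar denotes extension to multiplier algebras. Product systems. A Hilbert bimodule over $A$ is a right Hilbert $A$-module with a left action of $A$ given by a $*$-homomorphism $\phi$ into the adjointable operators. A product system over a semigroup $Q$ with identity $e$ is a semigroup $X$ with a semigroup homomorphism $p:X\to Q$ whose fibres $X_s=p^{-1}(s)$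 are Hilbert bimodules over $A$ (left action $\phi_s$), such that for $s,t\neq e$ multiplication extends to a Hilbert bimodule isomorphism of $X_s\otimes_AX_t$ onto the fibre over the product of $s$ and $t$ in $Q$, $X_e=A$ with its usual bimodule structure, and $ax=\phi_s(a)x$, $xa=x\cdot a$ for $a\in X_e$, $x\in X_s$. A Toeplitz representation of $X$ in a $C^*$-algebra $B$ is a map $\psi:X\to B$, with linear restrictions $\psi_s=\psi|_{X_s}$ and $\psi_e$ a $*$-homomorphism, satisfying $\psi(xy)=\psi(x)\psi(y)$ and $\psi_s(x)^*\psi_s(y)=\psi_e(\langle x,y\rangle_A)$ for $x,y\in X_s$. $\mathcal K(X_s)=\overline{\mathrm{span}}\{\Theta_{x,y}\}$, $\Theta_{x,y}(z)=x\cdot\langle y,z\rangle_A$, and $\psi^{(s)}:\mathcal K(X_s)\to B$ is the homomorphism with $\psi^{(s)}(\Theta_{x,y})=\psi_s(x)\psi_s(y)^*$. The product system $X(A,P,\beta,\omega)$. $X_s:=\{s\}\times\overline{\beta_s}(1)A$ with $(s,x)\cdot a=(s,xa)$, $\langle(s,x),(s,y)\rangle_A=x^*y$, $\phi_s(a)(s,x)=(s,\beta_s(a)x)$; $X=\bigsqcup_{s\in P}X_s$, $p(s,x)=s$, with multiplication $(s,x)(t,y):=(ts,\overline{\omega(t,s)}\beta_t(x)y)$. It is a product system over $P^o$ with fibres that are essential as left $A$-modules and on which $A$ acts on the left by compact operators; consequently it is compactly aligned: for $S\in\mathcal K(X_s)$, $T\in\mathcal K(X_t)$ with $s\vee t<\infty$,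 $(S\otimes_A1)(T\otimes_A1)\in\mathcal K(X_{s\vee t})$, where $S\otimes_A1$ acts on $X_{s\vee t}\cong X_s\otimes_AX_{r}$ ($r\in P$ with $s\vee t=rs$) by $(S\otimes_A1)(xy)=(Sx)y$, and similarly for $T$. A Toeplitz representation $\psi$ of $X$ is Nica covariant if, for all $s,t\in P$, $S\in\mathcal K(X_s)$, $T\in\mathcal K(X_t)$, $\psi^{(s)}(S)\psi^{(t)}(T)$ equals $\psi^{(s\vee t)}((S\otimes_A1)(T\otimes_A1))$ if $s\vee t<\infty$ and $0$ otherwise. $\mathcal T_{\mathrm{cov}}(X)$ is the $C^*$-algebra generated by a universal Nica-covariant Toeplitz representation $i_X$: every Nica-covariant Toeplitz representation $\psi$ of $X$ is $\psi_*\circ i_X$ for a homomorphism $\psi_*$ of $\mathcal T_{\mathrm{cov}}(X)$. The strict limits defining $i_P$ exist. *)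

theory Defs
  imports "HOL-Analysis.Analysis" "HOL-Algebra.Group"
begin

section \<open>C*-algebras\<close>

text \<open>Complex scalars are added on top of the real vector space classes. Algebras need not be
  unital, and the zero algebra is allowed.\<close>

class complex_vector_space = real_vector +
  fixes scaleC :: "complex \<Rightarrow> 'a \<Rightarrow> 'a"  (infixr "*\<^sub>C" 75)
  assumes scaleC_add_right: "c *\<^sub>C (x + y) = c *\<^sub>C x + c *\<^sub>C y"
    and scaleC_add_left: "(c + d) *\<^sub>C x = c *\<^sub>C x + d *\<^sub>C x"
    and scaleC_scaleC: "c *\<^sub>C d *\<^sub>C x = (c * d) *\<^sub>C x"
    and scaleC_one: "1 *\<^sub>C x = x"
    and scaleR_scaleC: "r *\<^sub>R x = complex_of_real r *\<^sub>C x"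

lemma additive_scaleC: "Modules.additive (\<lambda>x. c *\<^sub>C (x :: 'a::complex_vector_space))"
  by standard (rule scaleC_add_right)

lemmas scaleC_zero_right = Modules.additive.zero[OF additive_scaleC]
  and scaleC_minus_right = Modules.additive.minus[OF additive_scaleC]
  and scaleC_diff_right = Modules.additive.diff[OF additive_scaleC]

class star_algebra = complex_vector_space + ring +
  fixes star :: "'a \<Rightarrow> 'a"  ("_\<^sup>\<star>" [1000] 1000)
  assumes mult_scaleC_left: "(c *\<^sub>C x) * y = c *\<^sub>C (x * y)"
    and mult_scaleC_right: "x * (c *\<^sub>C y) = c *\<^sub>C (x * y)"
    and star_add: "(x + y)\<^sup>\<star> = x\<^sup>\<star> + y\<^sup>\<star>"
    and star_scaleC: "(c *\<^sub>C x)\<^sup>\<star> = cnj c *\<^sub>C x\<^sup>\<star>"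
    and star_mult: "(x * y)\<^sup>\<star> = y\<^sup>\<star> * x\<^sup>\<star>"
    and star_star: "x\<^sup>\<star>\<^sup>\<star> = x"

class cstar_algebra = star_algebra + real_normed_algebra + banach +
  assumes norm_scaleC: "norm (c *\<^sub>C x) = cmod c * norm x"
    and cstar_identity: "norm (x\<^sup>\<star> * x) = (norm x)\<^sup>2"

definition star_hom :: "('a::star_algebra \<Rightarrow> 'b::star_algebra) \<Rightarrow> bool" where
  "star_hom f \<longleftrightarrow>
     (\<forall>x y. f (x + y) = f x + f y) \<and> (\<forall>c x. f (c *\<^sub>C x) = c *\<^sub>C f x) \<and>
     (\<forall>x y. f (x * y) = f x * f y) \<and> (\<forall>x. f (x\<^sup>\<star>) = (f x)\<^sup>\<star>)"

definition cspan :: "'a::complex_vector_space set \<Rightarrow> 'a set" where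
  "cspan S = span {c *\<^sub>C x | c x. x \<in> S}"

definition nondegenerate_hom :: "('a::cstar_algebra \<Rightarrow> 'b::cstar_algebra) \<Rightarrow> bool" where
  "nondegenerate_hom f \<longleftrightarrow> star_hom f \<and> closure (cspan {f a * b | a b. True}) = UNIV"

definition cstar_subalgebra :: "'a::cstar_algebra set \<Rightarrow> bool" where
  "cstar_subalgebra C \<longleftrightarrow> closed C \<and> 0 \<in> C \<and>
     (\<forall>x\<in>C. \<forall>y\<in>C. x + y \<in> C \<and> x * y \<in> C) \<and> (\<forall>x\<in>C. x\<^sup>\<star> \<in> C \<and> (\<forall>c. c *\<^sub>C x \<in> C))"

definition cstar_generated :: "'a::cstar_algebra set \<Rightarrow> 'a set" where
  "cstar_generated S = \<Inter>{C. cstar_subalgebra C \<and> S \<subseteq> C}"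

text \<open>Nets are given by a family together with a filter on its index type; a net over a directed
  set is the case of the filter generated by its tails.\<close>

definition approximate_identity :: "'i filter \<Rightarrow> ('i \<Rightarrow> 'a::cstar_algebra) \<Rightarrow> bool" where
  "approximate_identity F u \<longleftrightarrow> F \<noteq> bot \<and> (\<forall>i. norm (u i) \<le> 1) \<and>
     (\<forall>a. ((\<lambda>i. u i * a) \<longlongrightarrow> a) F) \<and> (\<forall>a. ((\<lambda>i. a * u i) \<longlongrightarrow> a) F)"

lemma cstar_norm_star: "norm (x\<^sup>\<star>) = norm (x :: 'a::cstar_algebra)"
proof -
  have le: "norm y \<le> norm (y\<^sup>\<star>)" for y :: 'a
  proof (cases "y = 0")
    case False
    have "norm y * norm y = norm (y\<^sup>\<star> * y)"
      by (simp add: cstar_identity power2_eq_square)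
    also have "\<dots> \<le> norm (y\<^sup>\<star>) * norm y"
      by (rule norm_mult_ineq)
    finally show ?thesis
      using False by simp
  qed simp
  show ?thesis
    using le[of x] le[of "x\<^sup>\<star>"] by (simp add: star_star)
qed

lemma cstar_eqI_left:
  fixes x y :: "'a::cstar_algebra"
  assumes "\<And>a. a * x = a * y"
  shows "x = y"
proof -
  have "(x - y)\<^sup>\<star> * (x - y) = 0"
    using assms by (simp add: right_diff_distrib)
  then have "(norm (x - y))\<^sup>2 = 0"
    by (metis cstar_identity norm_zero)
  then show ?thesis
    by simp
qed

lemma cstar_eqI_right:
  fixes x y :: "'a::cstar_algebra"
  assumes "\<And>a. x * a = y * a"
  shows "x = y"
proof -
  have "x\<^sup>\<star> = y\<^sup>\<star>"
  proof (rule cstar_eqI_left)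
    fix a :: 'a
    have "(x * a\<^sup>\<star>)\<^sup>\<star> = (y * a\<^sup>\<star>)\<^sup>\<star>"
      using assms by simp
    then show "a * x\<^sup>\<star> = a * y\<^sup>\<star>"
      by (simp add: star_mult star_star)
  qed
  then show ?thesis
    by (metis star_star)
qed


section \<open>The multiplier algebra\<close>

text \<open>Busby's double centralisers: pairs \<open>(L, R)\<close> of maps with \<open>a * L b = R a * b\<close>, where \<open>L\<close> is
  left and \<open>R\<close> is right multiplication by the multiplier. For C*-algebras the linearity and
  boundedness of \<open>L\<close> and \<open>R\<close> are automatic.\<close>

typedef (overloaded) 'a multiplier =
  "{m :: ('a::cstar_algebra \<Rightarrow> 'a) \<times> ('a \<Rightarrow> 'a). \<forall>a b. a * fst m b = snd m a * b}"
  by (rule exI[of _ "(id, id)"]) simp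

setup_lifting type_definition_multiplier

lift_definition lmul :: "'a::cstar_algebra multiplier \<Rightarrow> 'a \<Rightarrow> 'a" is fst .

lift_definition rmul :: "'a::cstar_algebra \<Rightarrow> 'a multiplier \<Rightarrow> 'a" is "\<lambda>a m. snd m a" .

lift_definition mult_embed :: "'a::cstar_algebra \<Rightarrow> 'a multiplier" is
  "\<lambda>a. (\<lambda>b. a * b, \<lambda>b. b * a)"
  by (simp add: mult.assoc)

lemma lmul_rmul: "a * lmul m b = rmul a m * b"
  by transfer auto

lemma multiplier_eqI:
  assumes "\<And>a. lmul m a = lmul n a"
  shows "m = n"
proof -
  have "rmul a m = rmul a n" for a
    by (rule cstar_eqI_right) (metis assms lmul_rmul)
  with assms show ?thesis
    by transfer (auto simp: prod_eq_iff)
qed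

lemma lmul_add: "lmul m (a + b) = lmul m a + lmul m b"
  by (rule cstar_eqI_left) (simp add: lmul_rmul distrib_left)

lemma lmul_scaleC: "lmul m (c *\<^sub>C a) = c *\<^sub>C lmul m a"
  by (rule cstar_eqI_left) (simp add: lmul_rmul mult_scaleC_right)

lemma rmul_add: "rmul (a + b) m = rmul a m + rmul b m"
  by (rule cstar_eqI_right) (simp add: lmul_rmul[symmetric] distrib_right)

lemma rmul_scaleC: "rmul (c *\<^sub>C a) m = c *\<^sub>C rmul a m"
  by (rule cstar_eqI_right) (simp add: lmul_rmul[symmetric] mult_scaleC_left)

instantiation multiplier :: (cstar_algebra) star_algebra
begin

lift_definition zero_multiplier :: "'a multiplier" is "(\<lambda>_. 0, \<lambda>_. 0)" by simp

lift_definition plus_multiplier :: "'a multiplier \<Rightarrow> 'a multiplier \<Rightarrow> 'a multiplier" is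
  "\<lambda>m n. (\<lambda>a. fst m a + fst n a, \<lambda>a. snd m a + snd n a)"
  by (simp add: distrib_left distrib_right)

lift_definition uminus_multiplier :: "'a multiplier \<Rightarrow> 'a multiplier" is
  "\<lambda>m. (\<lambda>a. - fst m a, \<lambda>a. - snd m a)"
  by simp

lift_definition minus_multiplier :: "'a multiplier \<Rightarrow> 'a multiplier \<Rightarrow> 'a multiplier" is
  "\<lambda>m n. (\<lambda>a. fst m a - fst n a, \<lambda>a. snd m a - snd n a)"
  by (simp add: left_diff_distrib right_diff_distrib)

lift_definition times_multiplier :: "'a multiplier \<Rightarrow> 'a multiplier \<Rightarrow> 'a multiplier" is
  "\<lambda>m n. (\<lambda>a. fst m (fst n a), \<lambda>a. snd n (snd m a))"
  by simp

lift_definition scaleC_multiplier :: "complex \<Rightarrow> 'a multiplier \<Rightarrow> 'a multiplier" is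
  "\<lambda>c m. (\<lambda>a. c *\<^sub>C fst m a, \<lambda>a. c *\<^sub>C snd m a)"
  by (simp add: mult_scaleC_left mult_scaleC_right)

definition scaleR_multiplier :: "real \<Rightarrow> 'a multiplier \<Rightarrow> 'a multiplier" where
  "scaleR_multiplier r m = complex_of_real r *\<^sub>C m"

lift_definition star_multiplier :: "'a multiplier \<Rightarrow> 'a multiplier" is
  "\<lambda>m. (\<lambda>a. (snd m (a\<^sup>\<star>))\<^sup>\<star>, \<lambda>a. (fst m (a\<^sup>\<star>))\<^sup>\<star>)"
  by (metis (no_types, lifting) fst_conv snd_conv star_mult star_star)

lemma lmul_zero: "lmul 0 a = 0"
  and lmul_plus: "lmul (m + n) a = lmul m a + lmul n a"
  and lmul_uminus: "lmul (- m) a = - lmul m a"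
  and lmul_minus: "lmul (m - n) a = lmul m a - lmul n a"
  and lmul_times: "lmul (m * n) a = lmul m (lmul n a)"
  and lmul_scaleC_mult: "lmul (c *\<^sub>C m) a = c *\<^sub>C lmul m a"
  and lmul_star: "lmul (m\<^sup>\<star>) a = (rmul (a\<^sup>\<star>) m)\<^sup>\<star>"
  and rmul_star: "rmul a (m\<^sup>\<star>) = (lmul m (a\<^sup>\<star>))\<^sup>\<star>"
  for m n :: "'a multiplier"
  by (transfer; simp)+

instance
proof
  fix m n k :: "'a multiplier" and c d :: complex and r s :: real
  show "m + n + k = m + (n + k)" "m + n = n + m" "0 + m = m" "- m + m = 0" "m - n = m + - n"
    by (rule multiplier_eqI; simp add: lmul_plus lmul_zero lmul_uminus lmul_minus add_ac)+
  show "m * n * k = m * (n * k)" "(m + n) * k = m * k + n * k" "m * (n + k) = m * n + m * k"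
    by (rule multiplier_eqI; simp add: lmul_plus lmul_times lmul_add)+
  show "c *\<^sub>C (m + n) = c *\<^sub>C m + c *\<^sub>C n" "(c + d) *\<^sub>C m = c *\<^sub>C m + d *\<^sub>C m"
    "c *\<^sub>C d *\<^sub>C m = (c * d) *\<^sub>C m" "1 *\<^sub>C m = m"
    by (rule multiplier_eqI; simp add: lmul_plus lmul_scaleC_mult
        scaleC_add_left scaleC_add_right scaleC_scaleC scaleC_one)+
  show "r *\<^sub>R m = complex_of_real r *\<^sub>C m"
    by (rule scaleR_multiplier_def)
  show "r *\<^sub>R (m + n) = r *\<^sub>R m + r *\<^sub>R n" "(r + s) *\<^sub>R m = r *\<^sub>R m + s *\<^sub>R m"
    "r *\<^sub>R s *\<^sub>R m = (r * s) *\<^sub>R m" "1 *\<^sub>R m = m"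
    unfolding scaleR_multiplier_def
    by (rule multiplier_eqI; simp add: lmul_plus lmul_scaleC_mult
        scaleC_add_left scaleC_add_right scaleC_scaleC scaleC_one)+
  show "(c *\<^sub>C m) * n = c *\<^sub>C (m * n)" "m * (c *\<^sub>C n) = c *\<^sub>C (m * n)"
    by (rule multiplier_eqI; simp add: lmul_times lmul_scaleC_mult lmul_scaleC)+
  show "m\<^sup>\<star>\<^sup>\<star> = m"
    by (rule multiplier_eqI; simp add: lmul_star rmul_star star_star)
  show "(m + n)\<^sup>\<star> = m\<^sup>\<star> + n\<^sup>\<star>"
    by (transfer; simp add: star_add)
  show "(c *\<^sub>C m)\<^sup>\<star> = cnj c *\<^sub>C m\<^sup>\<star>"
    by (transfer; simp add: star_scaleC)
  show "(m * n)\<^sup>\<star> = n\<^sup>\<star> * m\<^sup>\<star>"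
    by (transfer; simp add: star_star)
qed

end

instantiation multiplier :: (cstar_algebra) monoid_mult
begin

lift_definition one_multiplier :: "'a multiplier" is "(\<lambda>a. a, \<lambda>a. a)" by simp

instance
  by standard (transfer; simp)+

end

text \<open>The initial topology for the maps \<open>m \<mapsto> m a\<close> and \<open>m \<mapsto> a m\<close> into the normed space \<open>A\<close>.\<close>

definition strict_topology :: "'a::cstar_algebra multiplier topology" where
  "strict_topology =
     pullback_topology UNIV (\<lambda>m a. (lmul m a, rmul a m)) (product_topology (\<lambda>_. euclidean) UNIV)"

lemma limitin_strict_topology:
  fixes m :: "'a::cstar_algebra multiplier"
  shows "limitin strict_topology f m F \<longleftrightarrow>
     (\<forall>a. ((\<lambda>i. lmul (f i) a) \<longlongrightarrow> lmul m a) F) \<and> (\<forall>a. ((\<lambda>i. rmul a (f i)) \<longlongrightarrow> rmul a m) F)"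
proof -
  let ?\<Phi> = "\<lambda>m a. (lmul m a, rmul a m)"
  let ?T = "product_topology (\<lambda>_ :: 'a. euclidean :: ('a \<times> 'a) topology) UNIV"
  have "limitin strict_topology f m F \<longleftrightarrow> limitin ?T (\<lambda>i. ?\<Phi> (f i)) (?\<Phi> m) F"
    unfolding limitin_def strict_topology_def
    by (auto simp: openin_pullback_topology topspace_pullback_topology)
  also have "\<dots> \<longleftrightarrow> (\<forall>a. ((\<lambda>i. ?\<Phi> (f i) a) \<longlongrightarrow> ?\<Phi> m a) F)"
    by (simp add: limitin_componentwise)
  moreover have "((\<lambda>i. (g i, h i)) \<longlongrightarrow> (a, b)) F \<longleftrightarrow> (g \<longlongrightarrow> a) F \<and> (h \<longlongrightarrow> b) F"
    for g h :: "_ \<Rightarrow> 'a" and a b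
    using tendsto_fst[of "\<lambda>i. (g i, h i)" "(a, b)" F] tendsto_snd[of "\<lambda>i. (g i, h i)" "(a, b)" F]
    by (auto intro: tendsto_Pair)
  ultimately show ?thesis
    by (simp add: all_conj_distrib)
qed

definition strict_lim :: "'i filter \<Rightarrow> ('i \<Rightarrow> 'b::cstar_algebra multiplier) \<Rightarrow> 'b multiplier" where
  "strict_lim F f = (THE m. limitin strict_topology f m F)"

text \<open>The extension of a nondegenerate homomorphism to multipliers. Nondegeneracy makes it unique:
  \<open>g m * f b = f (lmul m b)\<close>.\<close>

definition mult_ext ::
  "('b::cstar_algebra \<Rightarrow> 'c::star_algebra) \<Rightarrow> 'b multiplier \<Rightarrow> 'c" where
  "mult_ext f = (THE g. star_hom g \<and> (\<forall>b. g (mult_embed b) = f b))"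

definition is_strict_ext ::
  "('a::cstar_algebra \<Rightarrow> 'a) \<Rightarrow> ('a multiplier \<Rightarrow> 'a multiplier) \<Rightarrow> bool" where
  "is_strict_ext f g \<longleftrightarrow> star_hom g \<and> (\<forall>a. g (mult_embed a) = mult_embed (f a)) \<and>
     continuous_map strict_topology strict_topology g"

definition extendible :: "('a::cstar_algebra \<Rightarrow> 'a) \<Rightarrow> bool" where
  "extendible f \<longleftrightarrow> (\<exists>g. is_strict_ext f g)"

text \<open>Unique for extendible \<open>f\<close>, since \<open>A\<close> is strictly dense in \<open>M(A)\<close>.\<close>

definition strict_ext ::
  "('a::cstar_algebra \<Rightarrow> 'a) \<Rightarrow> 'a multiplier \<Rightarrow> 'a multiplier" where
  "strict_ext f = (THE g. is_strict_ext f g)"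


section \<open>Hilbert spaces and bounded operators\<close>

text \<open>The inner product is linear in the second variable; its real part is the inner product of the
  underlying real Hilbert space, so that \<open>norm x = sqrt (Re (cinner x x))\<close>.\<close>

class complex_hilbert_space = complex_vector_space + real_inner + complete_space +
  fixes cinner :: "'a \<Rightarrow> 'a \<Rightarrow> complex"
  assumes cinner_commute: "cinner y x = cnj (cinner x y)"
    and cinner_add_right: "cinner x (y + z) = cinner x y + cinner x z"
    and cinner_scaleC_right: "cinner x (c *\<^sub>C y) = c * cinner x y"
    and Re_cinner: "Re (cinner x y) = inner x y"


instance complex_hilbert_space \<subseteq> banach ..

lemma cinner_add_left: "cinner (x + y) z = cinner x z + cinner y z"
  by (metis cinner_add_right cinner_commute complex_cnj_add)

lemma cinner_scaleC_left: "cinner (c *\<^sub>C x) y = cnj c * cinner x y"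
  by (metis cinner_commute cinner_scaleC_right complex_cnj_mult)

lemma cinner_eqI_left:
  fixes x y :: "'h::complex_hilbert_space"
  assumes "\<And>z. cinner x z = cinner y z"
  shows "x = y"
proof -
  have "inner x z = inner y z" for z
    using assms[of z] by (simp flip: Re_cinner)
  then show ?thesis
    by (metis inner_commute vector_eq_rdot)
qed

lemma cinner_eqI_Re:
  fixes x y x' y' :: "'h::complex_hilbert_space"
  assumes "\<And>c. inner x (c *\<^sub>C y) = inner x' (c *\<^sub>C y')"
  shows "cinner x y = cinner x' y'"
proof -
  have "Re (c * cinner x y) = Re (c * cinner x' y')" for c
    using assms[of c] by (simp flip: Re_cinner cinner_scaleC_right)
  from this[of 1] this[of "\<i>"] show ?thesis
    by (simp add: complex_eq_iff)
qed

lemma norm_scaleC_hilbert: "norm (c *\<^sub>C x) = cmod c * norm (x :: 'h::complex_hilbert_space)"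
proof -
  have "cinner (c *\<^sub>C x) (c *\<^sub>C x) = complex_of_real ((cmod c)\<^sup>2) * cinner x x"
    by (simp add: cinner_scaleC_left cinner_scaleC_right complex_norm_square mult_ac del: of_real_power)
  then have "inner (c *\<^sub>C x) (c *\<^sub>C x) = (cmod c)\<^sup>2 * inner x x"
    by (simp flip: Re_cinner)
  then show ?thesis
    by (simp add: norm_eq_sqrt_inner real_sqrt_mult)
qed

lemma bounded_linear_scaleC_hilbert:
  "bounded_linear (\<lambda>x :: 'h::complex_hilbert_space. c *\<^sub>C x)"
  by (rule bounded_linear_intro[where K = "cmod c"])
     (auto simp: scaleC_add_right norm_scaleC_hilbert scaleR_scaleC scaleC_scaleC mult.commute)

lemma real_riesz:
  fixes f :: "'h::{real_inner, complete_space} \<Rightarrow> real"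
  assumes "bounded_linear f"
  shows "\<exists>y. \<forall>x. f x = inner y x"
proof -
  interpret f: bounded_linear f by fact
  define Q where "Q x = (norm x)\<^sup>2 / 2 - f x" for x
  obtain K where K: "\<And>x. norm (f x) \<le> norm x * K"
    using f.bounded by blast
  have "- K\<^sup>2 / 2 \<le> Q x" for x
  proof -
    have "0 \<le> (norm x - K)\<^sup>2" by simp
    then show ?thesis
      using K[of x] unfolding Q_def power2_diff by (auto simp: abs_le_iff)
  qed
  then have bdd: "bdd_below (range Q)"
    by (auto simp: bdd_below_def)
  define d where "d = Inf (range Q)"
  have d: "d \<le> Q x" for x
    unfolding d_def by (rule cInf_lower) (auto intro: bdd)
  have "\<exists>x. Q x < d + 1 / real (Suc n)" for n
    using cInf_lessD[of "range Q" "d + 1 / real (Suc n)"] by (auto simp: d_def)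
  then obtain X where X: "\<And>n. Q (X n) < d + 1 / real (Suc n)"
    by metis
  have par: "(norm (x - z))\<^sup>2 \<le> 4 * (Q x + Q z - 2 * d)" for x z
  proof -
    have "Q x + Q z - 2 * Q ((1 / 2) *\<^sub>R (x + z)) = (norm (x - z))\<^sup>2 / 4"
      unfolding Q_def f.scaleR f.add power2_norm_eq_inner
      by (simp add: inner_add inner_diff inner_commute field_simps)
    with d[of "(1 / 2) *\<^sub>R (x + z)"] show ?thesis by simp
  qed
  have "Cauchy X"
  proof (rule CauchyI)
    fix e :: real assume e: "0 < e"
    then obtain N where N: "1 / real (Suc N) < e\<^sup>2 / 8"
      using nat_approx_posE[of "e\<^sup>2 / 8"] by auto
    show "\<exists>M. \<forall>m\<ge>M. \<forall>n\<ge>M. norm (X m - X n) < e"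
    proof (intro exI allI impI)
      fix m n assume mn: "N \<le> m" "N \<le> n"
      have "Q (X k) < d + e\<^sup>2 / 8" if "N \<le> k" for k
      proof -
        have "1 / real (Suc k) \<le> 1 / real (Suc N)"
          using that by (auto intro!: divide_left_mono)
        then have "1 / real (Suc k) < e\<^sup>2 / 8"
          using N by (rule le_less_trans)
        then show ?thesis
          using X[of k] by (rule less_trans[OF _ add_strict_left_mono, rotated])
      qed
      from par[of "X m" "X n"] this[OF mn(1)] this[OF mn(2)]
      have "(norm (X m - X n))\<^sup>2 < e\<^sup>2"
        by argo
      then show "norm (X m - X n) < e"
        by (rule power2_less_imp_less) (use e in simp)
    qed
  qed
  then obtain y where y: "X \<longlonglongrightarrow> y"
    by (auto simp: Cauchy_convergent_iff convergent_def)
  have "(\<lambda>n. Q (X n)) \<longlonglongrightarrow> Q y"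
    unfolding Q_def by (intro tendsto_intros f.tendsto y) simp
  moreover have "(\<lambda>n. d + 1 / real (Suc n)) \<longlonglongrightarrow> d + 0"
    by (intro tendsto_intros LIMSEQ_Suc[OF lim_1_over_n])
  ultimately have "Q y \<le> d + 0"
    by (rule LIMSEQ_le) (intro exI allI impI less_imp_le X)
  then have min: "Q y \<le> Q x" for x
    using d[of x] by simp
  have "f x = inner y x" for x
  proof (cases "x = 0")
    case False
    define a where "a = inner y x - f x"
    define t where "t = - a / inner x x"
    have pos: "inner x x > 0" using False by simp
    have "Q (y + t *\<^sub>R x) - Q y = t * a + t\<^sup>2 * inner x x / 2"
      unfolding Q_def f.scaleR f.add power2_norm_eq_inner a_def
      by (simp add: inner_add inner_commute field_simps power2_eq_square)
    also have "\<dots> = - a\<^sup>2 / (2 * inner x x)"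
      using pos by (simp add: t_def field_simps power2_eq_square)
    finally have "0 \<le> - a\<^sup>2 / (2 * inner x x)"
      using min[of "y + t *\<^sub>R x"] by simp
    moreover have "- a\<^sup>2 / (2 * inner x x) < 0" if "a \<noteq> 0"
      by (rule divide_neg_pos) (use pos that in \<open>simp_all only: neg_less_0_iff_less zero_less_power2
          zero_less_mult_iff, simp_all\<close>)
    ultimately have "a = 0"
      by linarith
    then show ?thesis by (simp add: a_def)
  qed simp
  then show ?thesis by blast
qed

typedef (overloaded) 'h bop =
  "{T :: 'h::complex_hilbert_space \<Rightarrow>\<^sub>L 'h. \<forall>c x. T (c *\<^sub>C x) = c *\<^sub>C T x}"
  by (rule exI[of _ id_blinfun]) simp

setup_lifting type_definition_bop

lift_definition bop_apply :: "'h::complex_hilbert_space bop \<Rightarrow> 'h \<Rightarrow> 'h" is blinfun_apply .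

lemma bop_eqI: "(\<And>x. bop_apply S x = bop_apply T x) \<Longrightarrow> S = T"
  by transfer (rule blinfun_eqI)

lemma bop_apply_scaleC: "bop_apply T (c *\<^sub>C x) = c *\<^sub>C bop_apply T x"
  by transfer simp

lemma bop_apply_bounded_linear: "bounded_linear (bop_apply T)"
  by transfer (rule blinfun.bounded_linear_right)

lemma bop_exI:
  assumes "bounded_linear f" and "\<And>c x. f (c *\<^sub>C x) = c *\<^sub>C f x"
  shows "\<exists>T. bop_apply T = f"
  using assms
  by (intro exI[of _ "Abs_bop (Blinfun f)"])
     (simp add: bop_apply.rep_eq Abs_bop_inverse bounded_linear_Blinfun_apply)

lemma bop_adjoint_exists:
  fixes T :: "'h::complex_hilbert_space bop"
  shows "\<exists>S. \<forall>x y. cinner (bop_apply S x) y = cinner x (bop_apply T y)"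
proof -
  interpret T: bounded_linear "bop_apply T" by (rule bop_apply_bounded_linear)
  have "\<exists>z. \<forall>y. inner x (bop_apply T y) = inner z y" for x
    by (rule real_riesz) (intro bounded_linear_intros T.bounded_linear_axioms)
  then obtain S where S: "\<And>x y. inner x (bop_apply T y) = inner (S x) y"
    by metis
  have cS: "cinner (S x) y = cinner x (bop_apply T y)" for x y
    by (rule cinner_eqI_Re) (simp add: S[symmetric] bop_apply_scaleC)
  obtain K where K: "\<And>x. norm (bop_apply T x) \<le> norm x * K"
    using T.bounded by blast
  have "\<exists>S'. bop_apply S' = S"
  proof (rule bop_exI)
    show "bounded_linear S"
    proof (rule bounded_linear_intro[where K = K])
      show "S (x + y) = S x + S y" for x y
        by (rule cinner_eqI_left) (simp add: cS cinner_add_left)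
      show "S (r *\<^sub>R x) = r *\<^sub>R S x" for r x
        by (rule cinner_eqI_left) (simp add: cS scaleR_scaleC cinner_scaleC_left)
      show "norm (S x) \<le> norm x * K" for x
      proof (cases "S x = 0")
        case True
        then show ?thesis
          using order_trans[OF norm_ge_zero K[of x]] by simp
      next
        case False
        have "norm (S x) * norm (S x) = inner x (bop_apply T (S x))"
          by (simp add: S flip: power2_norm_eq_inner power2_eq_square)
        also have "\<dots> \<le> norm x * norm (bop_apply T (S x))"
          by (rule norm_cauchy_schwarz)
        also have "\<dots> \<le> norm x * (norm (S x) * K)"
          by (intro mult_left_mono K) simp
        finally show ?thesis
          using False by (simp add: mult_ac)
      qed
    qed
    show "S (c *\<^sub>C x) = c *\<^sub>C S x" for c x
      by (rule cinner_eqI_left) (simp add: cS cinner_scaleC_left)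
  qed
  with cS show ?thesis by metis
qed

instantiation bop :: (complex_hilbert_space) star_algebra
begin

lift_definition zero_bop :: "'a bop" is 0
  by (simp add: zero_blinfun.rep_eq scaleC_zero_right)
lift_definition plus_bop :: "'a bop \<Rightarrow> 'a bop \<Rightarrow> 'a bop" is plus
  by (simp add: plus_blinfun.rep_eq scaleC_add_right)
lift_definition uminus_bop :: "'a bop \<Rightarrow> 'a bop" is uminus
  by (simp add: uminus_blinfun.rep_eq scaleC_minus_right)
lift_definition minus_bop :: "'a bop \<Rightarrow> 'a bop \<Rightarrow> 'a bop" is minus
  by (simp add: minus_blinfun.rep_eq scaleC_diff_right)
lift_definition times_bop :: "'a bop \<Rightarrow> 'a bop \<Rightarrow> 'a bop" is blinfun_compose
  by simp
lift_definition scaleR_bop :: "real \<Rightarrow> 'a bop \<Rightarrow> 'a bop" is scaleR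
  by (simp add: scaleR_blinfun.rep_eq scaleR_scaleC scaleC_scaleC mult.commute)
lift_definition scaleC_bop :: "complex \<Rightarrow> 'a bop \<Rightarrow> 'a bop" is
  "\<lambda>c T. Blinfun (\<lambda>x. c *\<^sub>C blinfun_apply T x)"
  by (subst (1 2) bounded_linear_Blinfun_apply)
     (auto intro!: bounded_linear_compose[OF bounded_linear_scaleC_hilbert]
        blinfun.bounded_linear_right simp: scaleC_scaleC mult.commute)

definition star_bop :: "'a bop \<Rightarrow> 'a bop" where
  "star_bop T = (THE S. \<forall>x y. cinner (bop_apply S x) y = cinner x (bop_apply T y))"

lemma bop_apply_zero: "bop_apply 0 x = 0"
  and bop_apply_plus: "bop_apply (S + T) x = bop_apply S x + bop_apply T x"
  and bop_apply_uminus: "bop_apply (- T) x = - bop_apply T x"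
  and bop_apply_minus: "bop_apply (S - T) x = bop_apply S x - bop_apply T x"
  and bop_apply_times: "bop_apply (S * T) x = bop_apply S (bop_apply T x)"
  and bop_apply_scaleR: "bop_apply (r *\<^sub>R T) x = r *\<^sub>R bop_apply T x"
  for S T :: "'a bop"
  by (transfer; simp add: plus_blinfun.rep_eq uminus_blinfun.rep_eq minus_blinfun.rep_eq
      scaleR_blinfun.rep_eq)+

lemma bop_apply_scaleC_mult: "bop_apply (c *\<^sub>C T) x = c *\<^sub>C bop_apply T x" for T :: "'a bop"
  by transfer
     (simp add: bounded_linear_Blinfun_apply bounded_linear_compose[OF bounded_linear_scaleC_hilbert]
        blinfun.bounded_linear_right)

lemma cinner_star_left: "cinner (bop_apply (T\<^sup>\<star>) x) y = cinner x (bop_apply T y)" for T :: "'a bop"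
proof -
  have "\<exists>!S. \<forall>x y. cinner (bop_apply S x) y = cinner x (bop_apply T y)"
    using bop_adjoint_exists[of T] by (metis bop_eqI cinner_eqI_left)
  from theI'[OF this] show ?thesis
    by (simp add: star_bop_def)
qed

lemma cinner_star_right: "cinner x (bop_apply (T\<^sup>\<star>) y) = cinner (bop_apply T x) y" for T :: "'a bop"
  by (metis cinner_commute cinner_star_left)

instance
proof
  fix S T U :: "'a bop" and c d :: complex and r s :: real
  note app = bop_apply_zero bop_apply_plus bop_apply_uminus bop_apply_minus bop_apply_times
    bop_apply_scaleR bop_apply_scaleC_mult bop_apply_scaleC
    linear_add[OF bounded_linear.linear[OF bop_apply_bounded_linear]]
  show "S + T + U = S + (T + U)" "S + T = T + S" "0 + S = S" "- S + S = 0" "S - T = S + - T"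
    "S * T * U = S * (T * U)" "(S + T) * U = S * U + T * U" "S * (T + U) = S * T + S * U"
    "r *\<^sub>R (S + T) = r *\<^sub>R S + r *\<^sub>R T" "(r + s) *\<^sub>R S = r *\<^sub>R S + s *\<^sub>R S"
    "r *\<^sub>R s *\<^sub>R S = (r * s) *\<^sub>R S" "1 *\<^sub>R S = S"
    "c *\<^sub>C (S + T) = c *\<^sub>C S + c *\<^sub>C T" "(c + d) *\<^sub>C S = c *\<^sub>C S + d *\<^sub>C S"
    "c *\<^sub>C d *\<^sub>C S = (c * d) *\<^sub>C S" "1 *\<^sub>C S = S"
    "r *\<^sub>R S = complex_of_real r *\<^sub>C S"
    "(c *\<^sub>C S) * T = c *\<^sub>C (S * T)" "S * (c *\<^sub>C T) = c *\<^sub>C (S * T)"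
    by (rule bop_eqI; simp add: app scaleR_add_right scaleR_add_left scaleC_add_right
        scaleC_add_left scaleC_scaleC scaleC_one; simp add: scaleR_scaleC)+
  show "(S + T)\<^sup>\<star> = S\<^sup>\<star> + T\<^sup>\<star>" "(c *\<^sub>C S)\<^sup>\<star> = cnj c *\<^sub>C S\<^sup>\<star>" "(S * T)\<^sup>\<star> = T\<^sup>\<star> * S\<^sup>\<star>"
    "S\<^sup>\<star>\<^sup>\<star> = S"
    by (rule bop_eqI, rule cinner_eqI_left, simp add: app cinner_star_left cinner_star_right
        cinner_add_left cinner_add_right cinner_scaleC_left cinner_scaleC_right)+
qed

end

instantiation bop :: (complex_hilbert_space) real_normed_algebra
begin

lift_definition norm_bop :: "'a bop \<Rightarrow> real" is norm .
lift_definition dist_bop :: "'a bop \<Rightarrow> 'a bop \<Rightarrow> real" is dist .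
definition sgn_bop :: "'a bop \<Rightarrow> 'a bop" where "sgn_bop T = inverse (norm T) *\<^sub>R T"
definition uniformity_bop :: "('a bop \<times> 'a bop) filter" where
  "uniformity_bop = (INF e\<in>{0<..}. principal {(S, T). dist S T < e})"
definition open_bop :: "'a bop set \<Rightarrow> bool" where
  "open_bop U \<longleftrightarrow> (\<forall>S\<in>U. eventually (\<lambda>(S', T). S' = S \<longrightarrow> T \<in> U) uniformity)"

lemma norm_bop_apply: "norm (bop_apply T x) \<le> norm T * norm x" for T :: "'a bop"
  by transfer (rule norm_blinfun)

lemma norm_bop_le:
  fixes T :: "'a bop"
  assumes "0 \<le> K" and "\<And>x. norm (bop_apply T x) \<le> K * norm x"
  shows "norm T \<le> K"
  using assms by transfer (rule norm_blinfun_bound)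

instance
proof
  fix S T :: "'a bop" and c :: complex and r :: real and U :: "'a bop set"
  show "dist S T = norm (S - T)"
    by transfer (rule dist_norm)
  show "sgn T = inverse (norm T) *\<^sub>R T"
    by (rule sgn_bop_def)
  show "(uniformity :: ('a bop \<times> 'a bop) filter) =
      (INF e\<in>{0<..}. principal {(S, T). dist S T < e})"
    by (rule uniformity_bop_def)
  show "open U \<longleftrightarrow> (\<forall>S\<in>U. eventually (\<lambda>(S', T). S' = S \<longrightarrow> T \<in> U) uniformity)"
    by (rule open_bop_def)
  show "norm T = 0 \<longleftrightarrow> T = 0" "norm (S + T) \<le> norm S + norm T" "norm (r *\<^sub>R T) = \<bar>r\<bar> * norm T"
    by (transfer; simp add: norm_triangle_ineq)+
  show "r *\<^sub>R S * T = r *\<^sub>R (S * T)" "S * r *\<^sub>R T = r *\<^sub>R (S * T)"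
    by (simp_all add: scaleR_scaleC mult_scaleC_left mult_scaleC_right)
  show "norm (S * T) \<le> norm S * norm T"
    by transfer (rule norm_blinfun_compose)
qed

end

instance bop :: (complex_hilbert_space) cstar_algebra
proof
  fix T :: "'a bop" and c :: complex
  have sC_le: "norm (c *\<^sub>C T) \<le> cmod c * norm T" for c and T :: "'a bop"
    by (rule norm_bop_le)
       (auto simp: bop_apply_scaleC_mult norm_scaleC_hilbert mult.assoc
          intro!: mult_left_mono norm_bop_apply)
  show "norm (c *\<^sub>C T) = cmod c * norm T"
  proof (cases "c = 0")
    case True
    then show ?thesis
      using sC_le[of c T] by simp
  next
    case False
    have "norm T = norm (inverse c *\<^sub>C c *\<^sub>C T)"
      using False by (simp add: scaleC_scaleC scaleC_one)
    also have "\<dots> \<le> cmod (inverse c) * norm (c *\<^sub>C T)"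
      by (rule sC_le)
    finally have "norm T \<le> norm (c *\<^sub>C T) / cmod c"
      by (simp add: norm_inverse divide_inverse mult.commute)
    then have "cmod c * norm T \<le> norm (c *\<^sub>C T)"
      using False by (simp add: pos_le_divide_eq mult.commute)
    with sC_le[of c T] show ?thesis by simp
  qed
  have sq: "(norm T)\<^sup>2 \<le> norm (T\<^sup>\<star> * T)" for T :: "'a bop"
  proof -
    have "norm T \<le> sqrt (norm (T\<^sup>\<star> * T))"
    proof (rule norm_bop_le)
      fix x :: 'a
      have "(norm (bop_apply T x))\<^sup>2 = inner (bop_apply (T\<^sup>\<star> * T) x) x"
        by (simp add: power2_norm_eq_inner bop_apply_times cinner_star_left flip: Re_cinner)
      also have "\<dots> \<le> norm (bop_apply (T\<^sup>\<star> * T) x) * norm x"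
        by (rule norm_cauchy_schwarz)
      also have "\<dots> \<le> norm (T\<^sup>\<star> * T) * norm x * norm x"
        by (intro mult_right_mono norm_bop_apply) simp
      also have "\<dots> = (sqrt (norm (T\<^sup>\<star> * T)) * norm x)\<^sup>2"
        by (simp add: power_mult_distrib power2_eq_square)
      finally show "norm (bop_apply T x) \<le> sqrt (norm (T\<^sup>\<star> * T)) * norm x"
        by (rule power2_le_imp_le) simp
    qed simp
    from power_mono[OF this, of 2] show ?thesis
      by simp
  qed
  have le_star: "norm T \<le> norm (T\<^sup>\<star>)" for T :: "'a bop"
  proof (cases "norm T = 0")
    case False
    have "norm T * norm T \<le> norm (T\<^sup>\<star>) * norm T"
      using sq[of T] norm_mult_ineq[of "T\<^sup>\<star>" T] by (simp add: power2_eq_square)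
    with False show ?thesis by simp
  qed simp
  show "norm (T\<^sup>\<star> * T) = (norm T)\<^sup>2"
  proof (rule antisym)
    have "norm (T\<^sup>\<star>) = norm T"
      using le_star[of T] le_star[of "T\<^sup>\<star>"] by (simp only: star_star antisym)
    then show "norm (T\<^sup>\<star> * T) \<le> (norm T)\<^sup>2"
      using norm_mult_ineq[of "T\<^sup>\<star>" T] by (simp only: power2_eq_square)
  qed (rule sq)
next
  fix X :: "nat \<Rightarrow> 'a bop"
  assume "Cauchy X"
  then have "Cauchy (\<lambda>n. Rep_bop (X n))"
    by (simp add: Cauchy_def dist_bop.rep_eq)
  then obtain L where L: "(\<lambda>n. Rep_bop (X n)) \<longlonglongrightarrow> L"
    by (auto simp: Cauchy_convergent_iff convergent_def)
  have "blinfun_apply L (c *\<^sub>C x) = c *\<^sub>C blinfun_apply L x" for c x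
  proof (rule LIMSEQ_unique)
    show "(\<lambda>n. blinfun_apply (Rep_bop (X n)) (c *\<^sub>C x)) \<longlonglongrightarrow> blinfun_apply L (c *\<^sub>C x)"
      by (intro blinfun.tendsto L tendsto_const)
    have "(\<lambda>n. c *\<^sub>C blinfun_apply (Rep_bop (X n)) x) \<longlonglongrightarrow> c *\<^sub>C blinfun_apply L x"
      by (intro bounded_linear.tendsto[OF bounded_linear_scaleC_hilbert] blinfun.tendsto L
          tendsto_const)
    moreover have "blinfun_apply (Rep_bop (X n)) (c *\<^sub>C x) =
        c *\<^sub>C blinfun_apply (Rep_bop (X n)) x" for n
      using Rep_bop[of "X n"] by simp
    ultimately show
      "(\<lambda>n. blinfun_apply (Rep_bop (X n)) (c *\<^sub>C x)) \<longlonglongrightarrow> c *\<^sub>C blinfun_apply L x"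
      by (simp only:)
  qed
  then have R: "Rep_bop (Abs_bop L) = L"
    by (simp add: Abs_bop_inverse)
  have "\<forall>e>0. \<exists>N. \<forall>n\<ge>N. dist (X n) (Abs_bop L) < e"
    using L by (simp add: lim_sequentially dist_bop.rep_eq R)
  then show "convergent X"
    unfolding convergent_def lim_sequentially by blast
qed


definition nondegenerate_rep ::
  "('a::cstar_algebra \<Rightarrow> 'h::complex_hilbert_space bop) \<Rightarrow> bool" where
  "nondegenerate_rep \<pi> \<longleftrightarrow>
     star_hom \<pi> \<and> closure (cspan {bop_apply (\<pi> a) h | a h. True}) = UNIV"

definition partial_isometry :: "'h::complex_hilbert_space bop \<Rightarrow> bool" where
  "partial_isometry V \<longleftrightarrow> V * V\<^sup>\<star> * V = V"


section \<open>Quasi-lattice ordered opposite pairs\<close>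

definition right_le :: "('g, 'm) monoid_scheme \<Rightarrow> 'g set \<Rightarrow> 'g \<Rightarrow> 'g \<Rightarrow> bool" where
  "right_le G P s t \<longleftrightarrow> t \<otimes>\<^bsub>G\<^esub> inv\<^bsub>G\<^esub> s \<in> P"

definition upper_bound_in :: "('g, 'm) monoid_scheme \<Rightarrow> 'g set \<Rightarrow> 'g set \<Rightarrow> 'g \<Rightarrow> bool" where
  "upper_bound_in G P S u \<longleftrightarrow> u \<in> P \<and> (\<forall>s\<in>S. right_le G P s u)"

definition lub_in :: "('g, 'm) monoid_scheme \<Rightarrow> 'g set \<Rightarrow> 'g set \<Rightarrow> 'g \<Rightarrow> bool" where
  "lub_in G P S u \<longleftrightarrow>
     upper_bound_in G P S u \<and> (\<forall>v. upper_bound_in G P S v \<longrightarrow> right_le G P u v)"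

definition opp_quasi_lattice_ordered :: "('g, 'm) monoid_scheme \<Rightarrow> 'g set \<Rightarrow> bool" where
  "opp_quasi_lattice_ordered G P \<longleftrightarrow> P \<inter> m_inv G ` P = {\<one>\<^bsub>G\<^esub>} \<and>
     (\<forall>S. finite S \<and> S \<subseteq> carrier G \<and> (\<exists>u. upper_bound_in G P S u) \<longrightarrow> (\<exists>u. lub_in G P S u))"

text \<open>\<open>s \<or> t < \<infinity>\<close>, and \<open>s \<or> t\<close> itself in that case.\<close>

definition join_finite :: "('g, 'm) monoid_scheme \<Rightarrow> 'g set \<Rightarrow> 'g \<Rightarrow> 'g \<Rightarrow> bool" where
  "join_finite G P s t \<longleftrightarrow> (\<exists>u. upper_bound_in G P {s, t} u)"

definition join :: "('g, 'm) monoid_scheme \<Rightarrow> 'g set \<Rightarrow> 'g \<Rightarrow> 'g \<Rightarrow> 'g" where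
  "join G P s t = (THE u. lub_in G P {s, t} u)"


section \<open>Twisted systems and Nica-Toeplitz crossed products\<close>

definition twisted_system :: "('g, 'm) monoid_scheme \<Rightarrow> 'g set \<Rightarrow>
    ('g \<Rightarrow> 'a::cstar_algebra \<Rightarrow> 'a) \<Rightarrow> ('g \<Rightarrow> 'g \<Rightarrow> complex) \<Rightarrow> bool" where
  "twisted_system G P \<beta> \<omega> \<longleftrightarrow>
     (\<forall>s\<in>P. star_hom (\<beta> s) \<and> extendible (\<beta> s)) \<and>
     (\<forall>s\<in>P. \<forall>t\<in>P. \<beta> (s \<otimes>\<^bsub>G\<^esub> t) = \<beta> s \<circ> \<beta> t) \<and> \<beta> \<one>\<^bsub>G\<^esub> = id \<and>
     (\<forall>s\<in>P. \<forall>t\<in>P. cmod (\<omega> s t) = 1) \<and> \<omega> \<one>\<^bsub>G\<^esub> \<one>\<^bsub>G\<^esub> = 1 \<and>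
     (\<forall>r\<in>P. \<forall>s\<in>P. \<forall>t\<in>P. \<omega> r s * \<omega> (r \<otimes>\<^bsub>G\<^esub> s) t = \<omega> r (s \<otimes>\<^bsub>G\<^esub> t) * \<omega> s t)"

definition nt_covariant_rep :: "('g, 'm) monoid_scheme \<Rightarrow> 'g set \<Rightarrow>
    ('g \<Rightarrow> 'a::cstar_algebra \<Rightarrow> 'a) \<Rightarrow> ('g \<Rightarrow> 'g \<Rightarrow> complex) \<Rightarrow>
    ('a \<Rightarrow> 'h::complex_hilbert_space bop) \<Rightarrow> ('g \<Rightarrow> 'h bop) \<Rightarrow> bool" where
  "nt_covariant_rep G P \<beta> \<omega> \<pi> V \<longleftrightarrow> nondegenerate_rep \<pi> \<and>
     (\<forall>s\<in>P. partial_isometry (V s)) \<and>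
     (\<forall>s\<in>P. \<forall>t\<in>P. V s * V t = \<omega> s t *\<^sub>C V (s \<otimes>\<^bsub>G\<^esub> t)) \<and>
     (\<forall>s\<in>P. \<forall>a. \<pi> (\<beta> s a) = V s * \<pi> a * (V s)\<^sup>\<star>) \<and>
     (\<forall>s\<in>P. \<forall>a. (V s)\<^sup>\<star> * V s * \<pi> a = \<pi> a * ((V s)\<^sup>\<star> * V s)) \<and>
     (\<forall>s\<in>P. \<forall>t\<in>P. (V s)\<^sup>\<star> * V s * ((V t)\<^sup>\<star> * V t) =
        (if join_finite G P s t then (V (join G P s t))\<^sup>\<star> * V (join G P s t) else 0))"

text \<open>The covariant representations range over the Hilbert space \<open>'h\<close>, which is arbitrary wherever
  this is used with a type variable; \<open>B\<close> is the type \<open>'b\<close>.\<close>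

definition nt_crossed_product :: "'h::complex_hilbert_space itself \<Rightarrow>
    ('g, 'm) monoid_scheme \<Rightarrow> 'g set \<Rightarrow>
    ('g \<Rightarrow> 'a::cstar_algebra \<Rightarrow> 'a) \<Rightarrow> ('g \<Rightarrow> 'g \<Rightarrow> complex) \<Rightarrow>
    ('a \<Rightarrow> 'b::cstar_algebra) \<Rightarrow> ('g \<Rightarrow> 'b multiplier) \<Rightarrow> bool" where
  "nt_crossed_product TYPE('h) G P \<beta> \<omega> jA jP \<longleftrightarrow> nondegenerate_hom jA \<and>
     (\<forall>\<sigma> :: 'b \<Rightarrow> 'h bop. nondegenerate_rep \<sigma> \<longrightarrow>
        nt_covariant_rep G P \<beta> \<omega> (\<sigma> \<circ> jA) (mult_ext \<sigma> \<circ> jP)) \<and>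
     (\<forall>(\<pi> :: 'a \<Rightarrow> 'h bop) V. nt_covariant_rep G P \<beta> \<omega> \<pi> V \<longrightarrow>
        (\<exists>\<rho> :: 'b \<Rightarrow> 'h bop. star_hom \<rho> \<and> \<rho> \<circ> jA = \<pi> \<and> (\<forall>s\<in>P. mult_ext \<rho> (jP s) = V s))) \<and>
     cstar_generated {rmul (jA a) (jP s) | a s. s \<in> P} = UNIV"


section \<open>Hilbert bimodules\<close>

text \<open>The underlying vector space is a subspace of the type \<open>'v\<close>.\<close>

record ('v, 'a) hilbert_bimodule =
  hcarrier :: "'v set"
  hinner :: "'v \<Rightarrow> 'v \<Rightarrow> 'a"
  hright :: "'v \<Rightarrow> 'a \<Rightarrow> 'v"
  hleft :: "'a \<Rightarrow> 'v \<Rightarrow> 'v"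

definition hnorm :: "('v, 'a::cstar_algebra) hilbert_bimodule \<Rightarrow> 'v \<Rightarrow> real" where
  "hnorm M x = sqrt (norm (hinner M x x))"

text \<open>Positivity \<open>\<langle>x, x\<rangle> \<ge> 0\<close> is expressed as \<open>\<langle>x, x\<rangle> = b\<^sup>* b\<close>.\<close>

definition hilbert_bimodule ::
  "('v::complex_vector_space, 'a::cstar_algebra) hilbert_bimodule \<Rightarrow> bool" where
  "hilbert_bimodule M \<longleftrightarrow> (let C = hcarrier M in
     0 \<in> C \<and> (\<forall>x\<in>C. \<forall>y\<in>C. x + y \<in> C) \<and> (\<forall>c. \<forall>x\<in>C. c *\<^sub>C x \<in> C) \<and>
     (\<forall>x\<in>C. \<forall>a. hright M x a \<in> C) \<and>
     (\<forall>x\<in>C. \<forall>y\<in>C. \<forall>a. hright M (x + y) a = hright M x a + hright M y a) \<and>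
     (\<forall>x\<in>C. \<forall>a b. hright M x (a + b) = hright M x a + hright M x b) \<and>
     (\<forall>x\<in>C. \<forall>a b. hright M x (a * b) = hright M (hright M x a) b) \<and>
     (\<forall>x\<in>C. \<forall>a c. hright M (c *\<^sub>C x) a = c *\<^sub>C hright M x a \<and> hright M x (c *\<^sub>C a) = c *\<^sub>C hright M x a) \<and>
     (\<forall>x\<in>C. \<forall>y\<in>C. \<forall>z\<in>C. hinner M x (y + z) = hinner M x y + hinner M x z) \<and>
     (\<forall>x\<in>C. \<forall>y\<in>C. \<forall>c. hinner M x (c *\<^sub>C y) = c *\<^sub>C hinner M x y) \<and>
     (\<forall>x\<in>C. \<forall>y\<in>C. \<forall>a. hinner M x (hright M y a) = hinner M x y * a) \<and>
     (\<forall>x\<in>C. \<forall>y\<in>C. (hinner M x y)\<^sup>\<star> = hinner M y x) \<and>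
     (\<forall>x\<in>C. (\<exists>b. hinner M x x = b\<^sup>\<star> * b) \<and> (hinner M x x = 0 \<longrightarrow> x = 0)) \<and>
     (\<forall>f. (\<forall>n::nat. f n \<in> C) \<and> (\<forall>e>0. \<exists>N. \<forall>m\<ge>N. \<forall>n\<ge>N. hnorm M (f m - f n) < e) \<longrightarrow>
        (\<exists>x\<in>C. (\<lambda>n. hnorm M (f n - x)) \<longlonglongrightarrow> 0)) \<and>
     (\<forall>a. \<forall>x\<in>C. hleft M a x \<in> C) \<and>
     (\<forall>a. \<forall>x\<in>C. \<forall>y\<in>C. hinner M (hleft M a x) y = hinner M x (hleft M (a\<^sup>\<star>) y)) \<and>
     (\<forall>a b. \<forall>x\<in>C. hleft M (a + b) x = hleft M a x + hleft M b x) \<and>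
     (\<forall>c a. \<forall>x\<in>C. hleft M (c *\<^sub>C a) x = c *\<^sub>C hleft M a x) \<and>
     (\<forall>a b. \<forall>x\<in>C. hleft M (a * b) x = hleft M a (hleft M b x)))"

text \<open>Operators on \<open>M\<close> are functions on \<open>'v\<close> that vanish off the carrier, so that equal operators
  are equal functions.\<close>

definition operators_on :: "('v::zero, 'a) hilbert_bimodule \<Rightarrow> ('v \<Rightarrow> 'v) set" where
  "operators_on M = {T. (\<forall>x\<in>hcarrier M. T x \<in> hcarrier M) \<and> (\<forall>x. x \<notin> hcarrier M \<longrightarrow> T x = 0)}"

definition adjoint_pair ::
  "('v, 'a) hilbert_bimodule \<Rightarrow> ('v \<Rightarrow> 'v) \<Rightarrow> ('v \<Rightarrow> 'v) \<Rightarrow> bool" where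
  "adjoint_pair M S T \<longleftrightarrow>
     (\<forall>x\<in>hcarrier M. \<forall>y\<in>hcarrier M. hinner M (S x) y = hinner M x (T y))"

definition adjointables :: "('v::zero, 'a) hilbert_bimodule \<Rightarrow> ('v \<Rightarrow> 'v) set" where
  "adjointables M = {T \<in> operators_on M. \<exists>S\<in>operators_on M. adjoint_pair M T S}"

definition rank_one :: "('v::zero, 'a) hilbert_bimodule \<Rightarrow> 'v \<Rightarrow> 'v \<Rightarrow> 'v \<Rightarrow> 'v" where
  "rank_one M x y = (\<lambda>z. if z \<in> hcarrier M then hright M x (hinner M y z) else 0)"

text \<open>Operator-norm limits of finite sums of rank one operators; scalar coefficients are absorbed
  into the vectors \<open>x k\<close>.\<close>

definition compacts ::
  "('v::complex_vector_space, 'a::cstar_algebra) hilbert_bimodule \<Rightarrow> ('v \<Rightarrow> 'v) set" where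
  "compacts M = {T \<in> adjointables M. \<forall>e>0. \<exists>(n::nat) x y.
     (\<forall>k<n. x k \<in> hcarrier M \<and> y k \<in> hcarrier M) \<and>
     (\<forall>z\<in>hcarrier M. hnorm M (T z - (\<Sum>k<n. rank_one M (x k) (y k) z)) \<le> e * hnorm M z)}"

definition compact_hom :: "('v::complex_vector_space, 'a::cstar_algebra) hilbert_bimodule \<Rightarrow>
    (('v \<Rightarrow> 'v) \<Rightarrow> 'b::cstar_algebra) \<Rightarrow> bool" where
  "compact_hom M f \<longleftrightarrow>
     (\<forall>S\<in>compacts M. \<forall>T\<in>compacts M. f (\<lambda>z. S z + T z) = f S + f T) \<and>
     (\<forall>c. \<forall>S\<in>compacts M. f (\<lambda>z. c *\<^sub>C S z) = c *\<^sub>C f S) \<and>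
     (\<forall>S\<in>compacts M. \<forall>T\<in>compacts M. f (S \<circ> T) = f S * f T) \<and>
     (\<forall>S\<in>compacts M. \<forall>T\<in>compacts M. adjoint_pair M S T \<longrightarrow> f T = (f S)\<^sup>\<star>)"


section \<open>Product systems\<close>

text \<open>The total space of the system is the set of pairs \<open>(s, x)\<close> with \<open>x\<close> in the carrier of
  \<open>fibre X s\<close>, and \<open>p = fst\<close>. The map \<open>coeff X\<close> is the identification of \<open>A\<close> with the fibre over
  the identity.\<close>

record ('s, 'v, 'a) product_system =
  fibre :: "'s \<Rightarrow> ('v, 'a) hilbert_bimodule"
  psmult :: "'s \<times> 'v \<Rightarrow> 's \<times> 'v \<Rightarrow> 's \<times> 'v"
  coeff :: "'a \<Rightarrow> 'v"

text \<open>The condition for \<open>s, t \<noteq> e\<close> states the isomorphism \<open>X\<^sub>s \<otimes>\<^sub>A X\<^sub>t \<cong> X\<^sub>s\<^sub>t\<close> without tensor products: the interior tensor product is the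
  completion of the algebraic one for the inner product
  \<open>\<langle>x \<otimes> y, x' \<otimes> y'\<rangle> = \<langle>y, \<phi>\<^sub>t(\<langle>x, x'\<rangle>) y'\<rangle>\<close>, so multiplication extends to a unitary iff it preserves
  inner products of elementary tensors and has dense linear range. Compatibility with the two
  actions of \<open>A\<close> is associativity with a factor in \<open>X\<^sub>e\<close>.\<close>

definition product_system ::
  "('s, 'm) monoid_scheme \<Rightarrow>
    ('s, 'v::complex_vector_space, 'a::cstar_algebra) product_system \<Rightarrow> bool" where
  "product_system Q X \<longleftrightarrow> monoid Q \<and>
     (\<forall>s\<in>carrier Q. hilbert_bimodule (fibre X s)) \<and>
     (\<forall>s\<in>carrier Q. \<forall>t\<in>carrier Q. \<forall>x\<in>hcarrier (fibre X s). \<forall>y\<in>hcarrier (fibre X t).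
        psmult X (s, x) (t, y) \<in> {s \<otimes>\<^bsub>Q\<^esub> t} \<times> hcarrier (fibre X (s \<otimes>\<^bsub>Q\<^esub> t))) \<and>
     (\<forall>s\<in>carrier Q. \<forall>t\<in>carrier Q. \<forall>r\<in>carrier Q. \<forall>x\<in>hcarrier (fibre X s).
        \<forall>y\<in>hcarrier (fibre X t). \<forall>z\<in>hcarrier (fibre X r).
        psmult X (psmult X (s, x) (t, y)) (r, z) = psmult X (s, x) (psmult X (t, y) (r, z))) \<and>
     (\<forall>s\<in>carrier Q - {\<one>\<^bsub>Q\<^esub>}. \<forall>t\<in>carrier Q - {\<one>\<^bsub>Q\<^esub>}.
        (\<forall>x\<in>hcarrier (fibre X s). \<forall>x'\<in>hcarrier (fibre X s).
         \<forall>y\<in>hcarrier (fibre X t). \<forall>y'\<in>hcarrier (fibre X t).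
           hinner (fibre X (s \<otimes>\<^bsub>Q\<^esub> t)) (snd (psmult X (s, x) (t, y))) (snd (psmult X (s, x') (t, y')))
           = hinner (fibre X t) y (hleft (fibre X t) (hinner (fibre X s) x x') y')) \<and>
        (\<forall>z\<in>hcarrier (fibre X (s \<otimes>\<^bsub>Q\<^esub> t)). \<forall>e>0. \<exists>(n::nat) x y.
           (\<forall>k<n. x k \<in> hcarrier (fibre X s) \<and> y k \<in> hcarrier (fibre X t)) \<and>
           hnorm (fibre X (s \<otimes>\<^bsub>Q\<^esub> t)) (z - (\<Sum>k<n. snd (psmult X (s, x k) (t, y k)))) < e)) \<and>
     bij_betw (coeff X) UNIV (hcarrier (fibre X \<one>\<^bsub>Q\<^esub>)) \<and>
     (\<forall>a b. coeff X (a + b) = coeff X a + coeff X b) \<and>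
     (\<forall>c a. coeff X (c *\<^sub>C a) = c *\<^sub>C coeff X a) \<and>
     (\<forall>a b. hinner (fibre X \<one>\<^bsub>Q\<^esub>) (coeff X a) (coeff X b) = a\<^sup>\<star> * b) \<and>
     (\<forall>a b. hright (fibre X \<one>\<^bsub>Q\<^esub>) (coeff X a) b = coeff X (a * b)) \<and>
     (\<forall>a b. hleft (fibre X \<one>\<^bsub>Q\<^esub>) a (coeff X b) = coeff X (a * b)) \<and>
     (\<forall>s\<in>carrier Q. \<forall>x\<in>hcarrier (fibre X s). \<forall>a.
        psmult X (\<one>\<^bsub>Q\<^esub>, coeff X a) (s, x) = (s, hleft (fibre X s) a x) \<and>
        psmult X (s, x) (\<one>\<^bsub>Q\<^esub>, coeff X a) = (s, hright (fibre X s) x a))"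

definition toeplitz_rep :: "('s, 'm) monoid_scheme \<Rightarrow>
    ('s, 'v::complex_vector_space, 'a::cstar_algebra) product_system \<Rightarrow>
    ('s \<times> 'v \<Rightarrow> 'b::cstar_algebra) \<Rightarrow> bool" where
  "toeplitz_rep Q X \<psi> \<longleftrightarrow>
     (\<forall>s\<in>carrier Q. \<forall>x\<in>hcarrier (fibre X s). \<forall>y\<in>hcarrier (fibre X s).
        \<psi> (s, x + y) = \<psi> (s, x) + \<psi> (s, y)) \<and>
     (\<forall>s\<in>carrier Q. \<forall>c. \<forall>x\<in>hcarrier (fibre X s). \<psi> (s, c *\<^sub>C x) = c *\<^sub>C \<psi> (s, x)) \<and>
     star_hom (\<lambda>a. \<psi> (\<one>\<^bsub>Q\<^esub>, coeff X a)) \<and>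
     (\<forall>s\<in>carrier Q. \<forall>t\<in>carrier Q. \<forall>x\<in>hcarrier (fibre X s). \<forall>y\<in>hcarrier (fibre X t).
        \<psi> (psmult X (s, x) (t, y)) = \<psi> (s, x) * \<psi> (t, y)) \<and>
     (\<forall>s\<in>carrier Q. \<forall>x\<in>hcarrier (fibre X s). \<forall>y\<in>hcarrier (fibre X s).
        (\<psi> (s, x))\<^sup>\<star> * \<psi> (s, y) = \<psi> (\<one>\<^bsub>Q\<^esub>, coeff X (hinner (fibre X s) x y)))"

text \<open>The homomorphism \<open>\<psi>\<^sup>(\<^sup>s\<^sup>)\<close> on \<open>K(X\<^sub>s)\<close>. Its values on the compacts are determined, because
  *-homomorphisms are continuous; off the compacts it is irrelevant.\<close>

definition compact_ext ::
  "('s, 'v::complex_vector_space, 'a::cstar_algebra) product_system \<Rightarrow>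
    ('s \<times> 'v \<Rightarrow> 'b::cstar_algebra) \<Rightarrow> 's \<Rightarrow> ('v \<Rightarrow> 'v) \<Rightarrow> 'b" where
  "compact_ext X \<psi> s = (SOME f. compact_hom (fibre X s) f \<and>
     (\<forall>x\<in>hcarrier (fibre X s). \<forall>y\<in>hcarrier (fibre X s).
        f (rank_one (fibre X s) x y) = \<psi> (s, x) * (\<psi> (s, y))\<^sup>\<star>))"

text \<open>\<open>S \<otimes> 1\<close> on \<open>X\<^sub>s\<^sub>r\<close>, the product \<open>sr\<close> being that of the index monoid \<open>Q\<close>.\<close>

definition ampliation :: "('s, 'm) monoid_scheme \<Rightarrow>
    ('s, 'v::complex_vector_space, 'a::cstar_algebra) product_system \<Rightarrow>
    's \<Rightarrow> 's \<Rightarrow> ('v \<Rightarrow> 'v) \<Rightarrow> 'v \<Rightarrow> 'v" where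
  "ampliation Q X s r S = (THE R. R \<in> adjointables (fibre X (s \<otimes>\<^bsub>Q\<^esub> r)) \<and>
     (\<forall>x\<in>hcarrier (fibre X s). \<forall>y\<in>hcarrier (fibre X r).
        R (snd (psmult X (s, x) (r, y))) = snd (psmult X (s, S x) (r, y))))"

definition opp_submonoid :: "('g, 'm) monoid_scheme \<Rightarrow> 'g set \<Rightarrow> 'g monoid" where
  "opp_submonoid G P = \<lparr>carrier = P, mult = (\<lambda>s t. t \<otimes>\<^bsub>G\<^esub> s), one = \<one>\<^bsub>G\<^esub>\<rparr>"

text \<open>For a product system over \<open>P\<^sup>o\<close>. If \<open>j = s \<or> t\<close> is finite, then \<open>j = r s\<close> in \<open>G\<close> for
  \<open>r = j s\<^sup>-\<^sup>1 \<in> P\<close>, which reads \<open>j = s r\<close> in \<open>P\<^sup>o\<close>.\<close>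

definition nica_covariant :: "('g, 'm) monoid_scheme \<Rightarrow> 'g set \<Rightarrow>
    ('g, 'v::complex_vector_space, 'a::cstar_algebra) product_system \<Rightarrow>
    ('g \<times> 'v \<Rightarrow> 'b::cstar_algebra) \<Rightarrow> bool" where
  "nica_covariant G P X \<psi> \<longleftrightarrow>
     (\<forall>s\<in>P. \<forall>t\<in>P. \<forall>S\<in>compacts (fibre X s). \<forall>T\<in>compacts (fibre X t).
        compact_ext X \<psi> s S * compact_ext X \<psi> t T =
        (if join_finite G P s t then
           (let j = join G P s t; Q = opp_submonoid G P in
            compact_ext X \<psi> j
              (ampliation Q X s (j \<otimes>\<^bsub>G\<^esub> inv\<^bsub>G\<^esub> s) S \<circ> ampliation Q X t (j \<otimes>\<^bsub>G\<^esub> inv\<^bsub>G\<^esub> t) T))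
         else 0))"

definition nica_toeplitz_rep :: "('g, 'm) monoid_scheme \<Rightarrow> 'g set \<Rightarrow>
    ('g, 'v::complex_vector_space, 'a::cstar_algebra) product_system \<Rightarrow>
    ('g \<times> 'v \<Rightarrow> 'b::cstar_algebra) \<Rightarrow> bool" where
  "nica_toeplitz_rep G P X \<psi> \<longleftrightarrow> toeplitz_rep (opp_submonoid G P) X \<psi> \<and> nica_covariant G P X \<psi>"

text \<open>The type \<open>'b\<close> is the algebra \<open>T\<^sub>c\<^sub>o\<^sub>v(X)\<close>, and \<open>'c\<close> ranges over the target algebras of the
  universal property.\<close>

definition universal_nica_toeplitz_rep :: "'c::cstar_algebra itself \<Rightarrow>
    ('g, 'm) monoid_scheme \<Rightarrow> 'g set \<Rightarrow>
    ('g, 'v::complex_vector_space, 'a::cstar_algebra) product_system \<Rightarrow>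
    ('g \<times> 'v \<Rightarrow> 'b::cstar_algebra) \<Rightarrow> bool" where
  "universal_nica_toeplitz_rep TYPE('c) G P X i \<longleftrightarrow> nica_toeplitz_rep G P X i \<and>
     cstar_generated {i (s, x) | s x. s \<in> P \<and> x \<in> hcarrier (fibre X s)} = UNIV \<and>
     (\<forall>\<psi> :: 'g \<times> 'v \<Rightarrow> 'c. nica_toeplitz_rep G P X \<psi> \<longrightarrow>
        (\<exists>\<rho> :: 'b \<Rightarrow> 'c. star_hom \<rho> \<and>
           (\<forall>s\<in>P. \<forall>x\<in>hcarrier (fibre X s). \<psi> (s, x) = \<rho> (i (s, x)))))"

definition twisted_product_system :: "('g, 'm) monoid_scheme \<Rightarrow>
    ('g \<Rightarrow> 'a::cstar_algebra \<Rightarrow> 'a) \<Rightarrow> ('g \<Rightarrow> 'g \<Rightarrow> complex) \<Rightarrow> ('g, 'a, 'a) product_system" where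
  "twisted_product_system G \<beta> \<omega> =
     \<lparr>fibre = (\<lambda>s.
        \<lparr>hcarrier = range (lmul (strict_ext (\<beta> s) 1)),
         hinner = (\<lambda>x y. x\<^sup>\<star> * y),
         hright = (\<lambda>x a. x * a),
         hleft = (\<lambda>a x. \<beta> s a * x)\<rparr>),
      psmult = (\<lambda>(s, x) (t, y). (t \<otimes>\<^bsub>G\<^esub> s, cnj (\<omega> t s) *\<^sub>C (\<beta> t x * y))),
      coeff = id\<rparr>"


subsection \<open>It is a product system over the opposite semigroup\<close>

lemma lmul_mult_embed: "lmul (mult_embed a) b = a * b"
  and rmul_mult_embed: "rmul b (mult_embed a) = b * a"
  by (transfer; simp)+

lemma lmul_one: "lmul 1 a = a" and rmul_one: "rmul a 1 = a"
  by (transfer; simp)+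

lemma rmul_times: "rmul a (m * n) = rmul (rmul a m) n"
  by transfer simp

lemma lmul_mult: "lmul m (a * b) = lmul m a * b"
  by (rule cstar_eqI_left) (simp add: lmul_rmul mult.assoc[symmetric])

lemma lmul_zero_right: "lmul m 0 = 0"
  by (rule cstar_eqI_left) (simp add: lmul_rmul)

lemma star_mult_self_eq_0: "x\<^sup>\<star> * x = 0 \<longleftrightarrow> x = (0 :: 'a::cstar_algebra)"
  using cstar_identity[of x] by auto

lemma mult_embed_lmul: "mult_embed (lmul m a) = m * mult_embed a"
  by (rule multiplier_eqI) (simp add: lmul_mult_embed lmul_times lmul_mult)

lemma mult_embed_inject: "mult_embed a = mult_embed b \<Longrightarrow> a = b"
  by (rule cstar_eqI_right) (metis lmul_mult_embed)

lemma strict_lim_mult_embed: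
  "approximate_identity F u \<Longrightarrow> limitin strict_topology (\<lambda>i. mult_embed (u i)) 1 F"
  by (simp add: limitin_strict_topology lmul_mult_embed rmul_mult_embed lmul_one rmul_one
      approximate_identity_def)

lemma is_strict_ext_tendsto:
  assumes "is_strict_ext f g" and "approximate_identity F u"
  shows "((\<lambda>i. f (u i) * a) \<longlongrightarrow> lmul (g 1) a) F" and "((\<lambda>i. a * f (u i)) \<longlongrightarrow> rmul a (g 1)) F"
proof -
  have "continuous_map strict_topology strict_topology g"
    using assms(1) by (simp add: is_strict_ext_def)
  then have "limitin strict_topology (g \<circ> (\<lambda>i. mult_embed (u i))) (g 1) F"
    by (rule continuous_map_limit) (rule strict_lim_mult_embed[OF assms(2)])
  then show "((\<lambda>i. f (u i) * a) \<longlongrightarrow> lmul (g 1) a) F" "((\<lambda>i. a * f (u i)) \<longlongrightarrow> rmul a (g 1)) F"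
    using assms(1)
    by (simp_all add: is_strict_ext_def limitin_strict_topology o_def lmul_mult_embed
        rmul_mult_embed)
qed

lemma is_strict_ext_unique:
  fixes f :: "'a::cstar_algebra \<Rightarrow> 'a" and u :: "'i \<Rightarrow> 'a"
  assumes g: "is_strict_ext f g" and h: "is_strict_ext f h" and u: "approximate_identity F u"
  shows "g = h"
proof (rule ext)
  fix m :: "'a multiplier"
  have lim: "((\<lambda>i. b * f (lmul m (u i))) \<longlongrightarrow> rmul b (k m)) F" if k: "is_strict_ext f k" for b k
  proof -
    have hom: "k (x * y) = k x * k y" and emb: "k (mult_embed a) = mult_embed (f a)" for x y a
      using k by (auto simp: is_strict_ext_def star_hom_def)
    have "mult_embed (f (lmul m (u i))) = k m * mult_embed (f (u i))" for i
      by (simp add: emb[symmetric] mult_embed_lmul hom)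
    then have "f (lmul m (u i)) = lmul (k m) (f (u i))" for i
      by (intro mult_embed_inject) (simp add: mult_embed_lmul)
    moreover have "((\<lambda>i. rmul b (k m) * f (u i)) \<longlongrightarrow> rmul (rmul b (k m)) (k 1)) F"
      by (rule is_strict_ext_tendsto(2)[OF k u])
    moreover have "rmul (rmul b (k m)) (k 1) = rmul b (k m)"
      by (simp flip: rmul_times hom)
    ultimately show ?thesis
      by (simp add: lmul_rmul)
  qed
  have "F \<noteq> bot"
    using u by (simp add: approximate_identity_def)
  then have r: "rmul b (g m) = rmul b (h m)" for b
    by (rule tendsto_unique[OF _ lim[OF g] lim[OF h]])
  show "g m = h m"
    by (rule multiplier_eqI, rule cstar_eqI_left) (simp add: lmul_rmul r)
qed

lemma strict_ext_eqI:
  fixes f :: "'a::cstar_algebra \<Rightarrow> 'a" and u :: "'i \<Rightarrow> 'a"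
  assumes "is_strict_ext f g" and "approximate_identity F u"
  shows "strict_ext f = g"
  unfolding strict_ext_def using assms is_strict_ext_unique by blast

lemma projection_norm_le:
  fixes q :: "'a::cstar_algebra multiplier"
  assumes "q\<^sup>\<star> = q" and "q * q = q"
  shows "norm (lmul q a) \<le> norm a"
proof -
  have "(lmul q a)\<^sup>\<star> = rmul (a\<^sup>\<star>) q"
    by (metis assms(1) lmul_star star_star)
  then have "(lmul q a)\<^sup>\<star> * lmul q a = a\<^sup>\<star> * lmul q a"
    by (metis assms(2) lmul_rmul lmul_times)
  then have "(norm (lmul q a))\<^sup>2 \<le> norm a * norm (lmul q a)"
    by (metis cstar_identity cstar_norm_star norm_mult_ineq)
  then show ?thesis
    by (cases "norm (lmul q a) = 0") (simp_all add: power2_eq_square)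
qed

lemma projection_closed:
  fixes q :: "'a::cstar_algebra multiplier"
  assumes "\<And>n::nat. lmul q (f n) = f n" and "f \<longlonglongrightarrow> x"
  shows "lmul q x = x"
proof (rule cstar_eqI_left)
  fix a
  have "(\<lambda>n. rmul a q * f n) \<longlonglongrightarrow> rmul a q * x"
    by (intro tendsto_intros assms(2))
  moreover have "rmul a q * f n = a * f n" for n
    by (simp add: lmul_rmul[symmetric] assms(1))
  moreover have "(\<lambda>n. a * f n) \<longlonglongrightarrow> a * x"
    by (intro tendsto_intros assms(2))
  ultimately show "a * lmul q x = a * x"
    by (simp add: lmul_rmul LIMSEQ_unique)
qed

lemma product_system_twisted_product_system:
  fixes \<beta> :: "'g \<Rightarrow> 'a::cstar_algebra \<Rightarrow> 'a"
  assumes G: "group G" and P: "submonoid P G" and tw: "twisted_system G P \<beta> \<omega>"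
    and u: "approximate_identity F (u :: 'i \<Rightarrow> 'a)"
  shows "product_system (opp_submonoid G P) (twisted_product_system G \<beta> \<omega>)"
proof -
  interpret group G by fact
  interpret P: submonoid P G by fact
  define p where "p s = strict_ext (\<beta> s) 1" for s
  have inG: "s \<in> carrier G" if "s \<in> P" for s
    using that by (rule P.mem_carrier)
  have hom: "\<beta> s (a + b) = \<beta> s a + \<beta> s b" "\<beta> s (c *\<^sub>C a) = c *\<^sub>C \<beta> s a"
    "\<beta> s (a * b) = \<beta> s a * \<beta> s b" "\<beta> s (a\<^sup>\<star>) = (\<beta> s a)\<^sup>\<star>" if "s \<in> P" for s a b c
    using tw that by (auto simp: twisted_system_def star_hom_def)
  have comp: "\<beta> (s \<otimes>\<^bsub>G\<^esub> t) a = \<beta> s (\<beta> t a)" if "s \<in> P" "t \<in> P" for s t a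
    using tw that by (auto simp: twisted_system_def)
  have \<beta>1: "\<beta> \<one>\<^bsub>G\<^esub> = id"
    using tw by (auto simp: twisted_system_def)
  have \<omega>n: "\<omega> s t * cnj (\<omega> s t) = 1" "cnj (\<omega> s t) * \<omega> s t = 1" "\<omega> s t \<noteq> 0"
    if "s \<in> P" "t \<in> P" for s t
  proof -
    have "cmod (\<omega> s t) = 1"
      using tw that by (auto simp: twisted_system_def)
    then show "\<omega> s t * cnj (\<omega> s t) = 1" "cnj (\<omega> s t) * \<omega> s t = 1" "\<omega> s t \<noteq> 0"
      by (auto simp: complex_norm_square[symmetric] mult.commute)
  qed
  have coc: "\<omega> r s * \<omega> (r \<otimes>\<^bsub>G\<^esub> s) t = \<omega> r (s \<otimes>\<^bsub>G\<^esub> t) * \<omega> s t" if "r \<in> P" "s \<in> P" "t \<in> P" for r s t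
    using tw that by (auto simp: twisted_system_def)
  have \<omega>11: "\<omega> \<one>\<^bsub>G\<^esub> \<one>\<^bsub>G\<^esub> = 1"
    using tw by (auto simp: twisted_system_def)
  have \<omega>1: "\<omega> \<one>\<^bsub>G\<^esub> s = 1" "\<omega> s \<one>\<^bsub>G\<^esub> = 1" if "s \<in> P" for s
    using coc[of "\<one>\<^bsub>G\<^esub>" "\<one>\<^bsub>G\<^esub>" s] coc[of s "\<one>\<^bsub>G\<^esub>" "\<one>\<^bsub>G\<^esub>"] \<omega>n(3)[of "\<one>\<^bsub>G\<^esub>" s] \<omega>n(3)[of s "\<one>\<^bsub>G\<^esub>"] that
    by (auto simp: \<omega>11 inG)
  have sext: "is_strict_ext (\<beta> s) (strict_ext (\<beta> s))" if s: "s \<in> P" for s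
  proof -
    obtain g where "is_strict_ext (\<beta> s) g"
      using tw s by (auto simp: twisted_system_def extendible_def)
    with strict_ext_eqI[OF this u] show ?thesis by simp
  qed
  have ehom: "strict_ext (\<beta> s) (m * n) = strict_ext (\<beta> s) m * strict_ext (\<beta> s) n"
    "strict_ext (\<beta> s) (m\<^sup>\<star>) = (strict_ext (\<beta> s) m)\<^sup>\<star>"
    "strict_ext (\<beta> s) (mult_embed a) = mult_embed (\<beta> s a)" if "s \<in> P" for s m n a
    using sext[OF that] by (auto simp: is_strict_ext_def star_hom_def)
  have one_star: "(1 :: 'a multiplier)\<^sup>\<star> = 1"
    by (rule multiplier_eqI) (simp add: lmul_star rmul_one lmul_one star_star)
  have p_proj: "p s * p s = p s" "(p s)\<^sup>\<star> = p s" if "s \<in> P" for s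
    using ehom(1)[OF that, of 1 1] ehom(2)[OF that, of 1] by (simp_all add: p_def one_star)
  have p_comp: "p (t \<otimes>\<^bsub>G\<^esub> s) = strict_ext (\<beta> t) (p s)" if s: "s \<in> P" and t: "t \<in> P" for s t
  proof -
    have eq: "\<beta> (t \<otimes>\<^bsub>G\<^esub> s) = \<beta> t \<circ> \<beta> s"
      using comp[OF t s] by auto
    have "is_strict_ext (\<beta> (t \<otimes>\<^bsub>G\<^esub> s)) (strict_ext (\<beta> t) \<circ> strict_ext (\<beta> s))"
      using sext[OF s] sext[OF t] unfolding eq
      by (auto simp: is_strict_ext_def star_hom_def intro: continuous_map_compose)
    then show ?thesis
      unfolding p_def by (simp add: strict_ext_eqI[OF _ u])
  qed
  have p_one: "p \<one>\<^bsub>G\<^esub> = 1"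
  proof -
    have "is_strict_ext (\<beta> \<one>\<^bsub>G\<^esub>) id"
      unfolding \<beta>1 by (auto simp: is_strict_ext_def star_hom_def)
    then show ?thesis
      unfolding p_def by (simp add: strict_ext_eqI[OF _ u])
  qed
  have mem: "x \<in> range (lmul (p s)) \<longleftrightarrow> lmul (p s) x = x" if "s \<in> P" for s x
    using p_proj(1)[OF that] by (metis lmul_times rangeE rangeI)
  have \<beta>_lmul: "\<beta> t (lmul m a) = lmul (strict_ext (\<beta> t) m) (\<beta> t a)" if "t \<in> P" for t m a
    by (rule mult_embed_inject) (simp add: mult_embed_lmul ehom that flip: ehom(3))
  have p_\<beta>: "lmul (p (t \<otimes>\<^bsub>G\<^esub> s)) (\<beta> t x) = \<beta> t x"
    if "s \<in> P" "t \<in> P" "lmul (p s) x = x" for s t x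
    using \<beta>_lmul[of t "p s" x] that by (simp add: p_comp)
  have p_le: "lmul (p t) (\<beta> t a) = \<beta> t a" if "t \<in> P" for t a
    using p_\<beta>[of "\<one>\<^bsub>G\<^esub>" t a] that by (simp add: p_one lmul_one inG)
  have mult_closed: "s \<otimes>\<^bsub>G\<^esub> t \<in> P" if "s \<in> P" "t \<in> P" for s t
    using that by (rule P.m_closed)
  let ?X = "twisted_product_system G \<beta> \<omega>" and ?Q = "opp_submonoid G P"
  have fib: "hcarrier (fibre ?X s) = range (lmul (p s))" "hinner (fibre ?X s) x y = x\<^sup>\<star> * y"
    "hright (fibre ?X s) x a = x * a" "hleft (fibre ?X s) a x = \<beta> s a * x" for s x y a
    by (simp_all add: twisted_product_system_def p_def)
  have psm: "psmult ?X (s, x) (t, y) = (t \<otimes>\<^bsub>G\<^esub> s, cnj (\<omega> t s) *\<^sub>C (\<beta> t x * y))" for s t x y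
    by (simp add: twisted_product_system_def)
  have hn: "hnorm (fibre ?X s) x = norm x" for s x
    by (simp add: hnorm_def fib cstar_identity)
  have Q: "carrier ?Q = P" "s \<otimes>\<^bsub>?Q\<^esub> t = t \<otimes>\<^bsub>G\<^esub> s" "\<one>\<^bsub>?Q\<^esub> = \<one>\<^bsub>G\<^esub>" for s t
    by (simp_all add: opp_submonoid_def)
  have bim: "hilbert_bimodule (fibre ?X s)" if s: "s \<in> P" for s
  proof -
    have "\<exists>x. (\<lambda>n. norm (f n - lmul (p s) x)) \<longlonglongrightarrow> 0"
      if f: "\<forall>n. lmul (p s) (f n) = f n" and C: "\<forall>e>0. \<exists>N. \<forall>m\<ge>N. \<forall>n\<ge>N. norm (f m - f n) < e"
      for f :: "nat \<Rightarrow> 'a"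
    proof -
      have "Cauchy f"
        using C by (auto simp: Cauchy_def dist_norm)
      then obtain x where x: "f \<longlonglongrightarrow> x"
        by (auto simp: Cauchy_convergent_iff convergent_def)
      have "lmul (p s) x = x"
        by (rule projection_closed[OF _ x]) (simp add: f)
      with x have "(\<lambda>n. norm (f n - lmul (p s) x)) \<longlonglongrightarrow> 0"
        by (simp add: tendsto_norm_zero_iff LIM_zero_iff)
      then show ?thesis ..
    qed
    then show ?thesis
      unfolding hilbert_bimodule_def Let_def fib hn Ball_def mem[OF s]
      using s
      by (intro conjI allI impI)
         (auto simp: lmul_add lmul_scaleC lmul_mult lmul_zero_right hom p_le distrib_left
           distrib_right mult.assoc mult_scaleC_left mult_scaleC_right star_mult star_star
           star_mult_self_eq_0)
  qed
  have closed: "psmult ?X (s, x) (t, y) \<in> {t \<otimes>\<^bsub>G\<^esub> s} \<times> hcarrier (fibre ?X (t \<otimes>\<^bsub>G\<^esub> s))"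
    if "s \<in> P" "t \<in> P" "x \<in> hcarrier (fibre ?X s)" "y \<in> hcarrier (fibre ?X t)" for s t x y
  proof -
    have "lmul (p s) x = x"
      using that by (simp add: fib mem)
    then have "lmul (p (t \<otimes>\<^bsub>G\<^esub> s)) (cnj (\<omega> t s) *\<^sub>C (\<beta> t x * y)) = cnj (\<omega> t s) *\<^sub>C (\<beta> t x * y)"
      using that by (simp add: lmul_scaleC lmul_mult p_\<beta>)
    with that show ?thesis
      by (simp add: psm fib mem mult_closed)
  qed
  have assoc: "psmult ?X (psmult ?X (s, x) (t, y)) (r, z) = psmult ?X (s, x) (psmult ?X (t, y) (r, z))"
    if "s \<in> P" "t \<in> P" "r \<in> P" for s t r x y z
  proof -
    have "cnj (\<omega> r (t \<otimes>\<^bsub>G\<^esub> s)) * cnj (\<omega> t s) = cnj (\<omega> (r \<otimes>\<^bsub>G\<^esub> t) s) * cnj (\<omega> r t)"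
      using arg_cong[OF coc[of r t s], of cnj] that by (simp add: mult.commute)
    with that show ?thesis
      by (simp add: psm hom comp m_assoc inG mult_scaleC_left mult_scaleC_right scaleC_scaleC
          mult.assoc)
  qed
  have isometric: "hinner (fibre ?X (t \<otimes>\<^bsub>G\<^esub> s)) (snd (psmult ?X (s, x) (t, y)))
      (snd (psmult ?X (s, x') (t, y'))) =
      hinner (fibre ?X t) y (hleft (fibre ?X t) (hinner (fibre ?X s) x x') y')"
    if "s \<in> P" "t \<in> P" for s t x x' y y'
    using that by (simp add: psm fib hom star_scaleC star_mult mult_scaleC_left mult_scaleC_right
        scaleC_scaleC \<omega>n scaleC_one mult.assoc)
  have dense: "\<exists>(n::nat) x y. (\<forall>k<n. x k \<in> hcarrier (fibre ?X s) \<and> y k \<in> hcarrier (fibre ?X t)) \<and>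
      hnorm (fibre ?X (t \<otimes>\<^bsub>G\<^esub> s)) (z - (\<Sum>k<n. snd (psmult ?X (s, x k) (t, y k)))) < e"
    if s: "s \<in> P" and t: "t \<in> P" and z: "z \<in> hcarrier (fibre ?X (t \<otimes>\<^bsub>G\<^esub> s))" and e: "0 < e"
    for s t z and e :: real
  proof -
    define q where "q = strict_ext (\<beta> t) (p s)"
    define y where "y = lmul (p t) z"
    have q: "q = p (t \<otimes>\<^bsub>G\<^esub> s)"
      using p_comp[OF s t] by (simp add: q_def)
    have "q * p t = q"
      using t by (simp add: q_def p_def flip: ehom(1))
    then have qy: "lmul q (lmul (p t) y) = z"
      using z mem[OF mult_closed[OF t s], of z]
      by (simp add: y_def fib q flip: lmul_times) (simp add: mult.assoc p_proj[OF t])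
    have "((\<lambda>i. \<beta> t (u i) * y) \<longlongrightarrow> lmul (p t) y) F"
      using is_strict_ext_tendsto(1)[OF sext[OF t] u] by (simp add: p_def)
    then have "\<forall>\<^sub>F i in F. dist (\<beta> t (u i) * y) (lmul (p t) y) < e"
      using e by (rule tendstoD)
    moreover have "F \<noteq> bot"
      using u by (simp add: approximate_identity_def)
    ultimately obtain i where i: "dist (\<beta> t (u i) * y) (lmul (p t) y) < e"
      using eventually_happens' by blast
    have "norm (lmul q (lmul (p t) y - \<beta> t (u i) * y)) \<le> norm (lmul (p t) y - \<beta> t (u i) * y)"
      by (rule projection_norm_le) (simp_all add: q p_proj mult_closed s t)
    also have "\<dots> < e"
      using i by (simp add: dist_norm norm_minus_commute)
    also have "lmul q (lmul (p t) y - \<beta> t (u i) * y) =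
        z - snd (psmult ?X (s, lmul (p s) (u i)) (t, \<omega> t s *\<^sub>C y))"
    proof -
      have diff: "lmul q (a - b) = lmul q a - lmul q b" for a b
        by (rule cstar_eqI_left) (simp add: lmul_rmul right_diff_distrib)
      show ?thesis
        unfolding diff qy
        using s t by (simp add: psm \<beta>_lmul q_def lmul_mult mult_scaleC_right scaleC_scaleC \<omega>n scaleC_one)
    qed
    finally have "hnorm (fibre ?X (t \<otimes>\<^bsub>G\<^esub> s))
        (z - (\<Sum>k<Suc 0. snd (psmult ?X (s, lmul (p s) (u i)) (t, \<omega> t s *\<^sub>C y)))) < e"
      by (simp add: hn)
    moreover have "\<omega> t s *\<^sub>C y \<in> hcarrier (fibre ?X t)" "lmul (p s) (u i) \<in> hcarrier (fibre ?X s)"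
      by (auto simp: fib y_def simp flip: lmul_scaleC)
    ultimately show ?thesis
      by (intro exI[of _ "Suc 0"] exI[of _ "\<lambda>_. lmul (p s) (u i)"] exI[of _ "\<lambda>_. \<omega> t s *\<^sub>C y"]) simp
  qed
  have monoid: "monoid ?Q"
    by (rule monoidI) (auto simp: Q m_assoc inG mult_closed)
  have fib1: "hcarrier (fibre ?X \<one>\<^bsub>G\<^esub>) = UNIV"
    by (auto simp: fib p_one lmul_one image_def)
  have coeff: "coeff ?X = id"
    by (simp add: twisted_product_system_def)
  have unit: "psmult ?X (\<one>\<^bsub>G\<^esub>, a) (s, x) = (s, hleft (fibre ?X s) a x)"
    "psmult ?X (s, x) (\<one>\<^bsub>G\<^esub>, a) = (s, hright (fibre ?X s) x a)" if "s \<in> P" for s a x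
    using that by (simp_all add: psm fib \<omega>1 \<beta>1 scaleC_one inG)
  show ?thesis
    unfolding product_system_def Q
    by (intro conjI ballI allI; (elim DiffE)?)
       (simp_all add: monoid bim closed[simplified] assoc isometric[unfolded fib(2-4)] dense fib1 coeff unit fib(2-4) \<beta>1)
qed

end

theory Submission
  imports Defs
begin

text \<open>Write \<open>p\<^sub>s\<close> for the projection \<open>\<beta>\<^sub>s(1)\<close>, so that \<open>X\<^sub>s = p\<^sub>s A\<close> and \<open>K(X\<^sub>s)\<close> is the corner \<open>p\<^sub>s A p\<^sub>s\<close>,
  in which \<open>S \<otimes> 1\<close> becomes \<open>\<beta>\<^sub>r(S)\<close>. The strict limits satisfy \<open>i\<^sub>P(s)\<^sup>* i\<^sub>A(a) = i\<^sub>X(s, p\<^sub>s a)\<close>, and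
  since \<open>i\<^sub>A\<close> is nondegenerate this formula yields all covariance relations already in the
  multiplier algebra of \<open>T\<^sub>c\<^sub>o\<^sub>v(X)\<close>. For the Nica relation it gives
  \<open>i\<^sub>X\<^sup>(\<^sup>s\<^sup>)(\<beta>\<^sub>s(a)) = i\<^sub>A(a) i\<^sub>P(s)\<^sup>* i\<^sub>P(s)\<close>. Conversely a covariant pair \<open>(\<pi>, V)\<close> defines the Nica covariant
  representation \<open>\<psi>(s, x) = V\<^sub>s\<^sup>* \<pi>(x)\<close>, and the homomorphism that it induces on \<open>T\<^sub>c\<^sub>o\<^sub>v(X)\<close> sends \<open>i\<^sub>P(s)\<close>
  to \<open>V\<^sub>s\<close> by the same formula.\<close>

section \<open>Star algebras\<close>

text \<open>Multipliers form a *-algebra with a strict topology but without a norm, so they are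
  compared through products with i_A(a). This favours the adjoint of i_P(s), whose product with
  i_A(a) falls back into the image of X. Adjoints reverse products and conjugate scalars; hence the
  opposite semigroup and the conjugate of \<omega> in X.

  The obstacle is that \<open>strict_ext\<close>, \<open>strict_lim\<close>,
  \<open>mult_ext\<close>, \<open>ampliation\<close> and \<open>join\<close> are definite
  descriptions and \<open>compact_ext\<close> is a choice, so each needs existence and uniqueness
  before it can be used. The values of \<open>compact_ext\<close> are pinned down by contractivity
  of *-homomorphisms, obtained here without spectral theory. The existence part of
  \<open>mult_ext\<close> needs multipliers to be bounded, which the double centraliser encoding
  leaves implicit. Extendibility of \<beta>_s enters as strict convergence of \<beta>_s(u_i) to
  p_s.\<close>

lemma star_zero: "(0::'a::star_algebra)\<^sup>\<star> = 0"
  using star_add[of "0::'a" 0] by simp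

lemma star_minus: "(- x::'a::star_algebra)\<^sup>\<star> = - x\<^sup>\<star>"
  using star_add[of x "- x"] by (simp add: star_zero eq_neg_iff_add_eq_0 add.commute)

lemma star_diff: "(x - y::'a::star_algebra)\<^sup>\<star> = x\<^sup>\<star> - y\<^sup>\<star>"
  using star_add[of x "- y"] by (simp add: star_minus)

lemma star_scaleR: "(r *\<^sub>R x::'a::star_algebra)\<^sup>\<star> = r *\<^sub>R x\<^sup>\<star>"
  by (simp add: scaleR_scaleC star_scaleC)

lemma bounded_linear_star: "bounded_linear (star :: 'a::cstar_algebra \<Rightarrow> 'a)"
  by (rule bounded_linear_intro[where K = 1]) (simp_all add: star_add star_scaleR cstar_norm_star)

lemmas tendsto_star = bounded_linear.tendsto[OF bounded_linear_star]

lemma bounded_linear_scaleC: "bounded_linear (\<lambda>x :: 'a::cstar_algebra. c *\<^sub>C x)"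
  by (rule bounded_linear_intro[where K = "cmod c"])
     (auto simp: scaleC_add_right norm_scaleC scaleR_scaleC scaleC_scaleC mult.commute)

lemmas tendsto_scaleC = bounded_linear.tendsto[OF bounded_linear_scaleC]

lemma scaleC_minus_left: "(- c) *\<^sub>C (x::'a::complex_vector_space) = - (c *\<^sub>C x)"
  using scaleC_add_left[of c "- c" x] scaleC_add_left[of 0 0 x]
  by (simp add: eq_neg_iff_add_eq_0 add.commute)

lemma star_hom_simps:
  assumes "star_hom f"
  shows "f (x + y) = f x + f y" "f (c *\<^sub>C x) = c *\<^sub>C f x" "f (x * y) = f x * f y" "f (x\<^sup>\<star>) = (f x)\<^sup>\<star>"
    "f 0 = 0" "f (- x) = - f x" "f (x - y) = f x - f y"
proof -
  show *: "f (x + y) = f x + f y" "f (c *\<^sub>C x) = c *\<^sub>C f x" "f (x * y) = f x * f y" "f (x\<^sup>\<star>) = (f x)\<^sup>\<star>"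
    for x y c
    using assms by (auto simp: star_hom_def)
  show 0: "f 0 = 0"
    using *(1)[of 0 0] by simp
  show m: "f (- x) = - f x" for x
    using *(1)[of x "- x"] by (simp add: 0 eq_neg_iff_add_eq_0 add.commute)
  show "f (x - y) = f x - f y"
    using *(1)[of x "- y"] by (simp add: m)
qed


section \<open>Homomorphisms are contractive\<close>

text \<open>With a formal unit, \<open>eq\<close> reads c^2 + (1 - d)^2 = 1. Contractivity is
  derived from an equation because every *-homomorphism preserves it. Unitarity is tested on
  elements y, where y - d * y makes sense without a unit.\<close>

lemma cstar_unitary_part_norm_le:
  fixes c d :: "'b::cstar_algebra"
  assumes c: "c\<^sup>\<star> = c" and d: "d\<^sup>\<star> = d" and comm: "c * d = d * c" and eq: "c * c = 2 *\<^sub>R d - d * d"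
  shows "norm c \<le> 1"
proof -
  have cy: "norm (c * y) \<le> norm y" for y
  proof -
    txt \<open>In the unitization, \<open>c \<plusminus> i(1 - d)\<close> is unitary, and \<open>c\<close> is the mean of these two unitaries.\<close>
    have unit: "norm (c * y + k *\<^sub>C (y - d * y)) = norm y" if k: "cnj k = - k" "k * k = - 1" for k
    proof -
      define z where "z = y - d * y"
      have ccy: "c * (c * y) = 2 *\<^sub>R (d * y) - d * (d * y)"
        by (simp add: mult.assoc[symmetric] eq left_diff_distrib)
      have cz: "c * z = c * y - d * (c * y)"
        by (simp add: z_def right_diff_distrib comm flip: mult.assoc)
      have zs: "z\<^sup>\<star> = y\<^sup>\<star> - y\<^sup>\<star> * d"
        by (simp add: z_def star_diff star_mult d)
      have "(c * y + k *\<^sub>C z)\<^sup>\<star> * (c * y + k *\<^sub>C z) =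
          y\<^sup>\<star> * (c * (c * y)) + k *\<^sub>C (y\<^sup>\<star> * (c * z)) - k *\<^sub>C (z\<^sup>\<star> * (c * y)) + z\<^sup>\<star> * z"
        using k by (simp add: star_add star_mult star_scaleC c distrib_left distrib_right
          mult_scaleC_left mult_scaleC_right scaleC_scaleC mult.assoc scaleC_minus_left scaleC_one
          left_diff_distrib scaleC_diff_right)
      also have "\<dots> = y\<^sup>\<star> * y"
        unfolding cz zs ccy
        by (simp add: z_def algebra_simps scaleC_diff_right scaleR_2)
      finally have "(norm (c * y + k *\<^sub>C z))\<^sup>2 = (norm y)\<^sup>2"
        by (metis cstar_identity)
      then show ?thesis
        by (simp add: z_def)
    qed
    have "2 *\<^sub>R (c * y) = (c * y + \<i> *\<^sub>C (y - d * y)) + (c * y + (- \<i>) *\<^sub>C (y - d * y))"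
      by (simp add: scaleR_2 scaleC_minus_left)
    then have "norm (2 *\<^sub>R (c * y)) \<le> norm y + norm y"
      using norm_triangle_ineq[of "c * y + \<i> *\<^sub>C (y - d * y)" "c * y + (- \<i>) *\<^sub>C (y - d * y)"]
      by (simp only:) (simp add: unit)
    then show ?thesis by simp
  qed
  \<comment> \<open>The C*-identity for self-adjoint c, followed by \<open>cy\<close> at y =
    c.\<close>
  have "norm c * norm c = norm (c * c)"
    using cstar_identity[of c] by (simp add: c power2_eq_square)
  also have "\<dots> \<le> norm c"
    by (rule cy)
  finally show ?thesis
    by (cases "c = 0") auto
qed


lemma cstar_subalgebra_UNIV: "cstar_subalgebra UNIV"
  by (simp add: cstar_subalgebra_def)

text \<open>In the unitization b is 1 - sqrt(1 - a^2), since the last equation reads (1 - b)^2 = 1 -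
  a^2. It is the fixed point of b -> (a^2 + b^2) / 2, a contraction with constant
  \<open>norm a\<close> on the ball of radius \<open>norm a\<close>. Membership in C,
  self-adjointness and commuting with a are closed conditions preserved by the map, so they are
  built into its domain S.\<close>

lemma cstar_subalgebra_quadratic:
  fixes a :: "'a::cstar_algebra"
  assumes C: "cstar_subalgebra C" "a \<in> C" and a: "a\<^sup>\<star> = a" "norm a < 1"
  obtains b where "b \<in> C" "b\<^sup>\<star> = b" "a * b = b * a" "2 *\<^sub>R b = a * a + b * b"
proof -
  define S where "S = C \<inter> {b. b\<^sup>\<star> = b} \<inter> {b. a * b = b * a} \<inter> cball 0 (norm a)"
  define g where "g b = (1 / 2) *\<^sub>R (a * a + b * b)" for b
  have sc: "r *\<^sub>R x \<in> C" if "x \<in> C" for r x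
    using C that by (simp add: cstar_subalgebra_def scaleR_scaleC)
  have S_iff: "b \<in> S \<longleftrightarrow> b \<in> C \<and> b\<^sup>\<star> = b \<and> a * b = b * a \<and> norm b \<le> norm a" for b
    by (auto simp: S_def)
  have "\<exists>!b\<in>S. g b = b"
  proof (rule Banach_fix[where c = "norm a"])
    have "closed S"
      unfolding S_def using C
      by (intro closed_Int closed_Collect_eq continuous_intros closed_cball
          linear_continuous_on[OF bounded_linear_star]) (simp_all add: cstar_subalgebra_def)
    then show "complete S"
      by (simp add: complete_eq_closed)
    show "S \<noteq> {}"
    proof -
      have "0 \<in> S"
        using C by (simp add: S_iff cstar_subalgebra_def star_zero)
      then show ?thesis by blast
    qed
    show "0 \<le> norm a" "norm a < 1"
      using a by simp_all
    show "g ` S \<subseteq> S"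
    proof safe
      fix b assume b: "b \<in> S"
      have nb: "norm b \<le> norm a" and comm: "a * b = b * a"
        using b by (auto simp: S_iff)
      have "norm (a * a) \<le> norm a * norm a" "norm (b * b) \<le> norm a * norm a"
        using norm_mult_ineq[of a a] norm_mult_ineq[of b b] mult_mono[OF nb nb] by auto
      then have "norm (g b) \<le> norm a * norm a"
        using norm_triangle_ineq[of "a * a" "b * b"] by (simp add: g_def)
      also have "\<dots> \<le> norm a"
        using a by (simp add: mult_left_le_one_le)
      finally have "norm (g b) \<le> norm a" .
      moreover have "a * (b * b) = b * b * a"
        by (metis comm mult.assoc)
      moreover have "a * a + b * b \<in> C"
        using b C by (simp add: S_iff cstar_subalgebra_def)
      ultimately show "g b \<in> S"
        using b a by (auto simp: S_iff g_def sc star_scaleR star_add star_mult distrib_left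
            distrib_right mult.assoc)
    qed
    show "dist (g x) (g y) \<le> norm a * dist x y" if "x \<in> S" "y \<in> S" for x y
    proof -
      have n: "norm x \<le> norm a" "norm y \<le> norm a"
        using that by (auto simp: S_iff)
      have "norm (x * x - y * y) = norm (x * (x - y) + (x - y) * y)"
        by (simp add: algebra_simps)
      also have "\<dots> \<le> norm x * norm (x - y) + norm (x - y) * norm y"
        by (intro order.trans[OF norm_triangle_ineq] add_mono norm_mult_ineq)
      also have "\<dots> \<le> norm a * norm (x - y) + norm (x - y) * norm a"
        by (intro add_mono mult_left_mono mult_right_mono n) simp_all
      finally have "norm (x * x - y * y) \<le> 2 * (norm a * norm (x - y))"
        by simp
      moreover have "g x - g y = (1 / 2) *\<^sub>R (x * x - y * y)"
        by (simp add: g_def flip: scaleR_diff_right)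
      ultimately show ?thesis
        by (simp add: dist_norm)
    qed
  qed
  then obtain b where b: "b \<in> S" "g b = b"
    by blast
  have "2 *\<^sub>R g b = a * a + b * b"
    by (simp add: g_def)
  with b that show ?thesis
    by (auto simp: S_iff)
qed

text \<open>The laws are assumed on C only, because the lemma is applied to maps on a corner that
  are unspecified elsewhere. For self-adjoint x of norm below 1 the quadratic relation between x and
  b passes to f x and f b and forces norm at most 1; scaling and the C*-identity do the
  rest.\<close>

lemma cstar_subalgebra_hom_contractive:
  fixes f :: "'a::cstar_algebra \<Rightarrow> 'b::cstar_algebra"
  assumes C: "cstar_subalgebra C" and a: "a \<in> C"
    and add: "\<And>x y. x \<in> C \<Longrightarrow> y \<in> C \<Longrightarrow> f (x + y) = f x + f y"
    and scale: "\<And>c x. x \<in> C \<Longrightarrow> f (c *\<^sub>C x) = c *\<^sub>C f x"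
    and mult: "\<And>x y. x \<in> C \<Longrightarrow> y \<in> C \<Longrightarrow> f (x * y) = f x * f y"
    and star: "\<And>x. x \<in> C \<Longrightarrow> f (x\<^sup>\<star>) = (f x)\<^sup>\<star>"
  shows "norm (f a) \<le> norm a"
proof -
  have C': "x + y \<in> C" "x * y \<in> C" "x\<^sup>\<star> \<in> C" "c *\<^sub>C x \<in> C" if "x \<in> C" "y \<in> C" for x y c
    using C that by (simp_all add: cstar_subalgebra_def)
  have scaleR: "f (r *\<^sub>R x) = r *\<^sub>R f x" if "x \<in> C" for r x
    using that by (simp add: scaleR_scaleC scale)
  have unit: "norm (f x) \<le> 1" if x: "x \<in> C" "x\<^sup>\<star> = x" "norm x < 1" for x
  proof -
    obtain b where b: "b \<in> C" "b\<^sup>\<star> = b" "x * b = b * x" "2 *\<^sub>R b = x * x + b * b"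
      using cstar_subalgebra_quadratic[OF C x] .
    have "2 *\<^sub>R f b = f x * f x + f b * f b"
      by (simp add: C' x b add mult flip: scaleR)
    then show ?thesis
      by (intro cstar_unitary_part_norm_le[of _ "f b"])
         (simp_all add: x b flip: star mult)
  qed
  have selfadj: "norm (f x) \<le> norm x" if x: "x \<in> C" "x\<^sup>\<star> = x" for x
  proof (rule dense_ge)
    fix t assume t: "norm x < t"
    then have pos: "0 < t"
      using norm_ge_zero[of x] by linarith
    have "norm (f ((1 / t) *\<^sub>R x)) \<le> 1"
      using pos t x by (intro unit) (simp_all add: scaleR_scaleC C' star_scaleC norm_scaleC norm_divide)
    then show "norm (f x) \<le> t"
      using pos x by (simp add: scaleR field_simps)
  qed
  have "(norm (f a))\<^sup>2 = norm (f (a\<^sup>\<star> * a))"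
    using a by (simp add: mult star C' cstar_identity)
  also have "\<dots> \<le> norm (a\<^sup>\<star> * a)"
    using a by (intro selfadj) (simp_all add: C' star_mult star_star)
  finally have "(norm (f a))\<^sup>2 \<le> (norm a)\<^sup>2"
    by (simp add: cstar_identity)
  then show ?thesis
    by (rule power2_le_imp_le) simp
qed

lemma star_hom_contractive:
  fixes f :: "'a::cstar_algebra \<Rightarrow> 'b::cstar_algebra"
  assumes "star_hom f"
  shows "norm (f a) \<le> norm a"
  by (rule cstar_subalgebra_hom_contractive[OF cstar_subalgebra_UNIV])
     (simp_all add: star_hom_simps[OF assms])

lemma star_hom_bounded_linear:
  fixes f :: "'a::cstar_algebra \<Rightarrow> 'b::cstar_algebra"
  assumes "star_hom f"
  shows "bounded_linear f"
  by (rule bounded_linear_intro[where K = 1])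
     (simp_all add: star_hom_simps[OF assms] scaleR_scaleC star_hom_contractive[OF assms])

lemmas tendsto_star_hom = bounded_linear.tendsto[OF star_hom_bounded_linear]


section \<open>Dense subspaces and equibounded families\<close>

lemma closure_cspan_subset:
  fixes S :: "'a::{complex_vector_space, real_normed_vector} set"
  assumes "X \<subseteq> S" "closed S" "0 \<in> S" "\<And>x y. x \<in> S \<Longrightarrow> y \<in> S \<Longrightarrow> x + y \<in> S"
    and "\<And>c x. x \<in> S \<Longrightarrow> c *\<^sub>C x \<in> S"
  shows "closure (cspan X) \<subseteq> S"
proof (rule closure_minimal[OF _ assms(2)])
  have "subspace S"
    using assms by (simp add: subspace_def scaleR_scaleC)
  then show "cspan X \<subseteq> S"
    unfolding cspan_def using assms(1,5) by (intro span_minimal) auto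
qed

lemma
  fixes X :: "'a::cstar_algebra set"
  shows closure_cspan_base: "x \<in> X \<Longrightarrow> x \<in> closure (cspan X)"
    and closure_cspan_zero: "0 \<in> closure (cspan X)"
    and closure_cspan_add: "x \<in> closure (cspan X) \<Longrightarrow> y \<in> closure (cspan X) \<Longrightarrow> x + y \<in> closure (cspan X)"
    and closure_cspan_scaleC: "x \<in> closure (cspan X) \<Longrightarrow> c *\<^sub>C x \<in> closure (cspan X)"
proof -
  have sub: "subspace (cspan X)"
    unfolding cspan_def by (rule subspace_span)
  show "x \<in> closure (cspan X)" if "x \<in> X"
  proof -
    have "1 *\<^sub>C x \<in> cspan X"
      unfolding cspan_def using that by (intro span_base) blast
    then show ?thesis
      using closure_subset by (auto simp: scaleC_one)
  qed
  show "0 \<in> closure (cspan X)"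
    using sub closure_subset by (auto simp: subspace_def)
  show "x + y \<in> closure (cspan X)" if xy: "x \<in> closure (cspan X)" "y \<in> closure (cspan X)"
  proof -
    obtain f g where "\<And>n. f n \<in> cspan X" "f \<longlonglongrightarrow> x" "\<And>n. g n \<in> cspan X" "g \<longlonglongrightarrow> y"
      using xy unfolding closure_sequential by blast
    then have "\<And>n. f n + g n \<in> cspan X" "(\<lambda>n. f n + g n) \<longlonglongrightarrow> x + y"
      using sub by (auto simp: subspace_def intro: tendsto_add)
    then show ?thesis
      unfolding closure_sequential by (intro exI[of _ "\<lambda>n. f n + g n"]) simp
  qed
  show "c *\<^sub>C x \<in> closure (cspan X)" if x: "x \<in> closure (cspan X)"
  proof -
    have "c *\<^sub>C y \<in> cspan X" if "y \<in> cspan X" for y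
      using that unfolding cspan_def
    proof (induction rule: span_induct_alt)
      case base
      then show ?case by (simp add: scaleC_zero_right span_zero)
    next
      case (step r z w)
      then obtain d v where "z = d *\<^sub>C v" "v \<in> X" by blast
      have "c *\<^sub>C r *\<^sub>R z = r *\<^sub>R ((c * d) *\<^sub>C v)"
        unfolding \<open>z = d *\<^sub>C v\<close>
        by (simp add: scaleR_scaleC scaleC_scaleC mult_ac)
      moreover have "(c * d) *\<^sub>C v \<in> span {c *\<^sub>C x |c x. x \<in> X}"
        using \<open>v \<in> X\<close> by (intro span_base) blast
      ultimately have "c *\<^sub>C r *\<^sub>R z \<in> span {c *\<^sub>C x |c x. x \<in> X}"
        by (simp add: span_scale)
      then show ?case
        using step.IH unfolding scaleC_add_right by (rule span_add)
    qed
    then have "(*\<^sub>C) c ` cspan X \<subseteq> closure (cspan X)"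
      using closure_subset by blast
    then have "(*\<^sub>C) c ` closure (cspan X) \<subseteq> closure (cspan X)"
      by (intro image_closure_subset linear_continuous_on bounded_linear_scaleC) simp_all
    with x show ?thesis by blast
  qed
qed

text \<open>Together with a dense span this reduces convergence of a uniformly bounded net of maps
  to a check on generators.\<close>

lemma equibounded_null_closed:
  fixes T :: "'i \<Rightarrow> 'x::real_normed_vector \<Rightarrow> 'y::real_normed_vector"
  assumes diff: "\<And>i x y. T i (x - y) = T i x - T i y" and K: "\<And>i x. norm (T i x) \<le> K * norm x"
  shows "closed {x. ((\<lambda>i. T i x) \<longlongrightarrow> 0) F}"
proof (rule closed_sequential_limits[THEN iffD2], safe)
  fix X l assume X: "\<forall>n::nat. X n \<in> {x. ((\<lambda>i. T i x) \<longlongrightarrow> 0) F}" and l: "X \<longlonglongrightarrow> l"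
  \<comment> \<open>K may be 0; the maximum with 1 keeps the division by K' legitimate.\<close>
  define K' where "K' = max K 1"
  have K'_pos: "K' > 0" by (simp add: K'_def)
  have K': "norm (T i x) \<le> K' * norm x" for i x
    using K[of i x] mult_right_mono[of K K' "norm x"] by (simp add: K'_def)
  show "((\<lambda>i. T i l) \<longlongrightarrow> 0) F"
  proof (rule tendstoI)
    fix e :: real assume e: "0 < e"
    then obtain n where n: "dist (X n) l < e / (2 * K')"
      using l K'_pos unfolding lim_sequentially
      by (meson divide_pos_pos mult_pos_pos order_refl zero_less_numeral)
    have "\<forall>\<^sub>F i in F. dist (T i (X n)) 0 < e / 2"
      using X e by (intro tendstoD) auto
    then show "\<forall>\<^sub>F i in F. dist (T i l) 0 < e"
    proof eventually_elim
      case (elim i)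
      have "norm (T i l - T i (X n)) \<le> K' * norm (l - X n)"
        using K'[of i "l - X n"] by (simp add: diff)
      also have "\<dots> < e / 2"
        using n K'_pos by (simp add: dist_norm norm_minus_commute field_simps)
      finally show ?case
        using elim norm_triangle_ineq[of "T i l - T i (X n)" "T i (X n)"] by simp
    qed
  qed
qed

text \<open>The limit at l has no candidate in advance, so the net at l is shown to be Cauchy and
  completeness supplies the limit.\<close>

lemma equibounded_convergent_closed:
  fixes T :: "'i \<Rightarrow> 'x::real_normed_vector \<Rightarrow> 'y::banach"
  assumes diff: "\<And>i x y. T i (x - y) = T i x - T i y" and K: "\<And>i x. norm (T i x) \<le> K * norm x"
    and F: "F \<noteq> bot"
  shows "closed {x. \<exists>l. ((\<lambda>i. T i x) \<longlongrightarrow> l) F}"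
proof (rule closed_sequential_limits[THEN iffD2], safe)
  fix X l assume X: "\<forall>n::nat. X n \<in> {x. \<exists>l. ((\<lambda>i. T i x) \<longlongrightarrow> l) F}" and l: "X \<longlonglongrightarrow> l"
  define K' where "K' = max K 1"
  have K'_pos: "K' > 0" by (simp add: K'_def)
  have K': "norm (T i x) \<le> K' * norm x" for i x
    using K[of i x] mult_right_mono[of K K' "norm x"] by (simp add: K'_def)
  have "cauchy_filter (filtermap (\<lambda>i. T i l) F)"
    unfolding cauchy_filter_metric_filtermap
  proof safe
    fix e :: real assume e: "0 < e"
    then obtain n where n: "dist (X n) l < e / (4 * K')"
      using l K'_pos unfolding lim_sequentially
      by (meson divide_pos_pos mult_pos_pos order_refl zero_less_numeral)
    obtain m where m: "((\<lambda>i. T i (X n)) \<longlongrightarrow> m) F"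
      using X by blast
    \<comment> \<open>The path from T i l to T j l runs through T i (X n), m and T j (X n): four
      steps of length below e / 4.\<close>
    have "dist (T i l) (T j l) < e"
      if "dist (T i (X n)) m < e / 4" "dist (T j (X n)) m < e / 4" for i j
    proof -
      have "dist (T i l) (T i (X n)) < e / 4" for i
      proof -
        have "dist (T i l) (T i (X n)) \<le> K' * norm (l - X n)"
          using K'[of i "l - X n"] by (simp add: diff dist_norm)
        also have "\<dots> < e / 4"
          using n K'_pos by (simp add: dist_norm norm_minus_commute field_simps)
        finally show ?thesis .
      qed
      from this[of i] this[of j] that show ?thesis
        using dist_triangle[of "T i l" "T j l" "T i (X n)"] dist_triangle[of "T i (X n)" "T j l" m]
          dist_triangle[of m "T j l" "T j (X n)"]
        by (simp add: dist_commute)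
    qed
    moreover have "\<forall>\<^sub>F i in F. dist (T i (X n)) m < e / 4"
      using m e by (intro tendstoD) auto
    ultimately show "\<exists>P. eventually P F \<and> (\<forall>x y. P x \<and> P y \<longrightarrow> dist (T x l) (T y l) < e)"
      by blast
  qed
  then have "\<exists>z. filtermap (\<lambda>i. T i l) F \<le> nhds z"
    by (rule cauchy_filter_complete_converges[OF _ complete_UNIV])
       (use F in \<open>simp_all add: filtermap_bot_iff\<close>)
  then show "\<exists>m. ((\<lambda>i. T i l) \<longlongrightarrow> m) F"
    by (auto simp: filterlim_def)
qed


section \<open>Multipliers and extensions of nondegenerate representations\<close>

lemma star_hom_mult_embed: "star_hom mult_embed"
  unfolding star_hom_def
  by (intro conjI allI multiplier_eqI)
     (simp_all add: lmul_mult_embed lmul_plus lmul_scaleC_mult lmul_times lmul_star rmul_mult_embed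
       distrib_right mult_scaleC_left mult.assoc star_mult star_star)

lemma lmul_diff: "lmul m (a - b) = lmul m a - lmul m b"
  by (rule cstar_eqI_left) (simp add: lmul_rmul right_diff_distrib)

lemma rmul_diff: "rmul (a - b) m = rmul a m - rmul b m"
  by (rule cstar_eqI_right) (simp add: lmul_rmul[symmetric] left_diff_distrib)

lemma rmul_mult: "rmul (a * b) m = a * rmul b m"
  by (rule cstar_eqI_right) (simp add: lmul_rmul[symmetric] mult.assoc)

lemma mult_embed_rmul: "mult_embed (rmul a m) = mult_embed a * m"
  by (rule multiplier_eqI) (simp add: lmul_mult_embed lmul_times lmul_rmul)

lemma multiplier_one_star: "(1 :: 'a::cstar_algebra multiplier)\<^sup>\<star> = 1"
  by (rule multiplier_eqI) (simp add: lmul_star rmul_one lmul_one star_star)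

text \<open>Uniform boundedness by Baire category. Continuity of \<open>lmul m\<close> is not yet
  known, so S n is described through a * lmul m x = rmul a m * x, which is continuous in x for each
  fixed a. The closed sets S n exhaust the space, hence one of them contains a ball.\<close>

lemma lmul_norm_bound:
  fixes m :: "'a::cstar_algebra multiplier"
  obtains K where "0 \<le> K" "\<And>a. norm (lmul m a) \<le> K * norm a"
proof -
  \<comment> \<open>Up to the trivial case y = 0, the norm of y is attained at a = y^* / norm y, by
    the C*-identity.\<close>
  have dual: "norm y \<le> c" if c: "\<And>a. norm a \<le> 1 \<Longrightarrow> norm (a * y) \<le> c" for y :: 'a and c
  proof (cases "y = 0")
    case True
    then show ?thesis using c[of 0] by simp
  next
    case False
    define a where "a = (1 / norm y) *\<^sub>R y\<^sup>\<star>"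
    have "norm (a * y) = norm y"
      using False by (simp add: a_def cstar_identity power2_eq_square)
    moreover have "norm a \<le> 1"
      using False by (simp add: a_def cstar_norm_star)
    ultimately show ?thesis using c[of a] by simp
  qed
  define S where "S n = {x. \<forall>a. norm a \<le> 1 \<longrightarrow> norm (rmul a m * x) \<le> real n}" for n
  have S: "norm (lmul m x) \<le> real n" if "x \<in> S n" for x n
    by (rule dual) (use that in \<open>simp add: S_def lmul_rmul\<close>)
  have cl: "closed (S n)" for n
    unfolding S_def by (intro closed_Collect_all closed_Collect_imp closed_Collect_le continuous_intros) simp_all
  have "x \<in> S (nat \<lceil>norm (lmul m x)\<rceil>)" for x
  proof -
    have le: "norm (a * lmul m x) \<le> norm (lmul m x)" if "norm a \<le> 1" for a
      using norm_mult_ineq[of a "lmul m x"] mult_right_mono[OF that, of "norm (lmul m x)"] by simp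
    then show ?thesis
      unfolding S_def lmul_rmul[symmetric]
      by (intro CollectI allI impI order_trans[OF le real_nat_ceiling_ge])
  qed
  then have "\<Union>(range S) = UNIV"
    by blast
  moreover have "Met_TC.mtopology interior_of \<Union>(range S) = {}" if "\<And>n. interior (S n) = {}"
    using that by (intro Met_TC.metric_Baire_category_alt) (auto simp: cl complete_UNIV)
  ultimately obtain n where "interior (S n) \<noteq> {}"
    by force
  then obtain x e where e: "0 < e" "ball x e \<subseteq> S n"
    by (auto simp: mem_interior)
  have small: "norm (lmul m z) \<le> 2 * real n" if "norm z < e" for z
  proof -
    have "norm (lmul m (x + z)) \<le> n" "norm (lmul m x) \<le> n"
      using e that by (auto intro!: S simp: subset_iff dist_norm)
    moreover have "lmul m z = lmul m (x + z) - lmul m x"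
      by (simp add: lmul_add)
    ultimately show ?thesis
      using norm_triangle_ineq4[of "lmul m (x + z)" "lmul m x"] by simp
  qed
  \<comment> \<open>The bound 2 n holds for norms below e. Scaling a to norm e / 2 turns it into the
    factor 4 n / e.\<close>
  have "norm (lmul m a) \<le> (4 * real n / e) * norm a" for a
  proof (cases "a = 0")
    case False
    define r where "r = e / (2 * norm a)"
    have r: "r > 0" "norm (r *\<^sub>R a) < e"
      using False e by (simp_all add: r_def)
    have "lmul m (r *\<^sub>R a) = r *\<^sub>R lmul m a"
      by (simp add: scaleR_scaleC lmul_scaleC)
    then have "r * norm (lmul m a) \<le> 2 * real n"
      using small[OF r(2)] r by simp
    then show ?thesis
      using False e by (simp add: r_def field_simps)
  qed (simp add: lmul_zero_right)
  with e show ?thesis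
    by (intro that[of "4 * real n / e"]) auto
qed

lemma bounded_linear_lmul: "bounded_linear (lmul m)"
proof -
  obtain K where "\<And>a. norm (lmul m a) \<le> K * norm a"
    using lmul_norm_bound by blast
  then show ?thesis
    by (intro bounded_linear_intro[where K = K])
       (simp_all add: lmul_add scaleR_scaleC lmul_scaleC mult.commute)
qed

lemmas tendsto_lmul = bounded_linear.tendsto[OF bounded_linear_lmul]

section \<open>Strong limits and the extension of nondegenerate representations to
  multipliers\<close>

lemma bounded_linear_bop_apply_left: "bounded_linear (\<lambda>T. bop_apply T h)"
  by (rule bounded_linear_intro[where K = "norm h"])
     (simp_all add: bop_apply_plus bop_apply_scaleR norm_bop_apply)

lemmas tendsto_bop_apply_left = bounded_linear.tendsto[OF bounded_linear_bop_apply_left]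

lemmas bop_apply_add_right = linear_add[OF bounded_linear.linear[OF bop_apply_bounded_linear]]
  and bop_apply_diff_right = linear_diff[OF bounded_linear.linear[OF bop_apply_bounded_linear]]
  and bop_apply_zero_right = linear_0[OF bounded_linear.linear[OF bop_apply_bounded_linear]]

lemma nondegenerate_rep_induct:
  assumes \<pi>: "nondegenerate_rep \<pi>" and S: "closed S" "\<And>a h. bop_apply (\<pi> a) h \<in> S"
    and add: "\<And>x y. x \<in> S \<Longrightarrow> y \<in> S \<Longrightarrow> x + y \<in> S" and sc: "\<And>c x. x \<in> S \<Longrightarrow> c *\<^sub>C x \<in> S"
  shows "h \<in> S"
proof -
  have "0 \<in> S"
    using S(2)[of 0 0] by (simp add: bop_apply_zero_right)
  then have "closure (cspan {bop_apply (\<pi> a) h | a h. True}) \<subseteq> S"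
    using S add sc by (intro closure_cspan_subset) auto
  then show ?thesis
    using \<pi> by (auto simp: nondegenerate_rep_def)
qed

lemma nondegenerate_rep_eqI:
  assumes \<pi>: "nondegenerate_rep \<pi>" and eq: "\<And>a. S * \<pi> a = T * \<pi> a"
  shows "S = T"
proof (rule bop_eqI)
  fix h
  have "bop_apply S (bop_apply (\<pi> a) h) = bop_apply T (bop_apply (\<pi> a) h)" for a h
    by (metis bop_apply_times eq)
  moreover have "closed {h. bop_apply S h = bop_apply T h}"
    by (intro closed_Collect_eq linear_continuous_on bop_apply_bounded_linear)
  ultimately have "h \<in> {h. bop_apply S h = bop_apply T h}"
    by - (rule nondegenerate_rep_induct[OF \<pi>]; simp add: bop_apply_add_right bop_apply_scaleC)
  then show "bop_apply S h = bop_apply T h" by simp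
qed

text \<open>Contractivity of \<pi> bounds T i uniformly by 2, so it is enough to treat vectors
  \<pi>(a) h, where u_i a -> a in norm.\<close>

lemma nondegenerate_rep_approximate_identity:
  assumes \<pi>: "nondegenerate_rep \<pi>" and u: "approximate_identity F u"
  shows "((\<lambda>i. bop_apply (\<pi> (u i)) h) \<longlongrightarrow> h) F"
proof -
  have hom: "star_hom \<pi>"
    using \<pi> by (simp add: nondegenerate_rep_def)
  define T where "T i h = bop_apply (\<pi> (u i)) h - h" for i h
  have "norm (T i h) \<le> 2 * norm h" for i h
  proof -
    have "norm (\<pi> (u i)) \<le> 1"
      using star_hom_contractive[OF hom, of "u i"] u order_trans
      unfolding approximate_identity_def by blast
    then have "norm (bop_apply (\<pi> (u i)) h) \<le> 1 * norm h"
      by (rule order_trans[OF norm_bop_apply mult_right_mono]) simp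
    then show ?thesis
      unfolding T_def using norm_triangle_ineq4[of "bop_apply (\<pi> (u i)) h" h] by simp
  qed
  then have cl: "closed {h. ((\<lambda>i. T i h) \<longlongrightarrow> 0) F}"
    by (intro equibounded_null_closed[where K = 2]) (simp_all add: T_def bop_apply_diff_right)
  have "((\<lambda>i. T i (bop_apply (\<pi> a) h)) \<longlongrightarrow> 0) F" for a h
  proof -
    have "((\<lambda>i. bop_apply (\<pi> (u i * a)) h) \<longlongrightarrow> bop_apply (\<pi> a) h) F"
      using u by (intro tendsto_bop_apply_left tendsto_star_hom[OF hom]) (simp add: approximate_identity_def)
    then show ?thesis
      unfolding T_def by (subst LIM_zero_iff) (simp add: star_hom_simps[OF hom] bop_apply_times)
  qed
  moreover have "T i (x + y) = T i x + T i y" "T i (c *\<^sub>C x) = c *\<^sub>C T i x" for i x y c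
    by (simp_all add: T_def bop_apply_add_right bop_apply_scaleC scaleC_diff_right)
  ultimately have "h \<in> {h. ((\<lambda>i. T i h) \<longlongrightarrow> 0) F}"
    by - (rule nondegenerate_rep_induct[OF \<pi> cl],
        auto dest: tendsto_add[where a = 0 and b = 0]
         bounded_linear.tendsto[OF bounded_linear_scaleC_hilbert] simp: scaleC_zero_right)
  then show ?thesis
    unfolding T_def by (simp add: LIM_zero_iff)
qed

text \<open>The operator is the strong limit of \<sigma>(m u_i). Boundedness of m and contractivity
  of \<sigma> bound this net uniformly, and on \<sigma>(b) h it converges to \<sigma>(m b) h, which
  both yields the limit everywhere and identifies it.\<close>

lemma multiplier_operator_exists:
  fixes \<sigma> :: "'b::cstar_algebra \<Rightarrow> 'h::complex_hilbert_space bop" and u :: "'i \<Rightarrow> 'b"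
  assumes \<sigma>: "nondegenerate_rep \<sigma>" and u: "approximate_identity F u"
  shows "\<exists>T. \<forall>b. T * \<sigma> b = \<sigma> (lmul m b)"
proof -
  have hom: "star_hom \<sigma>"
    using \<sigma> by (simp add: nondegenerate_rep_def)
  have F: "F \<noteq> bot" and u1: "\<And>i. norm (u i) \<le> 1" and ua: "\<And>a. ((\<lambda>i. u i * a) \<longlongrightarrow> a) F"
    using u by (auto simp: approximate_identity_def)
  obtain K where K: "0 \<le> K" "\<And>a. norm (lmul m a) \<le> K * norm a"
    using lmul_norm_bound by blast
  define T where "T i h = bop_apply (\<sigma> (lmul m (u i))) h" for i h
  have TK: "norm (T i h) \<le> K * norm h" for i h
  proof -
    have "norm (\<sigma> (lmul m (u i))) \<le> norm (lmul m (u i))"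
      by (rule star_hom_contractive[OF hom])
    also have "\<dots> \<le> K * norm (u i)"
      by (rule K)
    also have "\<dots> \<le> K * 1"
      by (intro mult_left_mono u1 K)
    finally show ?thesis
      unfolding T_def by (intro order_trans[OF norm_bop_apply mult_right_mono]) simp_all
  qed
  have Tlin: "T i (x + y) = T i x + T i y" "T i (c *\<^sub>C x) = c *\<^sub>C T i x" "T i (x - y) = T i x - T i y"
    for i x y c
    by (simp_all add: T_def bop_apply_add_right bop_apply_scaleC bop_apply_diff_right)
  have cl: "closed {h. \<exists>l. ((\<lambda>i. T i h) \<longlongrightarrow> l) F}"
    by (rule equibounded_convergent_closed[OF Tlin(3) TK F])
  have T\<sigma>: "((\<lambda>i. T i (bop_apply (\<sigma> b) h)) \<longlongrightarrow> bop_apply (\<sigma> (lmul m b)) h) F" for b h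
  proof -
    have "((\<lambda>i. bop_apply (\<sigma> (lmul m (u i * b))) h) \<longlongrightarrow> bop_apply (\<sigma> (lmul m b)) h) F"
      by (intro tendsto_bop_apply_left tendsto_star_hom[OF hom] tendsto_lmul ua)
    then show ?thesis
      by (simp add: T_def star_hom_simps[OF hom] bop_apply_times lmul_mult)
  qed
  have "h \<in> {h. \<exists>l. ((\<lambda>i. T i h) \<longlongrightarrow> l) F}" for h
    by (rule nondegenerate_rep_induct[OF \<sigma> cl])
       (auto intro: T\<sigma> tendsto_add bounded_linear.tendsto[OF bounded_linear_scaleC_hilbert] simp: Tlin)
  then obtain g where g: "\<And>h. ((\<lambda>i. T i h) \<longlongrightarrow> g h) F"
    by auto metis
  have "g (x + y) = g x + g y" for x y
    using tendsto_unique[OF F g[of "x + y"]] tendsto_add[OF g[of x] g[of y]] by (simp add: Tlin)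
  moreover have gC: "g (c *\<^sub>C x) = c *\<^sub>C g x" for x c
    using tendsto_unique[OF F g[of "c *\<^sub>C x"]]
      bounded_linear.tendsto[OF bounded_linear_scaleC_hilbert g[of x]] by (simp add: Tlin)
  moreover have "norm (g x) \<le> K * norm x" for x
    by (rule tendsto_upperbound[OF tendsto_norm[OF g] _ F]) (simp add: TK)
  ultimately have "bounded_linear g"
    by (intro bounded_linear_intro[where K = K]) (simp_all add: scaleR_scaleC mult.commute)
  then obtain S where S: "bop_apply S = g"
    using bop_exI[OF _ gC] by blast
  have "S * \<sigma> b = \<sigma> (lmul m b)" for b
    by (rule bop_eqI) (simp add: bop_apply_times S tendsto_unique[OF F g T\<sigma>])
  then show ?thesis by blast
qed

text \<open>\<open>mult_ext\<close> is a definite description, so the extension must exist and be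
  unique. Any extension k satisfies k(m) \<sigma>(b) = \<sigma>(m b), which determines k(m) on a
  dense subspace.\<close>

lemma
  fixes \<sigma> :: "'b::cstar_algebra \<Rightarrow> 'h::complex_hilbert_space bop" and u :: "'i \<Rightarrow> 'b"
  assumes \<sigma>: "nondegenerate_rep \<sigma>" and u: "approximate_identity F u"
  shows star_hom_mult_ext: "star_hom (mult_ext \<sigma>)"
    and mult_ext_embed: "mult_ext \<sigma> (mult_embed b) = \<sigma> b"
proof -
  have hom: "star_hom \<sigma>"
    using \<sigma> by (simp add: nondegenerate_rep_def)
  obtain g where g: "\<And>m b. g m * \<sigma> b = \<sigma> (lmul m b)"
    using multiplier_operator_exists[OF \<sigma> u] by metis
  note eqI = nondegenerate_rep_eqI[OF \<sigma>]
  \<comment> \<open>Only products g(m) \<sigma>(b) are known. Those with the adjoint of g(m) come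
    within reach after taking adjoints and testing against a second element \<sigma>(c).\<close>
  have gs: "g (m\<^sup>\<star>) = (g m)\<^sup>\<star>" for m
  proof (rule eqI)
    fix b
    have "(g m)\<^sup>\<star> * \<sigma> b = g (m\<^sup>\<star>) * \<sigma> b"
    proof -
      have "((g m)\<^sup>\<star> * \<sigma> b)\<^sup>\<star> = (g (m\<^sup>\<star>) * \<sigma> b)\<^sup>\<star>"
      proof (rule eqI)
        fix c
        have "((g m)\<^sup>\<star> * \<sigma> b)\<^sup>\<star> * \<sigma> c = \<sigma> (b\<^sup>\<star> * lmul m c)"
          by (simp add: star_mult star_star g mult.assoc star_hom_simps[OF hom])
        also have "b\<^sup>\<star> * lmul m c = (lmul (m\<^sup>\<star>) b)\<^sup>\<star> * c"
          by (simp add: lmul_star star_star lmul_rmul)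
        finally show "((g m)\<^sup>\<star> * \<sigma> b)\<^sup>\<star> * \<sigma> c = (g (m\<^sup>\<star>) * \<sigma> b)\<^sup>\<star> * \<sigma> c"
          by (simp add: g star_hom_simps[OF hom])
      qed
      then show ?thesis by (metis star_star)
    qed
    then show "g (m\<^sup>\<star>) * \<sigma> b = (g m)\<^sup>\<star> * \<sigma> b" by simp
  qed
  have "g (m + n) = g m + g n" "g (c *\<^sub>C m) = c *\<^sub>C g m" "g (m * n) = g m * g n" for m n c
    by (rule eqI; simp add: g distrib_right mult_scaleC_left mult.assoc lmul_plus lmul_scaleC_mult
        lmul_times star_hom_simps[OF hom])+
  then have "star_hom g"
    by (simp add: star_hom_def gs)
  moreover have "g (mult_embed b) = \<sigma> b" for b
    by (rule eqI) (simp add: g lmul_mult_embed star_hom_simps[OF hom])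
  moreover have "k = g" if k: "star_hom k" "\<And>b. k (mult_embed b) = \<sigma> b" for k
  proof
    fix m
    show "k m = g m"
    proof (rule eqI)
      fix b
      have "k m * \<sigma> b = k (m * mult_embed b)"
        by (simp add: star_hom_simps[OF k(1)] k(2))
      also have "\<dots> = \<sigma> (lmul m b)"
        by (simp add: k(2) flip: mult_embed_lmul)
      finally show "k m * \<sigma> b = g m * \<sigma> b"
        by (simp add: g)
    qed
  qed
  ultimately have "mult_ext \<sigma> = g"
    unfolding mult_ext_def by - (rule the_equality; blast)
  with \<open>star_hom g\<close> \<open>\<And>b. g (mult_embed b) = \<sigma> b\<close> show "star_hom (mult_ext \<sigma>)" "mult_ext \<sigma> (mult_embed b) = \<sigma> b"
    by simp_all
qed


lemma bounded_linear_rmul: "bounded_linear (\<lambda>a. rmul a (m :: 'a::cstar_algebra multiplier))"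
proof -
  have "rmul a m = (lmul (m\<^sup>\<star>) (a\<^sup>\<star>))\<^sup>\<star>" for a
    by (simp add: lmul_star star_star)
  then show ?thesis
    by (simp add: bounded_linear_compose[OF bounded_linear_star]
        bounded_linear_compose[OF bounded_linear_lmul bounded_linear_star])
qed

lemmas tendsto_rmul = bounded_linear.tendsto[OF bounded_linear_rmul]

text \<open>An approximate identity is not assumed to be self-adjoint, so statements for one side
  are moved to the other through the adjoint net.\<close>

lemma approximate_identity_star:
  assumes "approximate_identity F u"
  shows "approximate_identity F (\<lambda>i. (u i)\<^sup>\<star>)"
proof -
  have "((\<lambda>i. (a\<^sup>\<star> * u i)\<^sup>\<star>) \<longlongrightarrow> a\<^sup>\<star>\<^sup>\<star>) F" "((\<lambda>i. (u i * a\<^sup>\<star>)\<^sup>\<star>) \<longlongrightarrow> a\<^sup>\<star>\<^sup>\<star>) F" for a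
    using assms by (auto simp: approximate_identity_def intro!: tendsto_star)
  with assms show ?thesis
    by (simp add: approximate_identity_def cstar_norm_star star_mult star_star)
qed

lemma approximate_identityD:
  assumes "approximate_identity F u"
  shows "F \<noteq> bot" "norm (u i) \<le> 1" "((\<lambda>i. u i * a) \<longlongrightarrow> a) F" "((\<lambda>i. a * u i) \<longlongrightarrow> a) F"
  using assms by (auto simp: approximate_identity_def)


section \<open>Compact operators on the Hilbert module \<open>pA\<close>\<close>

text \<open>\<open>K(pA)\<close> is the corner \<open>pAp\<close>, acting by left multiplication.\<close>

definition projection_module :: "'a::cstar_algebra multiplier \<Rightarrow> ('a \<Rightarrow> 'a \<Rightarrow> 'a) \<Rightarrow> ('a, 'a) hilbert_bimodule" where
  "projection_module p l =
     \<lparr>hcarrier = range (lmul p), hinner = (\<lambda>x y. x\<^sup>\<star> * y), hright = (\<lambda>x a. x * a), hleft = l\<rparr>"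

definition corner :: "'a::cstar_algebra multiplier \<Rightarrow> 'a set" where
  "corner p = {a. lmul p a = a \<and> rmul a p = a}"

text \<open>The value 0 off pA is the convention of \<open>operators_on\<close>, under which the
  compact operators are equal to these maps as functions.\<close>

definition corner_op :: "'a::cstar_algebra multiplier \<Rightarrow> 'a \<Rightarrow> 'a \<Rightarrow> 'a" where
  "corner_op p a z = (if lmul p z = z then a * z else 0)"

locale cstar_projection =
  fixes p :: "'a::cstar_algebra multiplier"
  assumes proj: "p * p = p" "p\<^sup>\<star> = p"
begin

lemma lmul_idem: "lmul p (lmul p a) = lmul p a"
  by (simp add: proj flip: lmul_times)

lemma star_lmul: "(lmul p a)\<^sup>\<star> = rmul (a\<^sup>\<star>) p"
  and star_rmul: "(rmul a p)\<^sup>\<star> = lmul p (a\<^sup>\<star>)"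
  using lmul_star[of p "a\<^sup>\<star>"] lmul_star[of p a] by (simp_all add: proj star_star)

lemma range_lmul_iff: "x \<in> range (lmul p) \<longleftrightarrow> lmul p x = x"
  by (metis lmul_idem rangeE rangeI)

lemma corner_mult_fixed: "a \<in> corner p \<Longrightarrow> a * lmul p z = a * z"
  by (simp add: corner_def lmul_rmul)

lemma corner_star: "a \<in> corner p \<Longrightarrow> a\<^sup>\<star> \<in> corner p"
  by (metis (mono_tags, lifting) corner_def mem_Collect_eq star_lmul star_rmul)

lemma corner_mult_star: "lmul p x = x \<Longrightarrow> lmul p y = y \<Longrightarrow> x * y\<^sup>\<star> \<in> corner p"
  unfolding corner_def mem_Collect_eq
  by (metis lmul_mult rmul_mult star_lmul)

lemma cstar_subalgebra_corner: "cstar_subalgebra (corner p)"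
proof -
  have "closed (corner p)"
    unfolding corner_def
    by (intro closed_Collect_conj closed_Collect_eq linear_continuous_on bounded_linear_lmul
        bounded_linear_rmul continuous_on_id)
  then show ?thesis
    using corner_star unfolding cstar_subalgebra_def corner_def
    by (auto simp: lmul_add rmul_add lmul_scaleC rmul_scaleC lmul_mult rmul_mult lmul_zero_right
        linear_0[OF bounded_linear.linear[OF bounded_linear_rmul]])
qed

lemma cornerI:
  assumes "a \<in> corner p" "b \<in> corner p"
  shows "a + b \<in> corner p" "a * b \<in> corner p" "c *\<^sub>C a \<in> corner p" "a - b \<in> corner p"
proof -
  show "a + b \<in> corner p" "a * b \<in> corner p" "c *\<^sub>C a \<in> corner p"
    using assms cstar_subalgebra_corner by (simp_all add: cstar_subalgebra_def)
  show "a - b \<in> corner p"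
    using assms by (simp add: corner_def lmul_diff rmul_diff)
qed

text \<open>Every a in the corner satisfies a c = a (p c), so its action on pA determines its action
  on the whole algebra.\<close>

lemma corner_op_inject:
  assumes "a \<in> corner p" "b \<in> corner p" "corner_op p a = corner_op p b"
  shows "a = b"
proof (rule cstar_eqI_right)
  fix c
  have "a * lmul p c = b * lmul p c"
    using fun_cong[OF assms(3), of "lmul p c"] by (simp add: corner_op_def lmul_idem)
  then show "a * c = b * c"
    using assms by (simp add: corner_mult_fixed)
qed

lemma corner_op_algebra:
  assumes "a \<in> corner p" "b \<in> corner p"
  shows "(\<lambda>z. corner_op p a z + corner_op p b z) = corner_op p (a + b)"
    and "(\<lambda>z. c *\<^sub>C corner_op p a z) = corner_op p (c *\<^sub>C a)"
    and "corner_op p a \<circ> corner_op p b = corner_op p (a * b)"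
  using assms
  by (auto simp: corner_op_def fun_eq_iff distrib_right scaleC_zero_right mult_scaleC_left lmul_mult
      corner_def mult.assoc lmul_zero_right)

lemma projection_module_simps:
  "hcarrier (projection_module p l) = {x. lmul p x = x}"
  "hinner (projection_module p l) x y = x\<^sup>\<star> * y"
  "hright (projection_module p l) x a = x * a"
  "hnorm (projection_module p l) x = norm x"
  using range_lmul_iff by (auto simp: projection_module_def hnorm_def cstar_identity)

lemma rank_one_projection_module:
  "rank_one (projection_module p l) x y = corner_op p (x * y\<^sup>\<star>)"
  by (auto simp: rank_one_def corner_op_def projection_module_simps mult.assoc)

lemma corner_op_adjoint_pair:
  "adjoint_pair (projection_module p l) (corner_op p a) (corner_op p (a\<^sup>\<star>))"
  by (simp add: adjoint_pair_def corner_op_def projection_module_simps star_mult mult.assoc)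

lemma corner_op_adjointable:
  assumes "a \<in> corner p"
  shows "corner_op p a \<in> adjointables (projection_module p l)"
proof -
  have "corner_op p b \<in> operators_on (projection_module p l)" if "b \<in> corner p" for b
    using that by (auto simp: operators_on_def corner_op_def projection_module_simps corner_def lmul_mult)
  then show ?thesis
    using assms corner_star corner_op_adjoint_pair unfolding adjointables_def by blast
qed

text \<open>A single rank one operator approximates: the one given by a and p u_i acts on pA as left
  multiplication by a u_i^*, and this converges to a in norm.\<close>

lemma corner_op_compact:
  fixes u :: "'i \<Rightarrow> 'a"
  assumes u: "approximate_identity F u" and a: "a \<in> corner p"
  shows "corner_op p a \<in> compacts (projection_module p l)"
proof -
  have "\<exists>(n::nat) x y. (\<forall>k<n. x k \<in> {x. lmul p x = x} \<and> y k \<in> {x. lmul p x = x}) \<and>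
     (\<forall>z\<in>{x. lmul p x = x}. norm (corner_op p a z - (\<Sum>k<n. corner_op p (x k * (y k)\<^sup>\<star>) z)) \<le> e * norm z)"
    if e: "0 < e" for e
  proof -
    have "((\<lambda>i. a * (u i)\<^sup>\<star>) \<longlongrightarrow> a) F"
      by (rule approximate_identityD(4)[OF approximate_identity_star[OF u]])
    then have "\<forall>\<^sub>F i in F. dist (a * (u i)\<^sup>\<star>) a < e"
      using e by (rule tendstoD)
    then obtain i where i: "dist (a * (u i)\<^sup>\<star>) a < e"
      using eventually_happens' approximate_identityD(1)[OF u] by blast
    have "norm (corner_op p a z - corner_op p (a * (lmul p (u i))\<^sup>\<star>) z) \<le> e * norm z" if "lmul p z = z" for z
    proof -
      have "(lmul p (u i))\<^sup>\<star> * z = (u i)\<^sup>\<star> * z"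
        by (metis lmul_rmul star_lmul that)
      then have "corner_op p a z - corner_op p (a * (lmul p (u i))\<^sup>\<star>) z = (a - a * (u i)\<^sup>\<star>) * z"
        using that by (simp add: corner_op_def mult.assoc left_diff_distrib)
      also have "norm \<dots> \<le> norm (a - a * (u i)\<^sup>\<star>) * norm z"
        by (rule norm_mult_ineq)
      also have "\<dots> \<le> e * norm z"
        using i by (intro mult_right_mono) (simp_all add: dist_norm norm_minus_commute)
      finally show ?thesis .
    qed
    then show ?thesis
      using a lmul_idem
      by (intro exI[of _ "Suc 0"] exI[of _ "\<lambda>_. a"] exI[of _ "\<lambda>_. lmul p (u i)"]) (simp add: corner_def)
  qed
  then show ?thesis
    unfolding compacts_def projection_module_simps rank_one_projection_module
    using corner_op_adjointable[OF a] by blast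
qed

text \<open>The finite rank approximants of T are left multiplications by corner elements. An
  operator estimate on pA controls the norm of a corner element, so these elements form a Cauchy
  sequence, and T is multiplication by their limit.\<close>

lemma compacts_projection_moduleE:
  assumes T: "T \<in> compacts (projection_module p l)"
  obtains a where "a \<in> corner p" "T = corner_op p a"
proof -
  have "\<exists>a\<in>corner p. \<forall>z. lmul p z = z \<longrightarrow> norm (T z - a * z) \<le> (1 / real (Suc k)) * norm z" for k
  proof -
    obtain n :: nat and x y where xy: "\<And>j. j < n \<Longrightarrow> lmul p (x j) = x j \<and> lmul p (y j) = y j"
      and le: "\<And>z. lmul p z = z \<Longrightarrow>
        norm (T z - (\<Sum>j<n. corner_op p (x j * (y j)\<^sup>\<star>) z)) \<le> (1 / real (Suc k)) * norm z"
      using T unfolding compacts_def projection_module_simps rank_one_projection_module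
      by (auto dest!: spec[of _ "1 / real (Suc k)"]) blast
    have "(\<Sum>j<m. x j * (y j)\<^sup>\<star>) \<in> corner p" if "m \<le> n" for m
      using that
    proof (induction m)
      case 0
      then show ?case
        using cstar_subalgebra_corner by (simp add: cstar_subalgebra_def)
    qed (simp add: xy cornerI corner_mult_star)
    moreover have "(\<Sum>j<n. corner_op p (x j * (y j)\<^sup>\<star>) z) = (\<Sum>j<n. x j * (y j)\<^sup>\<star>) * z" if "lmul p z = z" for z
      using that by (simp add: corner_op_def sum_distrib_right)
    ultimately show ?thesis
      using le by (intro bexI[of _ "\<Sum>j<n. x j * (y j)\<^sup>\<star>"]) auto
  qed
  then obtain a where a: "\<And>k. a k \<in> corner p"
    and le: "\<And>k z. lmul p z = z \<Longrightarrow> norm (T z - a k * z) \<le> (1 / real (Suc k)) * norm z"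
    by metis
  have lim0: "(\<lambda>k. 1 / real (Suc k)) \<longlonglongrightarrow> 0"
    by (rule LIMSEQ_Suc[OF lim_1_over_n])
  have diff: "norm (a k - a j) \<le> 1 / real (Suc k) + 1 / real (Suc j)" for k j
  proof -
    \<comment> \<open>The adjoint of d lies in pA because d is in the corner, so it may be inserted
      into both operator estimates; the C*-identity then bounds d itself.\<close>
    define d where "d = a k - a j"
    have dfix: "lmul p (d\<^sup>\<star>) = d\<^sup>\<star>"
      using corner_star[OF cornerI(4)[OF a a]] by (simp add: d_def corner_def)
    have "norm d * norm d = norm (d * d\<^sup>\<star>)"
      using cstar_identity[of "d\<^sup>\<star>"] by (simp add: cstar_norm_star star_star power2_eq_square)
    also have "d * d\<^sup>\<star> = (T (d\<^sup>\<star>) - a j * d\<^sup>\<star>) - (T (d\<^sup>\<star>) - a k * d\<^sup>\<star>)"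
      by (simp add: d_def algebra_simps)
    also have "norm \<dots> \<le> (1 / real (Suc j)) * norm (d\<^sup>\<star>) + (1 / real (Suc k)) * norm (d\<^sup>\<star>)"
      by (rule order_trans[OF norm_triangle_ineq4 add_mono[OF le[OF dfix] le[OF dfix]]])
    also have "\<dots> = (1 / real (Suc k) + 1 / real (Suc j)) * norm d"
      by (simp only: cstar_norm_star distrib_right add.commute)
    finally have "norm d * norm d \<le> (1 / real (Suc k) + 1 / real (Suc j)) * norm d" .
    then have "norm d \<le> 1 / real (Suc k) + 1 / real (Suc j)"
      by (cases "norm d = 0") (simp_all only: mult_le_cancel_right, auto)
    then show ?thesis by (simp add: d_def)
  qed
  have "Cauchy a"
  proof (rule CauchyI)
    fix e :: real assume e: "0 < e"
    then obtain N where N: "\<And>n. n \<ge> N \<Longrightarrow> 1 / real (Suc n) < e / 2"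
      using tendstoD[OF lim0, of "e / 2"] by (auto simp: eventually_sequentially dist_norm)
    have "norm (a m - a n) < e" if "N \<le> m" "N \<le> n" for m n
      using N[OF that(1)] N[OF that(2)] diff[of m n] by linarith
    then show "\<exists>M. \<forall>m\<ge>M. \<forall>n\<ge>M. norm (a m - a n) < e"
      by blast
  qed
  then obtain b where b: "a \<longlonglongrightarrow> b"
    by (auto simp: Cauchy_convergent_iff convergent_def)
  have "closed (corner p)"
    using cstar_subalgebra_corner by (simp add: cstar_subalgebra_def)
  then have "b \<in> corner p"
    using a b closed_sequentially by blast
  moreover have "T z = b * z" if z: "lmul p z = z" for z
  proof -
    have "(\<lambda>k. T z - a k * z) \<longlonglongrightarrow> 0"
      by (rule Lim_null_comparison[OF always_eventually[OF allI] tendsto_mult_left_zero[OF lim0]])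
         (rule le[OF z])
    moreover have "(\<lambda>k. T z - a k * z) \<longlonglongrightarrow> T z - b * z"
      by (intro tendsto_intros b)
    ultimately show ?thesis
      using LIMSEQ_unique by fastforce
  qed
  moreover have "T z = 0" if "lmul p z \<noteq> z" for z
    using T that by (simp add: compacts_def adjointables_def operators_on_def projection_module_simps)
  ultimately have "T = corner_op p b"
    by (auto simp: corner_op_def)
  with \<open>b \<in> corner p\<close> show ?thesis
    by (rule that)
qed

text \<open>For z in pA, b^* z - a z lies in pA and is orthogonal to all of pA, hence to
  itself.\<close>

lemma corner_op_adjoint_unique:
  assumes "a \<in> corner p" "b \<in> corner p"
    and "adjoint_pair (projection_module p l) (corner_op p a) (corner_op p b)"
  shows "b = a\<^sup>\<star>"
proof -
  have "b\<^sup>\<star> = a"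
  proof (rule corner_op_inject[OF corner_star[OF assms(2)] assms(1)], rule ext)
    fix z
    have "y\<^sup>\<star> * (b\<^sup>\<star> * z) = y\<^sup>\<star> * (a * z)" if "lmul p z = z" "lmul p y = y" for y
    proof -
      have "(a * z)\<^sup>\<star> * y = z\<^sup>\<star> * (b * y)"
        using assms(3) that by (simp add: adjoint_pair_def projection_module_simps corner_op_def)
      then have "((a * z)\<^sup>\<star> * y)\<^sup>\<star> = (z\<^sup>\<star> * (b * y))\<^sup>\<star>"
        by simp
      then show ?thesis
        by (simp add: star_mult star_star mult.assoc)
    qed
    moreover have "lmul p (b\<^sup>\<star> * z - a * z) = b\<^sup>\<star> * z - a * z"
      using assms(1) corner_star[OF assms(2)] by (simp add: lmul_diff lmul_mult corner_def)
    ultimately have "(b\<^sup>\<star> * z - a * z)\<^sup>\<star> * (b\<^sup>\<star> * z - a * z) = 0" if "lmul p z = z"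
      using that by (simp add: right_diff_distrib)
    then show "corner_op p (b\<^sup>\<star>) z = corner_op p a z"
      by (simp add: corner_op_def star_mult_self_eq_0)
  qed
  then show ?thesis by (metis star_star)
qed

text \<open>The choice in \<^const>\<open>compact_ext\<close> is determined, since the finite sums of the \<open>x y\<^sup>\<star>\<close> are dense in the
  corner and homomorphisms on it are contractive.\<close>

lemma compact_ext_corner_op:
  fixes u :: "'i \<Rightarrow> 'a" and \<kappa> :: "'a \<Rightarrow> 'b::cstar_algebra"
  assumes u: "approximate_identity F u" and X: "fibre X s = projection_module p l"
    and add: "\<And>a b. a \<in> corner p \<Longrightarrow> b \<in> corner p \<Longrightarrow> \<kappa> (a + b) = \<kappa> a + \<kappa> b"
    and scale: "\<And>c a. a \<in> corner p \<Longrightarrow> \<kappa> (c *\<^sub>C a) = c *\<^sub>C \<kappa> a"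
    and mult: "\<And>a b. a \<in> corner p \<Longrightarrow> b \<in> corner p \<Longrightarrow> \<kappa> (a * b) = \<kappa> a * \<kappa> b"
    and star: "\<And>a. a \<in> corner p \<Longrightarrow> \<kappa> (a\<^sup>\<star>) = (\<kappa> a)\<^sup>\<star>"
    and \<kappa>: "\<And>x y. lmul p x = x \<Longrightarrow> lmul p y = y \<Longrightarrow> \<kappa> (x * y\<^sup>\<star>) = \<psi> (s, x) * (\<psi> (s, y))\<^sup>\<star>"
    and a: "a \<in> corner p"
  shows "compact_ext X \<psi> s (corner_op p a) = \<kappa> a"
proof -
  let ?M = "projection_module p l"
  define P where "P f \<longleftrightarrow> compact_hom ?M f \<and> (\<forall>x\<in>hcarrier ?M. \<forall>y\<in>hcarrier ?M.
    f (rank_one ?M x y) = \<psi> (s, x) * (\<psi> (s, y))\<^sup>\<star>)" for f :: "('a \<Rightarrow> 'a) \<Rightarrow> 'b"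
  define f where "f = compact_ext X \<psi> s"
  \<comment> \<open>\<kappa> transported along \<open>corner_op\<close> witnesses that the choice in
    \<open>compact_ext\<close> has a solution.\<close>
  define f0 where "f0 T = \<kappa> (THE a. a \<in> corner p \<and> T = corner_op p a)" for T
  have f0: "f0 (corner_op p a) = \<kappa> a" if "a \<in> corner p" for a
    using that corner_op_inject unfolding f0_def by (intro arg_cong[of _ _ \<kappa>] the_equality) auto
  have "compact_hom ?M f0"
    unfolding compact_hom_def
  proof (intro conjI ballI allI impI)
    fix S T c assume "S \<in> compacts ?M" "T \<in> compacts ?M"
    then obtain a b where ab: "a \<in> corner p" "b \<in> corner p" "S = corner_op p a" "T = corner_op p b"
      by (metis compacts_projection_moduleE)
    show "f0 (\<lambda>z. S z + T z) = f0 S + f0 T" "f0 (S \<circ> T) = f0 S * f0 T"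
      using ab by (simp_all add: corner_op_algebra f0 cornerI add mult)
    show "f0 T = (f0 S)\<^sup>\<star>" if "adjoint_pair ?M S T"
      using ab that corner_op_adjoint_unique[of a b l] by (simp add: f0 star)
  next
    fix c S assume "S \<in> compacts ?M"
    then obtain a where "a \<in> corner p" "S = corner_op p a"
      by (metis compacts_projection_moduleE)
    then show "f0 (\<lambda>z. c *\<^sub>C S z) = c *\<^sub>C f0 S"
      by (simp add: corner_op_algebra f0 cornerI scale)
  qed
  then have "P f0"
    by (simp add: P_def projection_module_simps rank_one_projection_module corner_mult_star f0 \<kappa>)
  then have "P (SOME f. P f)"
    by (rule someI[of P f0])
  then have P: "P f"
    by (simp add: f_def compact_ext_def X P_def[abs_def])
  define g where "g a = f (corner_op p a)" for a
  have c: "corner_op p a \<in> compacts ?M" if "a \<in> corner p" for a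
    by (rule corner_op_compact[OF u that])
  have g_bound: "norm (g b - g c) \<le> norm (b - c)" if "b \<in> corner p" "c \<in> corner p" for b c
  proof -
    have hom: "g (a + b) = g a + g b" "g (c *\<^sub>C a) = c *\<^sub>C g a" "g (a * b) = g a * g b" "g (a\<^sup>\<star>) = (g a)\<^sup>\<star>"
      if ab: "a \<in> corner p" "b \<in> corner p" for a b c
      using P c[OF ab(1)] c[OF ab(2)] c[OF corner_star[OF ab(1)]] corner_op_adjoint_pair[of l a]
      unfolding P_def compact_hom_def g_def corner_op_algebra[OF ab, symmetric] by blast+
    have "g ((b - c) + c) = g (b - c) + g c"
      using that by (intro hom cornerI)
    then have "norm (g b - g c) = norm (g (b - c))"
      by simp
    also have "\<dots> \<le> norm (b - c)"
      using that by (intro cstar_subalgebra_hom_contractive[OF cstar_subalgebra_corner] cornerI hom)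
    finally show ?thesis .
  qed
  have \<kappa>_bound: "norm (\<kappa> b - \<kappa> c) \<le> norm (b - c)" if "b \<in> corner p" "c \<in> corner p" for b c
  proof -
    have "\<kappa> ((b - c) + c) = \<kappa> (b - c) + \<kappa> c"
      using that by (intro add cornerI)
    then have "norm (\<kappa> b - \<kappa> c) = norm (\<kappa> (b - c))"
      by simp
    also have "\<dots> \<le> norm (b - c)"
      using that by (intro cstar_subalgebra_hom_contractive[OF cstar_subalgebra_corner] cornerI add scale mult star)
    finally show ?thesis .
  qed
  \<comment> \<open>Each b i is x y^* with x = a and y = p u_i in pA, where both maps have the
    prescribed value. As b i -> a and both are contractive on the corner, they agree at a.\<close>
  define b where "b i = a * (lmul p (u i))\<^sup>\<star>" for i
  have a_fix: "lmul p a = a" "rmul a p = a"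
    using a by (simp_all add: corner_def)
  have b: "b i \<in> corner p" for i
    unfolding b_def by (intro corner_mult_star) (simp_all add: a_fix lmul_idem)
  have "g (b i) = \<kappa> (b i)" for i
    using P by (simp add: P_def g_def b_def projection_module_simps rank_one_projection_module
        a_fix lmul_idem \<kappa>)
  have "((\<lambda>i. rmul (a * (u i)\<^sup>\<star>) p) \<longlongrightarrow> rmul a p) F"
    by (intro tendsto_rmul approximate_identityD(4)[OF approximate_identity_star[OF u]])
  then have lim: "(b \<longlongrightarrow> a) F"
    by (simp add: b_def[abs_def] star_lmul rmul_mult a_fix)
  then have lim0: "((\<lambda>i. norm (b i - a)) \<longlongrightarrow> 0) F"
    by (simp add: tendsto_norm_zero_iff LIM_zero_iff)
  have "((\<lambda>i. g (b i) - g a) \<longlongrightarrow> 0) F" "((\<lambda>i. \<kappa> (b i) - \<kappa> a) \<longlongrightarrow> 0) F"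
    by (rule Lim_null_comparison[OF _ lim0]; simp add: g_bound \<kappa>_bound a b)+
  then have "((\<lambda>i. g (b i)) \<longlongrightarrow> g a) F" "((\<lambda>i. \<kappa> (b i)) \<longlongrightarrow> \<kappa> a) F"
    by (simp_all add: LIM_zero_iff)
  then have "g a = \<kappa> a"
    using \<open>\<And>i. g (b i) = \<kappa> (b i)\<close> tendsto_unique[OF approximate_identityD(1)[OF u]] by simp
  then show ?thesis
    by (simp add: g_def f_def)
qed

end


section \<open>The product system of a twisted semigroup dynamical system\<close>

locale twisted_semigroup_system =
  fixes G :: "('g, 'm) monoid_scheme" (structure) and P :: "'g set"
    and \<beta> :: "'g \<Rightarrow> 'a::cstar_algebra \<Rightarrow> 'a" and \<omega> :: "'g \<Rightarrow> 'g \<Rightarrow> complex"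
    and F :: "'i filter" and u :: "'i \<Rightarrow> 'a"
  assumes group: "group G" and submonoid: "submonoid P G"
    and qlo: "opp_quasi_lattice_ordered G P"
    and tw: "twisted_system G P \<beta> \<omega>"
    and ai: "approximate_identity F u"
begin

sublocale group G by (rule group)

abbreviation X where "X \<equiv> twisted_product_system G \<beta> \<omega>"
abbreviation p where "p s \<equiv> strict_ext (\<beta> s) 1"

lemma P_carrier: "s \<in> P \<Longrightarrow> s \<in> carrier G"
  and P_one: "\<one> \<in> P"
  and P_mult: "s \<in> P \<Longrightarrow> t \<in> P \<Longrightarrow> s \<otimes> t \<in> P"
  using submonoid by (auto simp: submonoid_def)

lemma \<beta>_star_hom: "s \<in> P \<Longrightarrow> star_hom (\<beta> s)"
  and \<beta>_mult: "s \<in> P \<Longrightarrow> t \<in> P \<Longrightarrow> \<beta> (s \<otimes> t) a = \<beta> s (\<beta> t a)"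
  and \<beta>_one: "\<beta> \<one> = id"
  using tw by (auto simp: twisted_system_def)

lemmas \<beta>_simps = star_hom_simps[OF \<beta>_star_hom]

lemma \<omega>_cnj:
  assumes "s \<in> P" "t \<in> P"
  shows "\<omega> s t * cnj (\<omega> s t) = 1" "cnj (\<omega> s t) * \<omega> s t = 1" "\<omega> s t \<noteq> 0"
proof -
  have "cmod (\<omega> s t) = 1"
    using tw assms by (auto simp: twisted_system_def)
  then show "\<omega> s t * cnj (\<omega> s t) = 1" "cnj (\<omega> s t) * \<omega> s t = 1" "\<omega> s t \<noteq> 0"
    by (auto simp: complex_norm_square[symmetric] mult.commute)
qed

lemma \<omega>_one: "\<omega> \<one> \<one> = 1"
  using tw by (auto simp: twisted_system_def)

lemma \<omega>_one_left:
  assumes s: "s \<in> P"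
  shows "\<omega> \<one> s = 1"
proof -
  have "\<omega> \<one> \<one> * \<omega> (\<one> \<otimes> \<one>) s = \<omega> \<one> (\<one> \<otimes> s) * \<omega> \<one> s"
    using tw s P_one unfolding twisted_system_def by blast
  then show ?thesis
    using \<omega>_cnj(3)[OF P_one s] by (simp add: \<omega>_one P_carrier s)
qed

lemma \<omega>_one_right:
  assumes s: "s \<in> P"
  shows "\<omega> s \<one> = 1"
proof -
  have "\<omega> s \<one> * \<omega> (s \<otimes> \<one>) \<one> = \<omega> s (\<one> \<otimes> \<one>) * \<omega> \<one> \<one>"
    using tw s P_one unfolding twisted_system_def by blast
  then show ?thesis
    using \<omega>_cnj(3)[OF s P_one] by (simp add: \<omega>_one P_carrier s)
qed

lemma strict_ext:
  assumes s: "s \<in> P"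
  shows "is_strict_ext (\<beta> s) (strict_ext (\<beta> s))"
proof -
  obtain g where "is_strict_ext (\<beta> s) g"
    using tw s by (auto simp: twisted_system_def extendible_def)
  with strict_ext_eqI[OF this ai] show ?thesis by simp
qed

lemma strict_ext_hom:
  assumes "s \<in> P"
  shows "strict_ext (\<beta> s) (m * n) = strict_ext (\<beta> s) m * strict_ext (\<beta> s) n"
    "strict_ext (\<beta> s) (m\<^sup>\<star>) = (strict_ext (\<beta> s) m)\<^sup>\<star>"
    "strict_ext (\<beta> s) (mult_embed a) = mult_embed (\<beta> s a)"
  using strict_ext[OF assms] by (auto simp: is_strict_ext_def star_hom_def)

lemma projection_p: "s \<in> P \<Longrightarrow> cstar_projection (p s)"
  using strict_ext_hom(1)[of s 1 1] strict_ext_hom(2)[of s 1]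
  by unfold_locales (simp_all add: multiplier_one_star)

lemma p_one: "p \<one> = 1"
proof -
  have "is_strict_ext (\<beta> \<one>) id"
    unfolding \<beta>_one by (auto simp: is_strict_ext_def star_hom_def)
  then show ?thesis
    by (simp add: strict_ext_eqI[OF _ ai])
qed

lemma p_mult:
  assumes s: "s \<in> P" and t: "t \<in> P"
  shows "p (t \<otimes> s) = strict_ext (\<beta> t) (p s)"
proof -
  have eq: "\<beta> (t \<otimes> s) = \<beta> t \<circ> \<beta> s"
    using \<beta>_mult[OF t s] by auto
  have "is_strict_ext (\<beta> (t \<otimes> s)) (strict_ext (\<beta> t) \<circ> strict_ext (\<beta> s))"
    using strict_ext[OF s] strict_ext[OF t] unfolding eq
    by (auto simp: is_strict_ext_def star_hom_def intro: continuous_map_compose)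
  then show ?thesis
    by (simp add: strict_ext_eqI[OF _ ai])
qed

text \<open>p_ts is the image of p_s under the extension of \<beta>_t and therefore lies below p_t,
  the image of 1.\<close>

lemma p_mult_absorb:
  assumes s: "s \<in> P" and t: "t \<in> P"
  shows "lmul (p (t \<otimes> s)) (lmul (p t) a) = lmul (p (t \<otimes> s)) a"
  unfolding p_mult[OF s t] by (simp flip: lmul_times strict_ext_hom(1)[OF t])

lemma \<beta>_lmul: "t \<in> P \<Longrightarrow> \<beta> t (lmul m a) = lmul (strict_ext (\<beta> t) m) (\<beta> t a)"
  by (rule mult_embed_inject) (simp add: mult_embed_lmul strict_ext_hom flip: strict_ext_hom(3))

lemma \<beta>_lmul_p: "s \<in> P \<Longrightarrow> t \<in> P \<Longrightarrow> \<beta> t (lmul (p s) a) = lmul (p (t \<otimes> s)) (\<beta> t a)"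
  by (simp add: \<beta>_lmul p_mult)

lemma \<beta>_fixed: "s \<in> P \<Longrightarrow> t \<in> P \<Longrightarrow> lmul (p s) x = x \<Longrightarrow> lmul (p (t \<otimes> s)) (\<beta> t x) = \<beta> t x"
  using \<beta>_lmul_p[of s t x] by simp

lemma p_\<beta>: "t \<in> P \<Longrightarrow> lmul (p t) (\<beta> t a) = \<beta> t a"
  using \<beta>_fixed[of \<one> t a] by (simp add: p_one lmul_one P_carrier P_one)

lemma p_idem: "s \<in> P \<Longrightarrow> lmul (p s) (lmul (p s) a) = lmul (p s) a"
  by (rule cstar_projection.lmul_idem[OF projection_p])

lemma \<beta>_corner:
  assumes "s \<in> P" "t \<in> P" "a \<in> corner (p s)"
  shows "\<beta> t a \<in> corner (p (t \<otimes> s))"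
proof -
  interpret s: cstar_projection "p s" by (rule projection_p) fact
  interpret ts: cstar_projection "p (t \<otimes> s)" by (intro projection_p P_mult assms)
  have "lmul (p (t \<otimes> s)) (\<beta> t a) = \<beta> t a" "lmul (p (t \<otimes> s)) (\<beta> t (a\<^sup>\<star>)) = \<beta> t (a\<^sup>\<star>)"
    using assms s.corner_star[OF assms(3)] by (auto intro!: \<beta>_fixed simp: corner_def)
  moreover from this(2) have "rmul (\<beta> t a) (p (t \<otimes> s)) = \<beta> t a"
    by (metis assms(2) \<beta>_simps(4) star_star ts.star_rmul)
  ultimately show ?thesis by (simp add: corner_def)
qed

lemma \<beta>_u_tendsto:
  assumes "s \<in> P"
  shows "((\<lambda>i. \<beta> s (u i) * y) \<longlongrightarrow> lmul (p s) y) F" "((\<lambda>i. y * \<beta> s (u i)) \<longlongrightarrow> rmul y (p s)) F"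
  using is_strict_ext_tendsto[OF strict_ext[OF assms] ai] by auto

section \<open>Fibres, ampliations, joins and both covariance conditions in concrete form\<close>

lemma fibre_X: "fibre X s = projection_module (p s) (\<lambda>a x. \<beta> s a * x)"
  by (simp add: twisted_product_system_def projection_module_def)

lemma psmult_X: "psmult X (s, x) (t, y) = (t \<otimes> s, cnj (\<omega> t s) *\<^sub>C (\<beta> t x * y))"
  by (simp add: twisted_product_system_def)

lemma hcarrier_X: "s \<in> P \<Longrightarrow> hcarrier (fibre X s) = {x. lmul (p s) x = x}"
  by (simp add: fibre_X cstar_projection.projection_module_simps[OF projection_p])

lemma hinner_X: "hinner (fibre X s) x y = x\<^sup>\<star> * y"
  by (simp add: fibre_X projection_module_def)

lemma coeff_X: "coeff X a = a"
  by (simp add: twisted_product_system_def)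

lemma opp_simps:
  "carrier (opp_submonoid G P) = P" "s \<otimes>\<^bsub>opp_submonoid G P\<^esub> t = t \<otimes> s" "\<one>\<^bsub>opp_submonoid G P\<^esub> = \<one>"
  by (simp_all add: opp_submonoid_def)

lemma product_fixed:
  assumes "s \<in> P" "t \<in> P" "lmul (p s) x = x"
  shows "lmul (p (t \<otimes> s)) (cnj (\<omega> t s) *\<^sub>C (\<beta> t x * y)) = cnj (\<omega> t s) *\<^sub>C (\<beta> t x * y)"
  using assms by (simp add: lmul_scaleC lmul_mult \<beta>_fixed)

text \<open>The products with x = p_s u_i and y = p_r v form the net w, which converges to v. So v
  is a limit of vectors orthogonal to v.\<close>

lemma product_orthogonal:
  assumes s: "s \<in> P" and r: "r \<in> P" and v: "lmul (p (r \<otimes> s)) v = v"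
    and orth: "\<And>x y. lmul (p s) x = x \<Longrightarrow> lmul (p r) y = y \<Longrightarrow> (\<beta> r x * y)\<^sup>\<star> * v = 0"
  shows "v = 0"
proof -
  define w where "w i = \<beta> r (lmul (p s) (u i)) * lmul (p r) v" for i
  have "((\<lambda>i. lmul (p (r \<otimes> s)) (\<beta> r (u i) * lmul (p r) v)) \<longlongrightarrow> lmul (p (r \<otimes> s)) (lmul (p r) (lmul (p r) v))) F"
    by (intro tendsto_lmul \<beta>_u_tendsto r)
  then have "(w \<longlongrightarrow> v) F"
    using s r by (simp add: w_def[abs_def] \<beta>_lmul_p lmul_mult p_idem p_mult_absorb v)
  then have "((\<lambda>i. (w i)\<^sup>\<star> * v) \<longlongrightarrow> v\<^sup>\<star> * v) F"
    by (intro tendsto_mult tendsto_star tendsto_const)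
  moreover have "(w i)\<^sup>\<star> * v = 0" for i
    unfolding w_def by (intro orth p_idem s r)
  ultimately have "0 = v\<^sup>\<star> * v"
    by (simp add: tendsto_const_iff approximate_identityD(1)[OF ai])
  then show ?thesis
    by (metis star_mult_self_eq_0)
qed

text \<open>The description of S \<otimes> 1 asks for uniqueness among adjointable operators, whose
  definition does not mention linearity or continuity. Two candidates are therefore compared through
  their adjoints: these agree because their difference is orthogonal to all products, and then R z -
  R' z is orthogonal to itself.\<close>

lemma ampliation_X:
  assumes s: "s \<in> P" and r: "r \<in> P" and a: "a \<in> corner (p s)"
  shows "ampliation (opp_submonoid G P) X s r (corner_op (p s) a) = corner_op (p (r \<otimes> s)) (\<beta> r a)"
proof -
  let ?M = "fibre X (r \<otimes> s)"
  have rs: "r \<otimes> s \<in> P"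
    using s r by (rule P_mult[rotated])
  interpret rs: cstar_projection "p (r \<otimes> s)" by (rule projection_p[OF rs])
  define Q where "Q R \<longleftrightarrow> R \<in> adjointables ?M \<and>
    (\<forall>x\<in>hcarrier (fibre X s). \<forall>y\<in>hcarrier (fibre X r).
      R (snd (psmult X (s, x) (r, y))) = snd (psmult X (s, corner_op (p s) a x) (r, y)))" for R
  have "Q (corner_op (p (r \<otimes> s)) (\<beta> r a))"
    unfolding Q_def
  proof (intro conjI ballI)
    show "corner_op (p (r \<otimes> s)) (\<beta> r a) \<in> adjointables ?M"
      unfolding fibre_X by (intro rs.corner_op_adjointable \<beta>_corner s r a)
    fix x y assume "x \<in> hcarrier (fibre X s)" "y \<in> hcarrier (fibre X r)"
    then have x: "lmul (p s) x = x"
      using s by (simp add: hcarrier_X)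
    then show "corner_op (p (r \<otimes> s)) (\<beta> r a) (snd (psmult X (s, x) (r, y))) =
        snd (psmult X (s, corner_op (p s) a x) (r, y))"
      using product_fixed[OF s r x]
      by (simp add: psmult_X corner_op_def mult_scaleC_right \<beta>_simps[OF r] mult.assoc)
  qed
  moreover have "R = R'" if R: "Q R" and R': "Q R'" for R R'
  proof
    obtain S where S: "S \<in> operators_on ?M" "adjoint_pair ?M R S"
      using R by (auto simp: Q_def adjointables_def)
    obtain S' where S': "S' \<in> operators_on ?M" "adjoint_pair ?M R' S'"
      using R' by (auto simp: Q_def adjointables_def)
    have op: "R \<in> operators_on ?M" "R' \<in> operators_on ?M"
      using R R' by (auto simp: Q_def adjointables_def)
    note H = hcarrier_X[OF rs]
    have eqS: "S z = S' z" if z: "lmul (p (r \<otimes> s)) z = z" for z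
    proof -
      have fixed: "lmul (p (r \<otimes> s)) (S z - S' z) = S z - S' z"
        using S(1) S'(1) z by (simp add: operators_on_def H lmul_diff)
      have "S z - S' z = 0"
      proof (rule product_orthogonal[OF s r fixed])
        fix x y assume x: "lmul (p s) x = x" and y: "lmul (p r) y = y"
        let ?w = "snd (psmult X (s, x) (r, y))"
        have w: "?w \<in> hcarrier ?M"
          using product_fixed[OF s r x] by (simp add: H psmult_X)
        have "R ?w = R' ?w"
          using R R' x y s r by (simp add: Q_def hcarrier_X)
        moreover have "(R ?w)\<^sup>\<star> * z = ?w\<^sup>\<star> * S z" "(R' ?w)\<^sup>\<star> * z = ?w\<^sup>\<star> * S' z"
          using S(2) S'(2) w z unfolding adjoint_pair_def hinner_X H by blast+
        ultimately have "?w\<^sup>\<star> * S z = ?w\<^sup>\<star> * S' z"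
          by simp
        then have "\<omega> r s *\<^sub>C ((\<beta> r x * y)\<^sup>\<star> * (S z - S' z)) = 0"
          by (simp add: psmult_X star_scaleC mult_scaleC_left right_diff_distrib scaleC_diff_right)
        then have "cnj (\<omega> r s) *\<^sub>C \<omega> r s *\<^sub>C ((\<beta> r x * y)\<^sup>\<star> * (S z - S' z)) = 0"
          by (simp add: scaleC_zero_right)
        then show "(\<beta> r x * y)\<^sup>\<star> * (S z - S' z) = 0"
          by (simp add: scaleC_scaleC \<omega>_cnj[OF r s] scaleC_one)
      qed
      then show ?thesis by simp
    qed
    fix z show "R z = R' z"
    proof (cases "lmul (p (r \<otimes> s)) z = z")
      case True
      let ?v = "R z - R' z"
      have v: "lmul (p (r \<otimes> s)) ?v = ?v"
        using op True by (simp add: operators_on_def H lmul_diff)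
      have "(R z)\<^sup>\<star> * ?v = z\<^sup>\<star> * S ?v" "(R' z)\<^sup>\<star> * ?v = z\<^sup>\<star> * S' ?v"
        using S(2) S'(2) True v by (simp_all only: adjoint_pair_def hinner_X H mem_Collect_eq)
      then have "?v\<^sup>\<star> * ?v = 0"
        using eqS[OF v] by (simp only: star_diff left_diff_distrib diff_self)
      then show ?thesis
        by (simp only: star_mult_self_eq_0 right_minus_eq)
    next
      case False
      then show ?thesis
        using op by (simp add: operators_on_def H)
    qed
  qed
  ultimately have "(THE R. Q R) = corner_op (p (r \<otimes> s)) (\<beta> r a)"
    by blast
  then show ?thesis
    by (simp add: ampliation_def opp_simps Q_def)
qed

text \<open>\<open>join\<close> is a definite description. For two least upper bounds k and j, both
  k j^{-1} and its inverse are in P, so P \<inter> P^{-1} = {e} makes them equal.\<close>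

lemma join_props:
  assumes fin: "join_finite G P s t" and s: "s \<in> P" and t: "t \<in> P"
  shows "join G P s t \<in> P" "join G P s t \<otimes> inv s \<in> P" "join G P s t \<otimes> inv t \<in> P"
    "join G P s t \<otimes> inv s \<otimes> s = join G P s t" "join G P s t \<otimes> inv t \<otimes> t = join G P s t"
proof -
  have inv1: "P \<inter> m_inv G ` P = {\<one>}"
    and lub: "\<And>S. finite S \<Longrightarrow> S \<subseteq> carrier G \<Longrightarrow> \<exists>u. upper_bound_in G P S u \<Longrightarrow> \<exists>u. lub_in G P S u"
    using qlo by (auto simp: opp_quasi_lattice_ordered_def)
  obtain j where j: "lub_in G P {s, t} j"
    using lub[of "{s, t}"] fin s t by (auto simp: join_finite_def P_carrier)
  have "k = j" if k: "lub_in G P {s, t} k" for k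
  proof -
    have kj: "k \<in> P" "j \<in> P" "k \<otimes> inv j \<in> P" "j \<otimes> inv k \<in> P"
      using j k by (auto simp: lub_in_def upper_bound_in_def right_le_def)
    have "inv (j \<otimes> inv k) = k \<otimes> inv j"
      using kj by (simp add: P_carrier inv_mult_group)
    then have "k \<otimes> inv j \<in> P \<inter> m_inv G ` P"
      using kj by (metis IntI imageI)
    then have "k \<otimes> inv j = \<one>"
      using inv1 by blast
    then show ?thesis
      using kj by (metis P_carrier inv_closed inv_equality inv_inv)
  qed
  then have "join G P s t = j"
    using j unfolding join_def by blast
  moreover have "j \<in> P" "j \<otimes> inv s \<in> P" "j \<otimes> inv t \<in> P"
    using j by (auto simp: lub_in_def upper_bound_in_def right_le_def)
  ultimately show "join G P s t \<in> P" "join G P s t \<otimes> inv s \<in> P" "join G P s t \<otimes> inv t \<in> P"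
    "join G P s t \<otimes> inv s \<otimes> s = join G P s t" "join G P s t \<otimes> inv t \<otimes> t = join G P s t"
    using s t by (simp_all add: m_assoc P_carrier)
qed

lemma toeplitz_rep_X:
  "toeplitz_rep (opp_submonoid G P) X \<psi> \<longleftrightarrow>
     (\<forall>s\<in>P. \<forall>x y. lmul (p s) x = x \<longrightarrow> lmul (p s) y = y \<longrightarrow> \<psi> (s, x + y) = \<psi> (s, x) + \<psi> (s, y)) \<and>
     (\<forall>s\<in>P. \<forall>c x. lmul (p s) x = x \<longrightarrow> \<psi> (s, c *\<^sub>C x) = c *\<^sub>C \<psi> (s, x)) \<and>
     star_hom (\<lambda>a. \<psi> (\<one>, a)) \<and>
     (\<forall>s\<in>P. \<forall>t\<in>P. \<forall>x y. lmul (p s) x = x \<longrightarrow> lmul (p t) y = y \<longrightarrow>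
        \<psi> (t \<otimes> s, cnj (\<omega> t s) *\<^sub>C (\<beta> t x * y)) = \<psi> (s, x) * \<psi> (t, y)) \<and>
     (\<forall>s\<in>P. \<forall>x y. lmul (p s) x = x \<longrightarrow> lmul (p s) y = y \<longrightarrow>
        (\<psi> (s, x))\<^sup>\<star> * \<psi> (s, y) = \<psi> (\<one>, x\<^sup>\<star> * y))"
  by (simp add: toeplitz_rep_def opp_simps hcarrier_X hinner_X coeff_X psmult_X cong: ball_cong)

text \<open>Used in both directions: to prove Nica covariance for the representation built from a
  covariant pair, and to extract the Nica relation from \<open>iX\<close>.\<close>

lemma nica_covariant_X:
  assumes \<kappa>: "\<And>s a. s \<in> P \<Longrightarrow> a \<in> corner (p s) \<Longrightarrow> compact_ext X \<psi> s (corner_op (p s) a) = \<kappa> s a"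
  shows "nica_covariant G P X \<psi> \<longleftrightarrow>
    (\<forall>s\<in>P. \<forall>t\<in>P. \<forall>a\<in>corner (p s). \<forall>b\<in>corner (p t). \<kappa> s a * \<kappa> t b =
      (if join_finite G P s t then \<kappa> (join G P s t)
         (\<beta> (join G P s t \<otimes> inv s) a * \<beta> (join G P s t \<otimes> inv t) b) else 0))"
proof -
  have compacts: "compacts (fibre X s) = corner_op (p s) ` corner (p s)" if "s \<in> P" for s
  proof -
    interpret cstar_projection "p s" by (rule projection_p[OF that])
    show ?thesis
      using corner_op_compact[OF ai] compacts_projection_moduleE unfolding fibre_X by blast
  qed
  have "compact_ext X \<psi> j (ampliation (opp_submonoid G P) X s (j \<otimes> inv s) (corner_op (p s) a) \<circ>
      ampliation (opp_submonoid G P) X t (j \<otimes> inv t) (corner_op (p t) b)) =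
      \<kappa> j (\<beta> (j \<otimes> inv s) a * \<beta> (j \<otimes> inv t) b)"
    if "join_finite G P s t" "j = join G P s t" "s \<in> P" "t \<in> P" "a \<in> corner (p s)" "b \<in> corner (p t)"
    for s t a b j
  proof -
    note j = join_props[OF that(1,3,4), folded that(2)]
    interpret cstar_projection "p j" by (rule projection_p[OF j(1)])
    have c: "\<beta> (j \<otimes> inv s) a \<in> corner (p j)" "\<beta> (j \<otimes> inv t) b \<in> corner (p j)"
      using \<beta>_corner[OF that(3) j(2) that(5)] \<beta>_corner[OF that(4) j(3) that(6)] by (simp_all add: j)
    have "ampliation (opp_submonoid G P) X s (j \<otimes> inv s) (corner_op (p s) a) = corner_op (p j) (\<beta> (j \<otimes> inv s) a)"
      "ampliation (opp_submonoid G P) X t (j \<otimes> inv t) (corner_op (p t) b) = corner_op (p j) (\<beta> (j \<otimes> inv t) b)"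
      using ampliation_X[OF that(3) j(2) that(5)] ampliation_X[OF that(4) j(3) that(6)] by (simp_all add: j)
    then show ?thesis
      by (simp only: corner_op_algebra(3)[OF c] \<kappa>[OF j(1) cornerI(2)[OF c]])
  qed
  then show ?thesis
    by (simp add: nica_covariant_def compacts \<kappa> Let_def cong: ball_cong)
qed

end


section \<open>From covariant representations to representations of the product system\<close>

locale nt_covariant_representation = twisted_semigroup_system G P \<beta> \<omega> F u
  for G :: "('g, 'm) monoid_scheme" (structure) and P :: "'g set"
    and \<beta> :: "'g \<Rightarrow> 'a::cstar_algebra \<Rightarrow> 'a" and \<omega> :: "'g \<Rightarrow> 'g \<Rightarrow> complex"
    and F :: "'i filter" and u :: "'i \<Rightarrow> 'a" +
  fixes \<pi> :: "'a \<Rightarrow> 'h::complex_hilbert_space bop" and V :: "'g \<Rightarrow> 'h bop"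
  assumes cov: "nt_covariant_rep G P \<beta> \<omega> \<pi> V"
begin

lemma \<pi>_nondegenerate: "nondegenerate_rep \<pi>"
  using cov by (simp add: nt_covariant_rep_def)

lemma \<pi>_hom: "star_hom \<pi>"
  using \<pi>_nondegenerate by (simp add: nondegenerate_rep_def)

lemmas \<pi>_simps = star_hom_simps[OF \<pi>_hom]

lemma V_partial_isometry: "s \<in> P \<Longrightarrow> V s * ((V s)\<^sup>\<star> * V s) = V s"
  and V_mult: "s \<in> P \<Longrightarrow> t \<in> P \<Longrightarrow> V s * V t = \<omega> s t *\<^sub>C V (s \<otimes> t)"
  and \<pi>_\<beta>: "s \<in> P \<Longrightarrow> \<pi> (\<beta> s a) = V s * (\<pi> a * (V s)\<^sup>\<star>)"
  and V_comm: "s \<in> P \<Longrightarrow> (V s)\<^sup>\<star> * (V s * \<pi> a) = \<pi> a * ((V s)\<^sup>\<star> * V s)"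
  and V_nica: "s \<in> P \<Longrightarrow> t \<in> P \<Longrightarrow> (V s)\<^sup>\<star> * (V s * ((V t)\<^sup>\<star> * V t)) =
    (if join_finite G P s t then (V (join G P s t))\<^sup>\<star> * V (join G P s t) else 0)"
  using cov unfolding nt_covariant_rep_def partial_isometry_def mult.assoc by blast+

lemma V_star_partial_isometry: "s \<in> P \<Longrightarrow> (V s)\<^sup>\<star> * (V s * (V s)\<^sup>\<star>) = (V s)\<^sup>\<star>"
  using arg_cong[OF V_partial_isometry, of s star] by (simp add: star_mult star_star mult.assoc)

lemma V_star_mult:
  assumes "s \<in> P" "t \<in> P"
  shows "(V t)\<^sup>\<star> * (V s)\<^sup>\<star> = cnj (\<omega> s t) *\<^sub>C (V (s \<otimes> t))\<^sup>\<star>"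
  using arg_cong[OF V_mult[OF assms], of star] by (simp add: star_mult star_scaleC)

text \<open>V_e is idempotent since \<omega>(e, e) = 1, and \<beta>_e = id gives \<pi>(a) = V_e
  \<pi>(a) V_e^*. Hence V_e fixes \<pi>(a) from the left, by nondegeneracy also from the right, and
  adjoints give the claim.\<close>

lemma V_one_star: "(V \<one>)\<^sup>\<star> * \<pi> a = \<pi> a"
proof -
  have V1: "V \<one> * \<pi> a = \<pi> a" for a
  proof -
    have "V \<one> * V \<one> = V \<one>"
      using V_mult[OF P_one P_one] by (simp add: \<omega>_one scaleC_one)
    moreover have "\<pi> a = V \<one> * (\<pi> a * (V \<one>)\<^sup>\<star>)"
      using \<pi>_\<beta>[OF P_one, of a] by (simp add: \<beta>_one)
    ultimately show ?thesis
      by (metis mult.assoc)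
  qed
  have "\<pi> b * V \<one> = \<pi> b" for b
    by (rule nondegenerate_rep_eqI[OF \<pi>_nondegenerate]) (simp add: mult.assoc V1)
  then have "(\<pi> (a\<^sup>\<star>) * V \<one>)\<^sup>\<star> = (\<pi> (a\<^sup>\<star>))\<^sup>\<star>"
    by simp
  then show ?thesis
    by (simp add: star_mult \<pi>_simps star_star)
qed

text \<open>V_s V_s^* fixes the range of V_s, which contains that of \<pi>(\<beta>_s(u_i) x) = V_s
  \<pi>(u_i) V_s^* \<pi>(x). By extendibility \<beta>_s(u_i) x converges to p_s x = x.\<close>

lemma V_range:
  assumes s: "s \<in> P" and x: "lmul (p s) x = x"
  shows "V s * ((V s)\<^sup>\<star> * \<pi> x) = \<pi> x"
proof -
  have "V s * ((V s)\<^sup>\<star> * \<pi> (\<beta> s (u i) * x)) = \<pi> (\<beta> s (u i) * x)" for i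
  proof -
    have "V s * ((V s)\<^sup>\<star> * \<pi> (\<beta> s (u i) * x)) =
        (V s * ((V s)\<^sup>\<star> * V s)) * (\<pi> (u i) * ((V s)\<^sup>\<star> * \<pi> x))"
      by (simp only: \<pi>_simps(3) \<pi>_\<beta>[OF s] mult.assoc)
    also have "\<dots> = \<pi> (\<beta> s (u i) * x)"
      by (simp only: V_partial_isometry[OF s] \<pi>_simps(3) \<pi>_\<beta>[OF s] mult.assoc)
    finally show ?thesis .
  qed
  moreover have lim: "((\<lambda>i. \<pi> (\<beta> s (u i) * x)) \<longlongrightarrow> \<pi> x) F"
    using \<beta>_u_tendsto(1)[OF s, of x] by (intro tendsto_star_hom[OF \<pi>_hom]) (simp add: x)
  moreover have "((\<lambda>i. V s * ((V s)\<^sup>\<star> * \<pi> (\<beta> s (u i) * x))) \<longlongrightarrow> V s * ((V s)\<^sup>\<star> * \<pi> x)) F"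
    by (intro tendsto_mult tendsto_const lim)
  ultimately show ?thesis
    using tendsto_unique[OF approximate_identityD(1)[OF ai]] by simp
qed

lemma V_range_corner:
  assumes s: "s \<in> P" and a: "a \<in> corner (p s)"
  shows "V s * ((V s)\<^sup>\<star> * \<pi> a) = \<pi> a" and "\<pi> a * (V s * (V s)\<^sup>\<star>) = \<pi> a"
proof -
  interpret cstar_projection "p s" by (rule projection_p[OF s])
  have *: "V s * ((V s)\<^sup>\<star> * \<pi> b) = \<pi> b" if "b \<in> corner (p s)" for b
    using V_range[OF s] that by (simp add: corner_def)
  then show "V s * ((V s)\<^sup>\<star> * \<pi> a) = \<pi> a"
    using a by blast
  have "(V s * ((V s)\<^sup>\<star> * \<pi> (a\<^sup>\<star>)))\<^sup>\<star> = (\<pi> (a\<^sup>\<star>))\<^sup>\<star>"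
    using *[OF corner_star[OF a]] by simp
  then show "\<pi> a * (V s * (V s)\<^sup>\<star>) = \<pi> a"
    by (simp add: star_mult star_star \<pi>_simps mult.assoc)
qed

definition psi where "psi = (\<lambda>(s, x). (V s)\<^sup>\<star> * \<pi> x)"

lemma psi_apply: "psi (s, x) = (V s)\<^sup>\<star> * \<pi> x"
  by (simp add: psi_def)

text \<open>V_s^* V_t^* is the conjugate of \<omega>(t, s) times the adjoint of V_ts, and V_t^*
  \<pi>(\<beta>_t(x)) = \<pi>(x) V_t^* because V_t^* V_t commutes with \<pi>(x).\<close>

lemma psi_psmult:
  assumes s: "s \<in> P" and t: "t \<in> P"
  shows "psi (t \<otimes> s, cnj (\<omega> t s) *\<^sub>C (\<beta> t x * y)) = psi (s, x) * psi (t, y)"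
proof -
  have "psi (t \<otimes> s, cnj (\<omega> t s) *\<^sub>C (\<beta> t x * y)) = ((V s)\<^sup>\<star> * (V t)\<^sup>\<star>) * (\<pi> (\<beta> t x) * \<pi> y)"
    by (simp add: psi_apply \<pi>_simps V_star_mult[OF t s] mult_scaleC_left mult_scaleC_right)
  also have "\<dots> = (V s)\<^sup>\<star> * (((V t)\<^sup>\<star> * (V t * \<pi> x)) * ((V t)\<^sup>\<star> * \<pi> y))"
    by (simp add: \<pi>_\<beta>[OF t] mult.assoc)
  also have "\<dots> = (V s)\<^sup>\<star> * (\<pi> x * (((V t)\<^sup>\<star> * (V t * (V t)\<^sup>\<star>)) * \<pi> y))"
    unfolding V_comm[OF t] by (simp add: mult.assoc)
  finally show ?thesis
    by (simp add: psi_apply V_star_partial_isometry[OF t] mult.assoc)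
qed

lemma toeplitz_rep_psi: "toeplitz_rep (opp_submonoid G P) X psi"
  unfolding toeplitz_rep_X
proof (intro conjI ballI allI impI)
  show "star_hom (\<lambda>a. psi (\<one>, a))"
    by (simp add: psi_apply V_one_star \<pi>_hom)
  fix s x y assume s: "s \<in> P" and "lmul (p s) x = x" and y: "lmul (p s) y = y"
  show "(psi (s, x))\<^sup>\<star> * psi (s, y) = psi (\<one>, x\<^sup>\<star> * y)"
    using V_one_star[of "x\<^sup>\<star> * y"]
    by (simp add: psi_apply star_mult star_star mult.assoc V_range[OF s y] \<pi>_simps)
qed (simp_all add: psi_psmult, simp_all add: psi_apply \<pi>_simps distrib_left mult_scaleC_right)

text \<open>The map induced by \<open>psi\<close> on compacts: psi(s, x) times the adjoint of psi(s,
  y) is V_s^* \<pi>(x) \<pi>(y)^* V_s.\<close>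

definition kappa where "kappa s a = (V s)\<^sup>\<star> * (\<pi> a * V s)"

lemma compact_ext_psi:
  assumes s: "s \<in> P" and a: "a \<in> corner (p s)"
  shows "compact_ext X psi s (corner_op (p s) a) = kappa s a"
proof -
  interpret cstar_projection "p s" by (rule projection_p[OF s])
  show ?thesis
  proof (rule compact_ext_corner_op[OF ai fibre_X])
    fix a b assume "a \<in> corner (p s)" and b: "b \<in> corner (p s)"
    have "kappa s a * kappa s b = (V s)\<^sup>\<star> * (\<pi> a * ((V s * ((V s)\<^sup>\<star> * \<pi> b)) * V s))"
      by (simp add: kappa_def mult.assoc)
    then show "kappa s (a * b) = kappa s a * kappa s b"
      by (simp add: V_range_corner(1)[OF s b] kappa_def \<pi>_simps mult.assoc)
  qed (simp_all add: a kappa_def \<pi>_simps distrib_left distrib_right mult_scaleC_left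
      mult_scaleC_right star_mult star_star psi_apply mult.assoc)
qed

text \<open>The counterpart of a \<otimes> 1 = \<beta>_r(a). The adjoint of V_rs is a scalar
  multiple of V_s^* V_r^*, the projection V_s V_s^* is absorbed by a, and commuting V_r^* V_r past
  \<pi>(a) turns \<pi>(a) V_r^* into V_r^* \<pi>(\<beta>_r(a)).\<close>

lemma kappa_V_star:
  assumes r: "r \<in> P" and s: "s \<in> P" and a: "a \<in> corner (p s)"
  shows "kappa s a * (V (r \<otimes> s))\<^sup>\<star> = (V (r \<otimes> s))\<^sup>\<star> * \<pi> (\<beta> r a)"
proof -
  have j: "(V (r \<otimes> s))\<^sup>\<star> = \<omega> r s *\<^sub>C ((V s)\<^sup>\<star> * (V r)\<^sup>\<star>)"
    by (simp add: V_star_mult[OF r s] scaleC_scaleC \<omega>_cnj[OF r s] scaleC_one)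
  have "kappa s a * ((V s)\<^sup>\<star> * (V r)\<^sup>\<star>) = (V s)\<^sup>\<star> * ((\<pi> a * (V s * (V s)\<^sup>\<star>)) * (V r)\<^sup>\<star>)"
    by (simp add: kappa_def mult.assoc)
  also have "\<dots> = (V s)\<^sup>\<star> * (\<pi> a * ((V r)\<^sup>\<star> * (V r * (V r)\<^sup>\<star>)))"
    by (simp only: V_range_corner(2)[OF s a] V_star_partial_isometry[OF r])
  also have "\<dots> = (V s)\<^sup>\<star> * ((\<pi> a * ((V r)\<^sup>\<star> * V r)) * (V r)\<^sup>\<star>)"
    by (simp add: mult.assoc)
  also have "\<dots> = ((V s)\<^sup>\<star> * (V r)\<^sup>\<star>) * \<pi> (\<beta> r a)"
    unfolding V_comm[OF r, symmetric] by (simp add: \<pi>_\<beta>[OF r] mult.assoc)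
  finally show ?thesis
    by (simp add: j mult_scaleC_left mult_scaleC_right)
qed

lemma V_kappa:
  assumes r: "r \<in> P" and s: "s \<in> P" and a: "a \<in> corner (p s)"
  shows "V (r \<otimes> s) * kappa s a = \<pi> (\<beta> r a) * V (r \<otimes> s)"
proof -
  have "a\<^sup>\<star> \<in> corner (p s)"
    by (rule cstar_projection.corner_star[OF projection_p[OF s] a])
  then have "(kappa s (a\<^sup>\<star>) * (V (r \<otimes> s))\<^sup>\<star>)\<^sup>\<star> = ((V (r \<otimes> s))\<^sup>\<star> * \<pi> (\<beta> r (a\<^sup>\<star>)))\<^sup>\<star>"
    by (simp only: kappa_V_star[OF r s])
  then show ?thesis
    by (simp add: kappa_def star_mult star_star \<pi>_simps \<beta>_simps r mult.assoc)
qed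

lemma nica_covariant_psi: "nica_covariant G P X psi"
proof (rule iffD2[OF nica_covariant_X[of psi kappa]], rule compact_ext_psi, assumption, assumption, intro ballI)
  fix s t a b assume s: "s \<in> P" and t: "t \<in> P" and a: "a \<in> corner (p s)" and b: "b \<in> corner (p t)"
  \<comment> \<open>The initial projections of V_s and V_t are inserted between the two factors,
    where the Nica relation applies to their product.\<close>
  have "kappa s a * kappa t b =
      (V s)\<^sup>\<star> * (\<pi> a * ((V s * ((V s)\<^sup>\<star> * V s)) * (((V t)\<^sup>\<star> * (V t * (V t)\<^sup>\<star>)) * (\<pi> b * V t))))"
    by (simp only: V_partial_isometry[OF s] V_star_partial_isometry[OF t] kappa_def mult.assoc)
  also have "\<dots> = kappa s a * (((V s)\<^sup>\<star> * (V s * ((V t)\<^sup>\<star> * V t))) * kappa t b)"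
    by (simp add: kappa_def mult.assoc)
  finally have prod: "kappa s a * kappa t b = kappa s a * (((V s)\<^sup>\<star> * (V s * ((V t)\<^sup>\<star> * V t))) * kappa t b)" .
  show "kappa s a * kappa t b = (if join_finite G P s t then kappa (join G P s t)
         (\<beta> (join G P s t \<otimes> inv s) a * \<beta> (join G P s t \<otimes> inv t) b) else 0)"
  proof (cases "join_finite G P s t")
    case False
    then show ?thesis
      by (simp add: prod V_nica s t)
  next
    case True
    define j where "j = join G P s t"
    note j = join_props[OF True s t, folded j_def]
    \<comment> \<open>V_j^* is then pushed to the left and V_j to the right, with the factorisations
      j = (j s^{-1}) s = (j t^{-1}) t.\<close>
    have "kappa s a * kappa t b = (kappa s a * (V j)\<^sup>\<star>) * (V j * kappa t b)"
      using True by (simp add: prod V_nica s t mult.assoc flip: j_def)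
    also have "\<dots> = (V j)\<^sup>\<star> * \<pi> (\<beta> (j \<otimes> inv s) a) * (\<pi> (\<beta> (j \<otimes> inv t) b) * V j)"
      using kappa_V_star[OF j(2) s a] V_kappa[OF j(3) t b] by (simp add: j)
    also have "\<dots> = kappa j (\<beta> (j \<otimes> inv s) a * \<beta> (j \<otimes> inv t) b)"
      by (simp add: kappa_def \<pi>_simps mult.assoc)
    finally show ?thesis
      using True by (simp add: j_def)
  qed
qed

lemma nica_toeplitz_rep_psi: "nica_toeplitz_rep G P X psi"
  by (simp add: nica_toeplitz_rep_def toeplitz_rep_psi nica_covariant_psi)

text \<open>Matches V_s with i_P(s), whose adjoint sends i_A(a) to i_X(s, p_s a). Covariance gives
  V_s^* \<pi>(\<beta>_s(u_i) a) = \<pi>(u_i) V_s^* \<pi>(a); the limit of the left side comes from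
  extendibility in norm, that of the right side from nondegeneracy strongly, so both are taken on
  vectors.\<close>

lemma psi_lmul_p:
  assumes s: "s \<in> P"
  shows "psi (s, lmul (p s) a) = (V s)\<^sup>\<star> * \<pi> a"
proof (rule bop_eqI)
  fix h
  have eq: "(V s)\<^sup>\<star> * \<pi> (\<beta> s (u i) * a) = \<pi> (u i) * ((V s)\<^sup>\<star> * \<pi> a)" for i
  proof -
    have "(V s)\<^sup>\<star> * \<pi> (\<beta> s (u i) * a) = ((V s)\<^sup>\<star> * (V s * \<pi> (u i))) * ((V s)\<^sup>\<star> * \<pi> a)"
      by (simp add: \<pi>_simps \<pi>_\<beta>[OF s] mult.assoc)
    also have "\<dots> = \<pi> (u i) * (((V s)\<^sup>\<star> * (V s * (V s)\<^sup>\<star>)) * \<pi> a)"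
      unfolding V_comm[OF s] by (simp add: mult.assoc)
    finally show ?thesis
      by (simp add: V_star_partial_isometry[OF s])
  qed
  have "((\<lambda>i. (V s)\<^sup>\<star> * \<pi> (\<beta> s (u i) * a)) \<longlongrightarrow> psi (s, lmul (p s) a)) F"
    unfolding psi_apply by (intro tendsto_mult tendsto_const tendsto_star_hom[OF \<pi>_hom] \<beta>_u_tendsto s)
  then have "((\<lambda>i. bop_apply (\<pi> (u i) * ((V s)\<^sup>\<star> * \<pi> a)) h) \<longlongrightarrow> bop_apply (psi (s, lmul (p s) a)) h) F"
    unfolding eq by (rule tendsto_bop_apply_left)
  moreover have "((\<lambda>i. bop_apply (\<pi> (u i) * ((V s)\<^sup>\<star> * \<pi> a)) h) \<longlongrightarrow> bop_apply ((V s)\<^sup>\<star> * \<pi> a) h) F"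
    using nondegenerate_rep_approximate_identity[OF \<pi>_nondegenerate ai] by (simp add: bop_apply_times)
  ultimately show "bop_apply (psi (s, lmul (p s) a)) h = bop_apply ((V s)\<^sup>\<star> * \<pi> a) h"
    using tendsto_unique[OF approximate_identityD(1)[OF ai]] by blast
qed

end


section \<open>The covariant pair of a generating representation of the product system\<close>

locale generating_nica_toeplitz_rep = twisted_semigroup_system G P \<beta> \<omega> F u
  for G :: "('g, 'm) monoid_scheme" (structure) and P :: "'g set"
    and \<beta> :: "'g \<Rightarrow> 'a::cstar_algebra \<Rightarrow> 'a" and \<omega> :: "'g \<Rightarrow> 'g \<Rightarrow> complex"
    and F :: "'i filter" and u :: "'i \<Rightarrow> 'a" +
  fixes iX :: "'g \<times> 'a \<Rightarrow> 'b::cstar_algebra"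
  assumes nica_toeplitz: "nica_toeplitz_rep G P X iX"
    and generated: "cstar_generated {iX (s, x) | s x. s \<in> P \<and> x \<in> hcarrier (fibre X s)} = UNIV"
begin

definition jA where "jA a = iX (\<one>, a)"

definition jP where "jP s = strict_lim F (\<lambda>i. mult_embed ((iX (s, \<beta> s (u i)))\<^sup>\<star>))"

lemma toeplitz: "toeplitz_rep (opp_submonoid G P) X iX"
  using nica_toeplitz by (simp add: nica_toeplitz_rep_def)

lemma jA_hom: "star_hom jA"
  and iX_add: "s \<in> P \<Longrightarrow> lmul (p s) x = x \<Longrightarrow> lmul (p s) y = y \<Longrightarrow> iX (s, x + y) = iX (s, x) + iX (s, y)"
  and iX_scaleC: "s \<in> P \<Longrightarrow> lmul (p s) x = x \<Longrightarrow> iX (s, c *\<^sub>C x) = c *\<^sub>C iX (s, x)"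
  and iX_mult: "s \<in> P \<Longrightarrow> t \<in> P \<Longrightarrow> lmul (p s) x = x \<Longrightarrow> lmul (p t) y = y \<Longrightarrow>
    iX (s, x) * iX (t, y) = iX (t \<otimes> s, cnj (\<omega> t s) *\<^sub>C (\<beta> t x * y))"
  and iX_inner: "s \<in> P \<Longrightarrow> lmul (p s) x = x \<Longrightarrow> lmul (p s) y = y \<Longrightarrow>
    (iX (s, x))\<^sup>\<star> * iX (s, y) = jA (x\<^sup>\<star> * y)"
  using toeplitz unfolding toeplitz_rep_X jA_def[abs_def] by auto

lemmas jA_simps = star_hom_simps[OF jA_hom]

lemma iX_jA:
  assumes "s \<in> P" "lmul (p s) x = x"
  shows "iX (s, x) * jA a = iX (s, x * a)" and "jA a * iX (s, x) = iX (s, \<beta> s a * x)"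
proof -
  have a: "lmul (p \<one>) a = a"
    by (simp only: p_one lmul_one)
  show "iX (s, x) * jA a = iX (s, x * a)" "jA a * iX (s, x) = iX (s, \<beta> s a * x)"
    using iX_mult[OF assms(1) P_one assms(2) a] iX_mult[OF P_one assms(1) a assms(2)] assms
    by (simp_all add: jA_def \<omega>_one_left \<omega>_one_right \<beta>_one scaleC_one P_carrier)
qed

lemma iX_norm_le:
  assumes "s \<in> P" "lmul (p s) x = x"
  shows "norm (iX (s, x)) \<le> norm x"
proof -
  have "(norm (iX (s, x)))\<^sup>2 = norm (jA (x\<^sup>\<star> * x))"
    by (simp add: iX_inner assms flip: cstar_identity)
  also have "\<dots> \<le> norm (x\<^sup>\<star> * x)"
    by (rule star_hom_contractive[OF jA_hom])
  finally have "(norm (iX (s, x)))\<^sup>2 \<le> (norm x)\<^sup>2"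
    by (simp add: cstar_identity)
  then show ?thesis
    by (rule power2_le_imp_le) simp
qed

lemma iX_tendsto:
  assumes s: "s \<in> P" and f: "\<And>i. lmul (p s) (f i) = f i" and x: "lmul (p s) x = x" and lim: "(f \<longlongrightarrow> x) F'"
  shows "((\<lambda>i. iX (s, f i)) \<longlongrightarrow> iX (s, x)) F'"
proof -
  have "iX (s, f i) - iX (s, x) = iX (s, f i - x)" for i
  proof -
    have "lmul (p s) (f i - x) = f i - x"
      by (simp add: lmul_diff f x)
    from iX_add[OF s this x] show ?thesis by simp
  qed
  moreover have "norm (iX (s, f i - x)) \<le> norm (f i - x)" for i
    by (rule iX_norm_le[OF s]) (simp add: lmul_diff f x)
  moreover have "((\<lambda>i. norm (f i - x)) \<longlongrightarrow> 0) F'"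
    using lim by (simp add: tendsto_norm_zero_iff LIM_zero_iff)
  ultimately have "((\<lambda>i. iX (s, f i) - iX (s, x)) \<longlongrightarrow> 0) F'"
    by - (rule Lim_null_comparison[where g = "\<lambda>i. norm (f i - x)"]; simp)
  then show ?thesis
    by (simp add: LIM_zero_iff)
qed

text \<open>The closed span N of i_A(A) B is a right ideal, so the elements of N with adjoint in N
  form a C*-subalgebra, and it suffices to find the generators there. i_X(s, x) is in N because
  \<beta>_s(u_i) x -> p_s x = x, and its adjoint because x u_i -> x.\<close>

lemma jA_nondegenerate: "nondegenerate_hom jA"
proof -
  define N where "N = closure (cspan {jA a * b | a b. True})"
  have clN: "closed N" and N0: "0 \<in> N"
    and N_add: "x \<in> N \<Longrightarrow> y \<in> N \<Longrightarrow> x + y \<in> N" and N_scale: "x \<in> N \<Longrightarrow> c *\<^sub>C x \<in> N" for x y c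
    unfolding N_def by (simp_all add: closure_cspan_zero closure_cspan_add closure_cspan_scaleC)
  have base: "jA a * b \<in> N" for a b
    unfolding N_def by (intro closure_cspan_base) blast
  have right_ideal: "x * y \<in> N" if "x \<in> N" for x y
  proof -
    have "N \<subseteq> {x. x * y \<in> N}"
      unfolding N_def
    proof (rule closure_cspan_subset, unfold N_def[symmetric])
      show "{jA a * b |a b. True} \<subseteq> {x. x * y \<in> N}"
        by (auto simp: mult.assoc base)
      have "closed ((\<lambda>x. x * y) -` N)"
        by (intro closed_vimage clN continuous_intros)
      then show "closed {x. x * y \<in> N}"
        by (simp add: vimage_def)
    qed (simp_all add: N0 distrib_right N_add mult_scaleC_left N_scale)
    with that show ?thesis by blast
  qed
  have limN: "x \<in> N" if "(f \<longlongrightarrow> x) F" "\<And>i. f i \<in> N" for f x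
    using clN approximate_identityD(1)[OF ai] that by (metis Lim_in_closed_set always_eventually)
  define C where "C = N \<inter> star -` N"
  have "cstar_subalgebra C"
    unfolding cstar_subalgebra_def
  proof (intro conjI ballI allI)
    have "closed (star -` N :: 'b set)"
      by (intro closed_vimage clN linear_continuous_on bounded_linear_star)
    then show "closed C"
      unfolding C_def by (intro closed_Int clN)
  qed (auto simp: C_def N0 N_add N_scale right_ideal star_zero star_add star_mult star_scaleC star_star)
  moreover have "{iX (s, x) | s x. s \<in> P \<and> x \<in> hcarrier (fibre X s)} \<subseteq> C"
  proof safe
    fix s x assume s: "s \<in> P" and "x \<in> hcarrier (fibre X s)"
    then have x: "lmul (p s) x = x"
      by (simp add: hcarrier_X)
    have "((\<lambda>i. iX (s, \<beta> s (u i) * x)) \<longlongrightarrow> iX (s, x)) F"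
      using \<beta>_u_tendsto(1)[OF s, of x] s by (intro iX_tendsto) (simp_all add: lmul_mult p_\<beta> x)
    then have "iX (s, x) \<in> N"
      by (rule limN) (simp add: base s x flip: iX_jA(2))
    moreover have "((\<lambda>i. (iX (s, x * u i))\<^sup>\<star>) \<longlongrightarrow> (iX (s, x))\<^sup>\<star>) F"
      using s by (intro tendsto_star iX_tendsto approximate_identityD(4)[OF ai]) (simp_all add: lmul_mult x)
    then have "(iX (s, x))\<^sup>\<star> \<in> N"
      by (rule limN) (simp add: base s x star_mult flip: iX_jA(1) jA_simps(4))
    ultimately show "iX (s, x) \<in> C"
      by (simp add: C_def)
  qed
  ultimately have "C = UNIV"
    using generated by (auto simp: cstar_generated_def)
  then show ?thesis
    by (auto simp: nondegenerate_hom_def jA_hom C_def N_def)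
qed

lemma jA_induct:
  assumes "closed S" "\<And>a b. jA a * b \<in> S" "\<And>x y. x \<in> S \<Longrightarrow> y \<in> S \<Longrightarrow> x + y \<in> S"
    and "\<And>c x. x \<in> S \<Longrightarrow> c *\<^sub>C x \<in> S"
  shows "b \<in> S"
proof -
  have "0 \<in> S"
    using assms(2)[of 0 0] by simp
  then have "closure (cspan {jA a * b | a b. True}) \<subseteq> S"
    using assms by (intro closure_cspan_subset) auto
  then show ?thesis
    using jA_nondegenerate by (auto simp: nondegenerate_hom_def)
qed

text \<open>The net v is kept general because the right-hand limits for u come from the left-hand
  ones for the adjoint net.\<close>

lemma jA_approximate_identity_left:
  assumes v: "approximate_identity F v"
  shows "((\<lambda>i. jA (v i) * b) \<longlongrightarrow> b) F"
proof -
  define T where "T i b = jA (v i) * b - b" for i b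
  have "norm (T i b) \<le> 2 * norm b" for i b
  proof -
    have "norm (jA (v i)) \<le> 1"
      by (rule order_trans[OF star_hom_contractive[OF jA_hom] approximate_identityD(2)[OF v]])
    then have "norm (jA (v i) * b) \<le> 1 * norm b"
      by (rule order_trans[OF norm_mult_ineq mult_right_mono]) simp
    then show ?thesis
      unfolding T_def using norm_triangle_ineq4[of "jA (v i) * b" b] by simp
  qed
  then have cl: "closed {b. ((\<lambda>i. T i b) \<longlongrightarrow> 0) F}"
    by (intro equibounded_null_closed[where K = 2]) (simp_all add: T_def right_diff_distrib)
  have base: "((\<lambda>i. T i (jA a * b)) \<longlongrightarrow> 0) F" for a b
  proof -
    have "((\<lambda>i. jA (v i * a) * b) \<longlongrightarrow> jA a * b) F"
      by (intro tendsto_mult tendsto_const tendsto_star_hom[OF jA_hom] approximate_identityD(3)[OF v])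
    then show ?thesis
      unfolding T_def by (subst LIM_zero_iff) (simp add: jA_simps mult.assoc)
  qed
  have "b \<in> {b. ((\<lambda>i. T i b) \<longlongrightarrow> 0) F}"
  proof (rule jA_induct[OF cl])
    fix x y c assume x: "x \<in> {b. ((\<lambda>i. T i b) \<longlongrightarrow> 0) F}"
    have "T i (c *\<^sub>C x) = c *\<^sub>C T i x" for i
      by (simp add: T_def mult_scaleC_right scaleC_diff_right)
    then show "c *\<^sub>C x \<in> {b. ((\<lambda>i. T i b) \<longlongrightarrow> 0) F}"
      using tendsto_scaleC[of _ 0 F c] x by (simp add: scaleC_zero_right)
    assume y: "y \<in> {b. ((\<lambda>i. T i b) \<longlongrightarrow> 0) F}"
    have "T i (x + y) = T i x + T i y" for i
      by (simp add: T_def distrib_left)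
    then show "x + y \<in> {b. ((\<lambda>i. T i b) \<longlongrightarrow> 0) F}"
      using tendsto_add[of _ 0 F _ 0] x y by simp
  qed (simp add: base)
  then show ?thesis
    by (simp add: T_def LIM_zero_iff)
qed

lemma jA_approximate_identity: "approximate_identity F (\<lambda>i. jA (u i))"
proof -
  have "((\<lambda>i. (jA ((u i)\<^sup>\<star>) * b\<^sup>\<star>)\<^sup>\<star>) \<longlongrightarrow> b\<^sup>\<star>\<^sup>\<star>) F" for b
    by (intro tendsto_star jA_approximate_identity_left approximate_identity_star ai)
  then show ?thesis
    using jA_approximate_identity_left[OF ai] approximate_identityD(1)[OF ai]
      order_trans[OF star_hom_contractive[OF jA_hom] approximate_identityD(2)[OF ai]]
    unfolding approximate_identity_def by (simp add: star_mult jA_simps star_star)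
qed

text \<open>The net v is bounded by 1, so by nondegeneracy convergence is needed on i_A(a) only, for
  v i and for its adjoint. After taking adjoints the first case gives the right products, the second
  gives the left products, and the two limit maps form a double centraliser.\<close>

lemma jP_limit:
  assumes s: "s \<in> P"
  shows "limitin strict_topology (\<lambda>i. mult_embed ((iX (s, \<beta> s (u i)))\<^sup>\<star>)) (jP s) F"
proof -
  define v where "v i = iX (s, \<beta> s (u i))" for i
  have F: "F \<noteq> bot"
    by (rule approximate_identityD(1)[OF ai])
  have v1: "norm (v i) \<le> 1" for i
  proof -
    have "norm (v i) \<le> norm (\<beta> s (u i))"
      unfolding v_def using s by (intro iX_norm_le) (simp_all add: p_\<beta>)
    also have "\<dots> \<le> norm (u i)"
      by (rule star_hom_contractive[OF \<beta>_star_hom[OF s]])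
    finally show ?thesis
      using approximate_identityD(2)[OF ai, of i] by linarith
  qed
  have conv: "\<exists>l. ((\<lambda>i. w i * b) \<longlongrightarrow> l) F"
    if w1: "\<And>i. norm (w i) \<le> 1" and base: "\<And>a. \<exists>l. ((\<lambda>i. w i * jA a) \<longlongrightarrow> l) F" for w b
  proof -
    have "norm (w i * b) \<le> 1 * norm b" for i b
      by (rule order_trans[OF norm_mult_ineq mult_right_mono]) (simp_all add: w1)
    then have cl: "closed {b. \<exists>l. ((\<lambda>i. w i * b) \<longlongrightarrow> l) F}"
      by (intro equibounded_convergent_closed[where K = 1] F) (simp_all add: right_diff_distrib)
    have "b \<in> {b. \<exists>l. ((\<lambda>i. w i * b) \<longlongrightarrow> l) F}"
    proof (rule jA_induct[OF cl])
      fix a b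
      obtain l where "((\<lambda>i. w i * jA a) \<longlongrightarrow> l) F"
        using base by blast
      then have "((\<lambda>i. w i * jA a * b) \<longlongrightarrow> l * b) F"
        by (intro tendsto_mult tendsto_const)
      then show "jA a * b \<in> {b. \<exists>l. ((\<lambda>i. w i * b) \<longlongrightarrow> l) F}"
        by (auto simp: mult.assoc)
    qed (auto simp: distrib_left mult_scaleC_right intro: tendsto_add tendsto_scaleC)
    then show ?thesis by simp
  qed
  have "\<exists>l. ((\<lambda>i. v i * jA a) \<longlongrightarrow> l) F" for a
  proof -
    have "((\<lambda>i. iX (s, \<beta> s (u i) * a)) \<longlongrightarrow> iX (s, lmul (p s) a)) F"
      using s by (intro iX_tendsto \<beta>_u_tendsto) (simp_all add: lmul_mult p_\<beta> p_idem)
    then show ?thesis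
      using s by (auto simp: v_def iX_jA p_\<beta>)
  qed
  then have conv1: "\<exists>l. ((\<lambda>i. v i * b) \<longlongrightarrow> l) F" for b
    by (rule conv[OF v1])
  \<comment> \<open>The adjoint of this product is the left action of a^* on v i, that is i_X(s,
    \<beta>_s(a^* u_i)), so norm continuity of \<beta>_s gives the limit.\<close>
  have "\<exists>l. ((\<lambda>i. (v i)\<^sup>\<star> * jA a) \<longlongrightarrow> l) F" for a
  proof -
    have "((\<lambda>i. iX (s, \<beta> s (a\<^sup>\<star> * u i))) \<longlongrightarrow> iX (s, \<beta> s (a\<^sup>\<star>))) F"
      using s by (intro iX_tendsto tendsto_star_hom[OF \<beta>_star_hom] approximate_identityD(4)[OF ai])
        (simp_all add: p_\<beta>)
    then have "((\<lambda>i. (iX (s, \<beta> s (a\<^sup>\<star> * u i)))\<^sup>\<star>) \<longlongrightarrow> (iX (s, \<beta> s (a\<^sup>\<star>)))\<^sup>\<star>) F"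
      by (rule tendsto_star)
    moreover have "(iX (s, \<beta> s (a\<^sup>\<star> * u i)))\<^sup>\<star> = (v i)\<^sup>\<star> * jA a" for i
    proof -
      have "iX (s, \<beta> s (a\<^sup>\<star> * u i)) = jA (a\<^sup>\<star>) * v i"
        using s by (simp add: v_def iX_jA p_\<beta> \<beta>_simps)
      then show ?thesis
        by (simp add: star_mult star_star jA_simps)
    qed
    ultimately show ?thesis by auto
  qed
  then have conv2: "\<exists>l. ((\<lambda>i. (v i)\<^sup>\<star> * b) \<longlongrightarrow> l) F" for b
    by (rule conv[rotated]) (simp add: cstar_norm_star v1)
  obtain L where L: "\<And>b. ((\<lambda>i. (v i)\<^sup>\<star> * b) \<longlongrightarrow> L b) F"
    using conv2 by metis
  have "\<exists>l. ((\<lambda>i. b * (v i)\<^sup>\<star>) \<longlongrightarrow> l) F" for b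
  proof -
    obtain l where "((\<lambda>i. v i * b\<^sup>\<star>) \<longlongrightarrow> l) F"
      using conv1 by blast
    then have "((\<lambda>i. (v i * b\<^sup>\<star>)\<^sup>\<star>) \<longlongrightarrow> l\<^sup>\<star>) F"
      by (rule tendsto_star)
    then show ?thesis
      by (auto simp: star_mult star_star)
  qed
  then obtain R where R: "\<And>b. ((\<lambda>i. b * (v i)\<^sup>\<star>) \<longlongrightarrow> R b) F"
    by metis
  have LR: "a * L b = R a * b" for a b
  proof (rule tendsto_unique[OF F])
    show "((\<lambda>i. a * ((v i)\<^sup>\<star> * b)) \<longlongrightarrow> a * L b) F"
      by (intro tendsto_mult tendsto_const L)
    have "((\<lambda>i. (a * (v i)\<^sup>\<star>) * b) \<longlongrightarrow> R a * b) F"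
      by (intro tendsto_mult tendsto_const R)
    then show "((\<lambda>i. a * ((v i)\<^sup>\<star> * b)) \<longlongrightarrow> R a * b) F"
      by (simp add: mult.assoc)
  qed
  define m where "m = Abs_multiplier (L, R)"
  have m: "lmul m = L" "(\<lambda>b. rmul b m) = R"
    unfolding m_def lmul.rep_eq rmul.rep_eq by (simp_all add: Abs_multiplier_inverse LR)
  have lim: "limitin strict_topology (\<lambda>i. mult_embed ((v i)\<^sup>\<star>)) m F"
    using L R m by (simp add: limitin_strict_topology lmul_mult_embed rmul_mult_embed fun_eq_iff)
  moreover have "n = m" if n: "limitin strict_topology (\<lambda>i. mult_embed ((v i)\<^sup>\<star>)) n F" for n
  proof (rule multiplier_eqI)
    fix b
    show "lmul n b = lmul m b"
      using n lim tendsto_unique[OF F, of "\<lambda>i. lmul (mult_embed ((v i)\<^sup>\<star>)) b"]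
      by (simp add: limitin_strict_topology)
  qed
  ultimately have "jP s = m"
    unfolding jP_def strict_lim_def v_def[symmetric] by (intro the_equality)
  with lim show ?thesis
    by (simp add: v_def)
qed

lemma jP_star_limit:
  assumes s: "s \<in> P"
  shows "((\<lambda>i. iX (s, \<beta> s (u i)) * b) \<longlongrightarrow> lmul ((jP s)\<^sup>\<star>) b) F"
proof -
  have "((\<lambda>i. (b\<^sup>\<star> * (iX (s, \<beta> s (u i)))\<^sup>\<star>)\<^sup>\<star>) \<longlongrightarrow> (rmul (b\<^sup>\<star>) (jP s))\<^sup>\<star>) F"
    using jP_limit[OF s] by (intro tendsto_star) (simp add: limitin_strict_topology rmul_mult_embed)
  then show ?thesis
    by (simp add: lmul_star star_mult star_star)
qed

lemma jP_star_jA: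
  assumes s: "s \<in> P"
  shows "lmul ((jP s)\<^sup>\<star>) (jA a) = iX (s, lmul (p s) a)"
proof (rule tendsto_unique[OF approximate_identityD(1)[OF ai] jP_star_limit[OF s]])
  have "((\<lambda>i. iX (s, \<beta> s (u i) * a)) \<longlongrightarrow> iX (s, lmul (p s) a)) F"
    using s by (intro iX_tendsto \<beta>_u_tendsto) (simp_all add: lmul_mult p_\<beta> p_idem)
  then show "((\<lambda>i. iX (s, \<beta> s (u i)) * jA a) \<longlongrightarrow> iX (s, lmul (p s) a)) F"
    using s by (simp add: iX_jA p_\<beta>)
qed

text \<open>The product with i_X(t, \<beta>_t(u_i)) contains \<beta>_s(\<beta>_t(u_i)) =
  \<beta>_st(u_i), whose strict limit p_st absorbs p_s.\<close>

lemma jP_star_iX: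
  assumes s: "s \<in> P" and t: "t \<in> P"
  shows "lmul ((jP t)\<^sup>\<star>) (iX (s, lmul (p s) a)) = cnj (\<omega> s t) *\<^sub>C iX (s \<otimes> t, lmul (p (s \<otimes> t)) a)"
proof (rule tendsto_unique[OF approximate_identityD(1)[OF ai] jP_star_limit[OF t]])
  have st: "s \<otimes> t \<in> P"
    using s t by (rule P_mult)
  have lim: "((\<lambda>i. \<beta> (s \<otimes> t) (u i) * lmul (p s) a) \<longlongrightarrow> lmul (p (s \<otimes> t)) a) F"
    using \<beta>_u_tendsto(1)[OF st, of "lmul (p s) a"] by (simp add: p_mult_absorb s t)
  have "((\<lambda>i. iX (s \<otimes> t, \<beta> (s \<otimes> t) (u i) * lmul (p s) a)) \<longlongrightarrow> iX (s \<otimes> t, lmul (p (s \<otimes> t)) a)) F"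
    using st by (intro iX_tendsto lim) (simp_all add: lmul_mult p_\<beta> p_idem)
  then have "((\<lambda>i. cnj (\<omega> s t) *\<^sub>C iX (s \<otimes> t, \<beta> (s \<otimes> t) (u i) * lmul (p s) a)) \<longlongrightarrow>
      cnj (\<omega> s t) *\<^sub>C iX (s \<otimes> t, lmul (p (s \<otimes> t)) a)) F"
    by (rule tendsto_scaleC)
  moreover have "cnj (\<omega> s t) *\<^sub>C iX (s \<otimes> t, \<beta> (s \<otimes> t) (u i) * lmul (p s) a) =
      iX (t, \<beta> t (u i)) * iX (s, lmul (p s) a)" for i
  proof -
    have "iX (t, \<beta> t (u i)) * iX (s, lmul (p s) a) =
        iX (s \<otimes> t, cnj (\<omega> s t) *\<^sub>C (\<beta> s (\<beta> t (u i)) * lmul (p s) a))"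
      using s t by (intro iX_mult) (simp_all add: p_\<beta> p_idem)
    also have "\<beta> s (\<beta> t (u i)) = \<beta> (s \<otimes> t) (u i)"
      by (simp add: \<beta>_mult s t)
    also have "iX (s \<otimes> t, cnj (\<omega> s t) *\<^sub>C (\<beta> (s \<otimes> t) (u i) * lmul (p s) a)) =
        cnj (\<omega> s t) *\<^sub>C iX (s \<otimes> t, \<beta> (s \<otimes> t) (u i) * lmul (p s) a)"
      using st by (intro iX_scaleC) (simp_all add: lmul_mult p_\<beta>)
    finally show ?thesis ..
  qed
  ultimately show "((\<lambda>i. iX (t, \<beta> t (u i)) * iX (s, lmul (p s) a)) \<longlongrightarrow>
      cnj (\<omega> s t) *\<^sub>C iX (s \<otimes> t, lmul (p (s \<otimes> t)) a)) F"
    by simp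
qed


section \<open>Covariance relations among multipliers\<close>

definition J where "J a = mult_embed (jA a)"

lemma J_hom: "star_hom J"
  unfolding star_hom_def J_def by (simp add: jA_simps star_hom_simps[OF star_hom_mult_embed])

lemmas J_simps = star_hom_simps[OF J_hom]

lemma J_eqI_right:
  assumes "\<And>a. m * J a = n * J a"
  shows "m = n"
proof (rule multiplier_eqI)
  fix b
  have "lmul m (jA a) = lmul n (jA a)" for a
    by (rule mult_embed_inject) (use assms in \<open>simp add: mult_embed_lmul J_def\<close>)
  then have "b \<in> {b. lmul m b = lmul n b}"
    by - (rule jA_induct; simp add: lmul_mult lmul_add lmul_scaleC closed_Collect_eq
        linear_continuous_on bounded_linear_lmul)
  then show "lmul m b = lmul n b" by simp
qed

lemma J_eqI_left:
  assumes "\<And>a. J a * m = J a * n"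
  shows "m = n"
proof -
  have "m\<^sup>\<star> = n\<^sup>\<star>"
  proof (rule J_eqI_right)
    fix a
    have "(J (a\<^sup>\<star>) * m)\<^sup>\<star> = (J (a\<^sup>\<star>) * n)\<^sup>\<star>"
      by (simp only: assms)
    then show "m\<^sup>\<star> * J a = n\<^sup>\<star> * J a"
      by (simp add: star_mult J_simps star_star)
  qed
  then show ?thesis by (metis star_star)
qed

lemma jP_star_J: "s \<in> P \<Longrightarrow> (jP s)\<^sup>\<star> * J a = mult_embed (iX (s, lmul (p s) a))"
  by (simp add: J_def jP_star_jA flip: mult_embed_lmul)

lemma jP_mult:
  assumes s: "s \<in> P" and t: "t \<in> P"
  shows "jP s * jP t = \<omega> s t *\<^sub>C jP (s \<otimes> t)"
proof -
  have "(jP t)\<^sup>\<star> * (jP s)\<^sup>\<star> = cnj (\<omega> s t) *\<^sub>C (jP (s \<otimes> t))\<^sup>\<star>"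
  proof (rule J_eqI_right)
    fix a
    have "(jP t)\<^sup>\<star> * (jP s)\<^sup>\<star> * J a = mult_embed (lmul ((jP t)\<^sup>\<star>) (iX (s, lmul (p s) a)))"
      by (simp add: mult.assoc jP_star_J s mult_embed_lmul)
    then show "(jP t)\<^sup>\<star> * (jP s)\<^sup>\<star> * J a = (cnj (\<omega> s t) *\<^sub>C (jP (s \<otimes> t))\<^sup>\<star>) * J a"
      by (simp add: jP_star_iX s t mult_scaleC_left jP_star_J P_mult
          star_hom_simps[OF star_hom_mult_embed])
  qed
  from arg_cong[OF this, of star] show ?thesis
    by (simp add: star_mult star_star star_scaleC)
qed

text \<open>Tested against J c from the left, the product becomes an inner product of two values of
  \<open>iX\<close>; it is the Toeplitz relation that makes i_P(s) i_P(s)^* act as p_s.\<close>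

lemma jP_jP_star_J:
  assumes s: "s \<in> P"
  shows "jP s * ((jP s)\<^sup>\<star> * J a) = J (lmul (p s) a)"
proof (rule J_eqI_left)
  fix c
  interpret cstar_projection "p s" by (rule projection_p[OF s])
  have "J c * (jP s * ((jP s)\<^sup>\<star> * J a)) = ((jP s)\<^sup>\<star> * J (c\<^sup>\<star>))\<^sup>\<star> * ((jP s)\<^sup>\<star> * J a)"
    by (simp add: star_mult star_star J_simps mult.assoc)
  also have "\<dots> = mult_embed ((iX (s, lmul (p s) (c\<^sup>\<star>)))\<^sup>\<star> * iX (s, lmul (p s) a))"
    by (simp add: jP_star_J s star_hom_simps[OF star_hom_mult_embed])
  also have "\<dots> = J ((lmul (p s) (c\<^sup>\<star>))\<^sup>\<star> * lmul (p s) a)"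
    by (simp add: iX_inner s p_idem J_def)
  also have "(lmul (p s) (c\<^sup>\<star>))\<^sup>\<star> * lmul (p s) a = c * lmul (p s) a"
    by (simp add: star_lmul star_star lmul_idem flip: lmul_rmul)
  finally show "J c * (jP s * ((jP s)\<^sup>\<star> * J a)) = J c * J (lmul (p s) a)"
    by (simp add: J_simps)
qed

lemma jP_star_partial_isometry:
  assumes s: "s \<in> P"
  shows "(jP s)\<^sup>\<star> * (jP s * (jP s)\<^sup>\<star>) = (jP s)\<^sup>\<star>"
proof (rule J_eqI_right)
  fix a
  have "(jP s)\<^sup>\<star> * (jP s * (jP s)\<^sup>\<star>) * J a = (jP s)\<^sup>\<star> * (jP s * ((jP s)\<^sup>\<star> * J a))"
    by (simp only: mult.assoc)
  also have "\<dots> = (jP s)\<^sup>\<star> * J (lmul (p s) a)"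
    by (simp only: jP_jP_star_J[OF s])
  finally show "(jP s)\<^sup>\<star> * (jP s * (jP s)\<^sup>\<star>) * J a = (jP s)\<^sup>\<star> * J a"
    by (simp only: jP_star_J[OF s] p_idem[OF s])
qed

lemma jP_partial_isometry:
  assumes s: "s \<in> P"
  shows "jP s * (jP s)\<^sup>\<star> * jP s = jP s"
  using arg_cong[OF jP_star_partial_isometry[OF s], of star] by (simp add: star_mult star_star)

text \<open>The left action of A on X_s seen through i_P(s). Both the implementation of \<beta>_s
  and the commutation of i_P(s)^* i_P(s) with i_A(a) are derived from it.\<close>

lemma J_jP_star:
  assumes s: "s \<in> P"
  shows "J a * (jP s)\<^sup>\<star> = (jP s)\<^sup>\<star> * J (\<beta> s a)"
proof (rule J_eqI_right)
  fix c
  interpret cstar_projection "p s" by (rule projection_p[OF s])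
  have "rmul (\<beta> s a) (p s) = \<beta> s a"
    using star_lmul[of "\<beta> s (a\<^sup>\<star>)", unfolded p_\<beta>[OF s]] by (simp add: \<beta>_simps s star_star)
  then have "\<beta> s a * lmul (p s) c = lmul (p s) (\<beta> s a * c)"
    using s by (simp add: lmul_rmul lmul_mult p_\<beta>)
  then have eq: "J a * mult_embed (iX (s, lmul (p s) c)) = mult_embed (iX (s, lmul (p s) (\<beta> s a * c)))"
    using s by (simp add: J_def iX_jA p_idem flip: star_hom_simps(3)[OF star_hom_mult_embed])
  have "J a * (jP s)\<^sup>\<star> * J c = J a * mult_embed (iX (s, lmul (p s) c))"
    by (simp only: mult.assoc jP_star_J[OF s])
  also have "\<dots> = (jP s)\<^sup>\<star> * J (\<beta> s a * c)"
    by (simp only: eq jP_star_J[OF s])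
  finally show "J a * (jP s)\<^sup>\<star> * J c = (jP s)\<^sup>\<star> * J (\<beta> s a) * J c"
    by (simp add: J_simps mult.assoc)
qed

lemma jP_J:
  assumes s: "s \<in> P"
  shows "jP s * J a = J (\<beta> s a) * jP s"
  using arg_cong[OF J_jP_star[OF s, of "a\<^sup>\<star>"], of star]
  by (simp add: star_mult star_star J_simps \<beta>_simps s)

lemma J_\<beta>:
  assumes s: "s \<in> P"
  shows "J (\<beta> s a) = jP s * J a * (jP s)\<^sup>\<star>"
  by (simp add: mult.assoc J_jP_star jP_jP_star_J p_\<beta> s)

lemma jP_star_jP_J:
  assumes s: "s \<in> P"
  shows "(jP s)\<^sup>\<star> * jP s * J a = J a * ((jP s)\<^sup>\<star> * jP s)"
  by (simp add: mult.assoc jP_J s) (simp add: J_jP_star s flip: mult.assoc)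

text \<open>The product i_P(s)^* i_A(a) i_P(s), formed with \<open>lmul\<close> and
  \<open>rmul\<close> so that it is an element of the algebra itself, where
  \<open>compact_ext\<close> takes its values.\<close>

definition compact_rep where "compact_rep s a = rmul (lmul ((jP s)\<^sup>\<star>) (jA a)) (jP s)"

lemma mult_embed_compact_rep: "mult_embed (compact_rep s a) = (jP s)\<^sup>\<star> * (J a * jP s)"
  by (simp add: compact_rep_def mult_embed_rmul mult_embed_lmul J_def mult.assoc)

lemma compact_ext_iX:
  assumes s: "s \<in> P" and a: "a \<in> corner (p s)"
  shows "compact_ext X iX s (corner_op (p s) a) = compact_rep s a"
proof -
  interpret cstar_projection "p s" by (rule projection_p[OF s])
  note E = star_hom_simps[OF star_hom_mult_embed] mult_embed_compact_rep
  show ?thesis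
  proof (rule compact_ext_corner_op[OF ai fibre_X])
    fix a b assume "a \<in> corner (p s)" and b: "b \<in> corner (p s)"
    have "mult_embed (compact_rep s a * compact_rep s b) =
        (jP s)\<^sup>\<star> * (J a * ((jP s * ((jP s)\<^sup>\<star> * J b)) * jP s))"
      by (simp add: E mult.assoc)
    also have "\<dots> = mult_embed (compact_rep s (a * b))"
      using b by (simp add: jP_jP_star_J s E J_simps mult.assoc corner_def)
    finally show "compact_rep s (a * b) = compact_rep s a * compact_rep s b"
      by (rule mult_embed_inject[symmetric])
  next
    fix x y assume x: "lmul (p s) x = x" and y: "lmul (p s) y = y"
    have "mult_embed (iX (s, x) * (iX (s, y))\<^sup>\<star>) = ((jP s)\<^sup>\<star> * J x) * ((jP s)\<^sup>\<star> * J y)\<^sup>\<star>"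
      using s x y by (simp add: jP_star_J E)
    also have "\<dots> = mult_embed (compact_rep s (x * y\<^sup>\<star>))"
      by (simp add: E J_simps star_mult star_star mult.assoc)
    finally show "compact_rep s (x * y\<^sup>\<star>) = iX (s, x) * (iX (s, y))\<^sup>\<star>"
      by (rule mult_embed_inject[symmetric])
  qed (rule a | rule mult_embed_inject, simp add: E J_simps distrib_left distrib_right
      mult_scaleC_left mult_scaleC_right star_mult star_star mult.assoc)+
qed

text \<open>Each of the two projections gets its own test element. J d moves past i_P(s)^* i_P(s),
  and then both factors are values of \<open>compact_rep\<close>, at \<beta>_s(c) and \<beta>_t(d),
  to which Nica covariance of \<open>iX\<close> applies.\<close>

lemma jP_nica:
  assumes s: "s \<in> P" and t: "t \<in> P"
  shows "(jP s)\<^sup>\<star> * jP s * ((jP t)\<^sup>\<star> * jP t) =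
    (if join_finite G P s t then (jP (join G P s t))\<^sup>\<star> * jP (join G P s t) else 0)"
proof (rule J_eqI_left, rule J_eqI_left)
  fix d c
  note E = star_hom_simps[OF star_hom_mult_embed]
  have corner: "\<beta> s a \<in> corner (p s)" if "s \<in> P" for s a
    using \<beta>_corner[OF P_one that, of a] that by (simp add: corner_def p_one lmul_one rmul_one P_carrier)
  have compact_rep: "mult_embed (compact_rep s (\<beta> s a)) = J a * ((jP s)\<^sup>\<star> * jP s)" if "s \<in> P" for s a
    using J_jP_star[OF that, of a] by (simp add: mult_embed_compact_rep flip: mult.assoc)
  have "J c * (J d * ((jP s)\<^sup>\<star> * jP s * ((jP t)\<^sup>\<star> * jP t))) =
      J c * ((J d * ((jP s)\<^sup>\<star> * jP s)) * ((jP t)\<^sup>\<star> * jP t))"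
    by (simp add: mult.assoc)
  also have "\<dots> = mult_embed (compact_rep s (\<beta> s c)) * mult_embed (compact_rep t (\<beta> t d))"
    unfolding jP_star_jP_J[OF s, symmetric] by (simp add: compact_rep s t mult.assoc)
  also have "\<dots> = (if join_finite G P s t then mult_embed (compact_rep (join G P s t)
      (\<beta> (join G P s t \<otimes> inv s) (\<beta> s c) * \<beta> (join G P s t \<otimes> inv t) (\<beta> t d))) else 0)"
  proof -
    have nica: "nica_covariant G P X iX"
      using nica_toeplitz by (simp add: nica_toeplitz_rep_def)
    have "\<forall>s\<in>P. \<forall>t\<in>P. \<forall>a\<in>corner (p s). \<forall>b\<in>corner (p t). compact_rep s a * compact_rep t b =
        (if join_finite G P s t then compact_rep (join G P s t)
           (\<beta> (join G P s t \<otimes> inv s) a * \<beta> (join G P s t \<otimes> inv t) b) else 0)"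
      by (rule iffD1[OF nica_covariant_X[of iX compact_rep]], rule compact_ext_iX, assumption, assumption, rule nica)
    from this[rule_format, OF s t corner[OF s, of c] corner[OF t, of d]] show ?thesis
      by (simp add: E(5) flip: E(3))
  qed
  also have "\<dots> = J c * (J d * (if join_finite G P s t then (jP (join G P s t))\<^sup>\<star> * jP (join G P s t) else 0))"
  proof (cases "join_finite G P s t")
    case True
    \<comment> \<open>As j = (j s^{-1}) s = (j t^{-1}) t, the argument becomes \<beta>_j(c d), and
      the formula \<open>compact_rep\<close> is read backwards at j.\<close>
    note j = join_props[OF True s t]
    show ?thesis
      using True j s t
      by (simp add: compact_rep J_simps mult.assoc flip: \<beta>_mult \<beta>_simps)
  qed simp
  finally show "J c * (J d * ((jP s)\<^sup>\<star> * jP s * ((jP t)\<^sup>\<star> * jP t))) = \<dots>" .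
qed

section \<open>The axioms of the crossed product\<close>

lemma nt_covariant_rep_mult_ext:
  fixes \<sigma> :: "'b \<Rightarrow> 'h::complex_hilbert_space bop"
  assumes \<sigma>: "nondegenerate_rep \<sigma>"
  shows "nt_covariant_rep G P \<beta> \<omega> (\<sigma> \<circ> jA) (mult_ext \<sigma> \<circ> jP)"
proof -
  define S where "S = mult_ext \<sigma>"
  have S: "star_hom S" "\<And>b. S (mult_embed b) = \<sigma> b"
    unfolding S_def by (rule star_hom_mult_ext[OF \<sigma> jA_approximate_identity])
      (rule mult_ext_embed[OF \<sigma> jA_approximate_identity])
  note S_simps = star_hom_simps[OF S(1)]
  have \<pi>: "\<sigma> \<circ> jA = S \<circ> J"
    by (simp add: fun_eq_iff J_def S(2))
  have "nondegenerate_rep (\<sigma> \<circ> jA)"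
    unfolding nondegenerate_rep_def
  proof (intro conjI)
    show "star_hom (\<sigma> \<circ> jA)"
      using \<sigma> by (simp add: nondegenerate_rep_def star_hom_def jA_simps)
    \<comment> \<open>h is the limit of \<sigma>(i_A(u_i)) h, because i_A(u_i) is an approximate
      identity of the whole algebra.\<close>
    have "h \<in> closure (cspan {bop_apply ((\<sigma> \<circ> jA) a) h | a h. True})" (is "_ \<in> closure ?Z") for h
    proof (rule Lim_in_closed_set[OF closed_closure _ approximate_identityD(1)[OF ai]])
      show "((\<lambda>i. bop_apply (\<sigma> (jA (u i))) h) \<longlongrightarrow> h) F"
        by (rule nondegenerate_rep_approximate_identity[OF \<sigma> jA_approximate_identity])
      have "1 *\<^sub>C bop_apply (\<sigma> (jA (u i))) h \<in> ?Z" for i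
        unfolding cspan_def comp_def by (intro span_base) blast
      then have "bop_apply (\<sigma> (jA (u i))) h \<in> ?Z" for i
        by (simp add: scaleC_one)
      then show "\<forall>\<^sub>F i in F. bop_apply (\<sigma> (jA (u i))) h \<in> closure ?Z"
        using closure_subset by (intro always_eventually allI) blast
    qed
    then show "closure (cspan {bop_apply ((\<sigma> \<circ> jA) a) h |a h. True}) = UNIV"
      by blast
  qed
  then show ?thesis
    \<comment> \<open>All relations hold among multipliers already, and the *-homomorphism S carries
      them over.\<close>
    unfolding nt_covariant_rep_def partial_isometry_def S_def[symmetric]
    unfolding \<pi>
    unfolding o_def S_simps(2,3,4)[symmetric]
    by (simp add: S_simps(5) jP_partial_isometry jP_mult jP_nica if_distrib[of S] flip: J_\<beta> jP_star_jP_J)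
qed

lemma mult_ext_jP:
  fixes \<rho> :: "'b \<Rightarrow> 'h::complex_hilbert_space bop"
  assumes cov: "nt_covariant_rep G P \<beta> \<omega> \<pi> V" and \<rho>: "star_hom \<rho>"
    and eq: "\<And>s x. s \<in> P \<Longrightarrow> lmul (p s) x = x \<Longrightarrow> \<rho> (iX (s, x)) = (V s)\<^sup>\<star> * \<pi> x"
  shows "\<rho> \<circ> jA = \<pi>" and "s \<in> P \<Longrightarrow> mult_ext \<rho> (jP s) = V s"
proof -
  interpret nt_covariant_representation G P \<beta> \<omega> F u \<pi> V
    by unfold_locales (rule cov)
  have "lmul (p \<one>) a = a" for a
    by (simp only: p_one lmul_one)
  then show jA: "\<rho> \<circ> jA = \<pi>"
    by (simp add: fun_eq_iff jA_def eq P_one V_one_star)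
  \<comment> \<open>\<rho> takes all values of \<pi> and so inherits nondegeneracy, which makes
    \<open>mult_ext\<close> \<rho> a genuine extension.\<close>
  have "cspan {bop_apply (\<pi> a) h | a h. True} \<subseteq> cspan {bop_apply (\<rho> b) h | b h. True}"
    unfolding cspan_def jA[symmetric] by (intro span_mono) auto
  then have "nondegenerate_rep \<rho>"
    using closure_mono[of "cspan {bop_apply (\<pi> a) h | a h. True}"] \<pi>_nondegenerate \<rho>
    unfolding nondegenerate_rep_def by blast
  note S = star_hom_mult_ext[OF this jA_approximate_identity] mult_ext_embed[OF this jA_approximate_identity]
  show "mult_ext \<rho> (jP s) = V s" if s: "s \<in> P"
  proof -
    \<comment> \<open>The known formula concerns the adjoint of i_P(s) on i_A(a), so the adjoints
      are compared on the dense span of \<pi>(A) H.\<close>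
    have "(mult_ext \<rho> (jP s))\<^sup>\<star> = (V s)\<^sup>\<star>"
    proof (rule nondegenerate_rep_eqI[OF \<pi>_nondegenerate])
      fix a
      have "(mult_ext \<rho> (jP s))\<^sup>\<star> * \<pi> a = mult_ext \<rho> ((jP s)\<^sup>\<star> * J a)"
        by (simp add: star_hom_simps[OF S(1)] S(2) J_def flip: jA)
      also have "\<dots> = (V s)\<^sup>\<star> * \<pi> (lmul (p s) a)"
        using s by (simp add: jP_star_J S(2) eq p_idem)
      finally show "(mult_ext \<rho> (jP s))\<^sup>\<star> * \<pi> a = (V s)\<^sup>\<star> * \<pi> a"
        using psi_lmul_p[OF s, of a] by (simp add: psi_apply)
    qed
    then show ?thesis by (metis star_star)
  qed
qed

text \<open>i_X(s, x) is the adjoint of i_A(b) i_P(s) with b = x^*, so a C*-subalgebra containing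
  the new generators contains the old ones.\<close>

lemma cstar_generated_jA_jP: "cstar_generated {rmul (jA a) (jP s) | a s. s \<in> P} = UNIV"
proof -
  have sub: "{iX (s, x) | s x. s \<in> P \<and> x \<in> hcarrier (fibre X s)} \<subseteq> C"
    if C: "cstar_subalgebra C" "{rmul (jA a) (jP s) | a s. s \<in> P} \<subseteq> C" for C
  proof safe
    fix s x assume s: "s \<in> P" and x: "x \<in> hcarrier (fibre X s)"
    have "(rmul (jA (x\<^sup>\<star>)) (jP s))\<^sup>\<star> = lmul ((jP s)\<^sup>\<star>) (jA x)"
      by (simp add: lmul_star jA_simps)
    then have "iX (s, x) = (rmul (jA (x\<^sup>\<star>)) (jP s))\<^sup>\<star>"
      using x s by (simp add: jP_star_jA hcarrier_X)
    moreover have "rmul (jA (x\<^sup>\<star>)) (jP s) \<in> C"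
      using C s by blast
    ultimately show "iX (s, x) \<in> C"
      using C by (simp add: cstar_subalgebra_def)
  qed
  have "C = UNIV" if C: "cstar_subalgebra C" "{rmul (jA a) (jP s) | a s. s \<in> P} \<subseteq> C" for C
  proof -
    have "cstar_generated {iX (s, x) | s x. s \<in> P \<and> x \<in> hcarrier (fibre X s)} \<subseteq> C"
      unfolding cstar_generated_def by (intro Inter_lower CollectI conjI C(1) sub[OF C])
    then show ?thesis
      by (simp add: generated top.extremum_uniqueI)
  qed
  then show ?thesis
    unfolding cstar_generated_def by auto
qed

end

theorem proposition9p2:
  fixes G :: "('g, 'm) monoid_scheme" and P :: "'g set"
    and \<beta> :: "'g \<Rightarrow> 'a::cstar_algebra \<Rightarrow> 'a" and \<omega> :: "'g \<Rightarrow> 'g \<Rightarrow> complex"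
    and iX :: "'g \<times> 'a \<Rightarrow> 'b::cstar_algebra"
    and F :: "'i filter" and u :: "'i \<Rightarrow> 'a"
  assumes "group G" and "submonoid P G" and "countable P"
    and "opp_quasi_lattice_ordered G P"
    and "separable_space (euclidean :: 'a topology)"
    and "twisted_system G P \<beta> \<omega>"
    and "universal_nica_toeplitz_rep TYPE('h::complex_hilbert_space bop) G P
           (twisted_product_system G \<beta> \<omega>) iX"
    and "approximate_identity F u"
  shows "nt_crossed_product TYPE('h) G P \<beta> \<omega>
           (\<lambda>a. iX (\<one>\<^bsub>G\<^esub>, a))
           (\<lambda>s. strict_lim F (\<lambda>i. mult_embed ((iX (s, \<beta> s (u i)))\<^sup>\<star>)))"
proof -
  interpret generating_nica_toeplitz_rep G P \<beta> \<omega> F u iX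
    using assms
    by (auto simp: generating_nica_toeplitz_rep_def generating_nica_toeplitz_rep_axioms_def
        twisted_semigroup_system_def universal_nica_toeplitz_rep_def)
  have eq: "(\<lambda>a. iX (\<one>\<^bsub>G\<^esub>, a)) = jA" "(\<lambda>s. strict_lim F (\<lambda>i. mult_embed ((iX (s, \<beta> s (u i)))\<^sup>\<star>))) = jP"
    by (simp_all add: jA_def[abs_def] jP_def[abs_def])
  have "\<exists>\<rho> :: 'b \<Rightarrow> 'h bop. star_hom \<rho> \<and> \<rho> \<circ> jA = \<pi> \<and> (\<forall>s\<in>P. mult_ext \<rho> (jP s) = V s)"
    if cov: "nt_covariant_rep G P \<beta> \<omega> \<pi> V" for \<pi> :: "'a \<Rightarrow> 'h bop" and V
  proof -
    interpret V: nt_covariant_representation G P \<beta> \<omega> F u \<pi> V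
      by unfold_locales (rule cov)
    \<comment> \<open>The universal property is applied with B(H) as the target algebra.\<close>
    obtain \<rho> :: "'b \<Rightarrow> 'h bop" where \<rho>: "star_hom \<rho>"
      "\<And>s x. s \<in> P \<Longrightarrow> x \<in> hcarrier (fibre X s) \<Longrightarrow> V.psi (s, x) = \<rho> (iX (s, x))"
      using assms(7) V.nica_toeplitz_rep_psi unfolding universal_nica_toeplitz_rep_def by blast
    then have "\<rho> (iX (s, x)) = (V s)\<^sup>\<star> * \<pi> x" if "s \<in> P" "lmul (p s) x = x" for s x
      using \<rho>(2)[of s x] that by (simp add: hcarrier_X V.psi_apply)
    from mult_ext_jP[OF cov \<rho>(1) this] \<rho>(1) show ?thesis
      by blast
  qed
  then show ?thesis
    unfolding nt_crossed_product_def eq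
    using jA_nondegenerate nt_covariant_rep_mult_ext cstar_generated_jA_jP by blast
qed

end
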